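(* There is an absolute constant $C>0$ such that for every field $\mathbb{F}$ and every positive integer $N$, every set of $N$ planes ($2$-flats) in $\mathbb{F}^6$ has at most $C N^{3/2}$ joints.
   Context: A $k$-flat in $\mathbb{F}^d$ is a $k$-dimensional affine subspace; a plane is a $2$-flat. Given a set of planes in $\mathbb{F}^6$, a joint is a point of $\mathbb{F}^6$ that is contained in some three of these planes which do not all lie in a common (affine) hyperplane. Each point is counted as a joint at most once. The field $\mathbb{F}$ is arbitrary and constants do not depend on $\mathbb{F}$. *)

theory Defs
  imports Complex_Main "HOL-Library.FuncSet" "HOL-Algebra.Ring"
begin

text \<open>The points of \<open>F\<^sup>d\<close> are the functions on \<open>{..<d}\<close> with values in the carrier of \<open>F\<close>,
  extended by \<open>undefined\<close> so that they are determined by their \<open>d\<close> coordinates.\<close>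

definition affine_space :: "('a, 'm) ring_scheme \<Rightarrow> nat \<Rightarrow> (nat \<Rightarrow> 'a) set" where
  "affine_space F d = {..<d} \<rightarrow>\<^sub>E carrier F"

definition lin_indep :: "('a, 'm) ring_scheme \<Rightarrow> nat \<Rightarrow> nat \<Rightarrow> (nat \<Rightarrow> nat \<Rightarrow> 'a) \<Rightarrow> bool" where
  "lin_indep F d k v \<longleftrightarrow>
     (\<forall>c \<in> {..<k} \<rightarrow> carrier F.
        (\<forall>i<d. (\<Oplus>\<^bsub>F\<^esub>j\<in>{..<k}. c j \<otimes>\<^bsub>F\<^esub> v j i) = \<zero>\<^bsub>F\<^esub>) \<longrightarrow> (\<forall>j<k. c j = \<zero>\<^bsub>F\<^esub>))"

text \<open>A \<open>k\<close>-flat in \<open>F\<^sup>d\<close> is a translate \<open>p + span (v\<^sub>0, \<dots>, v\<^sub>k\<^sub>-\<^sub>1)\<close> of the span of \<open>k\<close> linearly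
  independent vectors.\<close>

definition flat :: "('a, 'm) ring_scheme \<Rightarrow> nat \<Rightarrow> nat \<Rightarrow> (nat \<Rightarrow> 'a) set \<Rightarrow> bool" where
  "flat F d k A \<longleftrightarrow>
     (\<exists>p \<in> affine_space F d. \<exists>v \<in> {..<k} \<rightarrow> affine_space F d.
        lin_indep F d k v \<and>
        A = (\<lambda>c. \<lambda>i\<in>{..<d}. p i \<oplus>\<^bsub>F\<^esub> (\<Oplus>\<^bsub>F\<^esub>j\<in>{..<k}. c j \<otimes>\<^bsub>F\<^esub> v j i)) ` ({..<k} \<rightarrow> carrier F))"

abbreviation plane :: "('a, 'm) ring_scheme \<Rightarrow> nat \<Rightarrow> (nat \<Rightarrow> 'a) set \<Rightarrow> bool" where
  "plane F d A \<equiv> flat F d 2 A"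

abbreviation hyperplane :: "('a, 'm) ring_scheme \<Rightarrow> nat \<Rightarrow> (nat \<Rightarrow> 'a) set \<Rightarrow> bool" where
  "hyperplane F d H \<equiv> flat F d (d - 1) H"

definition joints :: "('a, 'm) ring_scheme \<Rightarrow> (nat \<Rightarrow> 'a) set set \<Rightarrow> (nat \<Rightarrow> 'a) set" where
  "joints F Q =
     {x \<in> affine_space F 6.
        \<exists>A\<in>Q. \<exists>B\<in>Q. \<exists>D\<in>Q. A \<noteq> B \<and> A \<noteq> D \<and> B \<noteq> D \<and> x \<in> A \<and> x \<in> B \<and> x \<in> D \<and>
          \<not> (\<exists>H. hyperplane F 6 H \<and> A \<subseteq> H \<and> B \<subseteq> H \<and> D \<subseteq> H)}"

text \<open>Finiteness of the set of joints is part of the bound, because \<^const>\<open>card\<close> is \<open>0\<close> on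
  infinite sets.\<close>

definition joints_bound :: "('a, 'm) ring_scheme \<Rightarrow> real \<Rightarrow> bool" where
  "joints_bound F C \<longleftrightarrow>
     (\<forall>N::nat. N > 0 \<longrightarrow>
        (\<forall>Q. (\<forall>A\<in>Q. plane F 6 A) \<and> finite Q \<and> card Q = N \<longrightarrow>
           finite (joints F Q) \<and> real (card (joints F Q)) \<le> C * real N powr (3 / 2)))"

text \<open>HOL cannot place a quantifier over all types inside an existential quantifier, so in
  \<open>\<exists>C. \<forall>F :: 'a ring. \<dots>\<close> the constant could depend on \<open>'a\<close>. To say that one constant serves the
  fields over every type, it has to be a closed term of type \<^typ>\<open>real\<close>. We take any positive
  constant that serves all fields whose carrier is a set of natural numbers; if there were none,
  \<open>SOME\<close> would give a real number about which nothing is known. Naming this number loses no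
  generality: finitely many planes and joints are defined over a finitely generated, hence
  countable, subfield, so a constant serves all fields if and only if it serves these.\<close>

definition joints_constant :: real where
  "joints_constant = (SOME C. C > 0 \<and> (\<forall>F :: nat ring. field F \<longrightarrow> joints_bound F C))"

end

theory Submission
  imports Defs "HOL-Library.Poly_Mapping" "HOL-Library.Function_Algebras"
    "HOL-Library.Product_Lexorder" "HOL-Library.Numeral_Type" "HOL-Library.Countable_Set"
    "HOL-Algebra.Weak_Morphisms" "HOL-Algebra.Subrings"
begin

text \<open>The proof follows the handicap method of Tidor, Yu and Zhao. Fix a large degree \<open>n\<close>. On each
  plane, process the vanishing conditions (Taylor coefficients at the joints on that plane, in order
  of increasing total degree, delayed at each joint by its handicap) and keep those that are not
  implied by earlier ones. The kept conditions form a basis of the dual of the polynomials of degree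
  \<open>n\<close> on the plane, so about \<open>n\<^sup>2 / 2\<close> of them are kept. At a joint of three planes, impose on a
  polynomial in six variables the products of the conditions that were kept on the three planes. A
  polynomial of degree \<open>n\<close> satisfying all of them vanishes: otherwise look at a lowest-order
  monomial at the joint whose vanishing order plus handicap is smallest. Hence the sum over all
  joints of the product of the three numbers of kept conditions has order at least \<open>n\<^sup>6\<close>. Handicaps
  can be chosen so that no product is far above the average, and the bound follows by comparing with
  the number of conditions that are kept on all planes.

  The constant in the statement is only known to serve the fields over the natural numbers. It serves
  every field, because a configuration is defined over a countable subfield.\<close>

section \<open>Polynomials\<close>

text \<open>The three numbers at a joint cannot be prescribed, since each depends on all the points
  of its plane; but they react slowly. Raising a handicap by \<open>M\<close> costs at most about
  \<open>J * n\<close> conditions on each plane, where \<open>J\<close> bounds the number of joints,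
  so the product at that joint drops by order \<open>J * n ^ 5\<close>, while the average product is
  at least of order \<open>n ^ 6 / J\<close>. With \<open>n\<close> of order \<open>J ^ 2\<close>, a
  joint that is raised only when its product is high keeps a product of at least order
  \<open>n ^ 6 / J\<close>. The comparison then uses only the largest of the three numbers, which is
  at least of order \<open>n ^ 2\<close> divided by the cube root of \<open>J\<close>. Up to a
  constant, the number of joints is therefore at most the cube root of \<open>J\<close> times the
  number of planes. This form, with \<open>J\<close> fixed, adds up over groups of joints that share
  no plane. That matters because the handicaps of unrelated groups may drift apart without bound, so
  the raising controls only one group at a time.\<close>

type_synonym ('i, 'r) mpoly = "('i \<Rightarrow> nat) \<Rightarrow>\<^sub>0 'r"

abbreviation cf :: "('b \<Rightarrow>\<^sub>0 'r::zero) \<Rightarrow> 'b \<Rightarrow> 'r" where "cf \<equiv> Poly_Mapping.lookup"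

abbreviation Const :: "'r::zero \<Rightarrow> ('i, 'r) mpoly" where "Const a \<equiv> Poly_Mapping.single 0 a"

definition Var :: "'i \<Rightarrow> ('i, 'r::zero_neq_one) mpoly" where
  "Var i = Poly_Mapping.single (\<lambda>j. if j = i then 1 else 0) 1"

lemma mpoly_induct [case_names single add]:
  fixes f :: "'b \<Rightarrow>\<^sub>0 'r::comm_monoid_add"
  assumes single: "\<And>m a. P (Poly_Mapping.single m a)"
    and add: "\<And>f g. P f \<Longrightarrow> P g \<Longrightarrow> P (f + g)"
  shows "P f"
proof (induction f rule: Poly_Mapping.update_induct)
  case const
  show ?case using single[of _ 0] by simp
next
  case (update f a b)
  have "Poly_Mapping.update a b f = f + Poly_Mapping.single a b"
    by (rule poly_mapping_eqI)
      (use update(1) in \<open>auto simp: lookup_update lookup_add lookup_single when_def in_keys_iff\<close>)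
  then show ?case using add[OF update(3) single] by simp
qed

definition subst :: "('i::finite \<Rightarrow> ('j, 'r) mpoly) \<Rightarrow> ('i, 'r) mpoly \<Rightarrow> ('j, 'r::comm_ring_1) mpoly" where
  "subst x f = (\<Sum>m\<in>Poly_Mapping.keys f. Const (cf f m) * (\<Prod>i\<in>UNIV. x i ^ m i))"

lemma subst_superset:
  assumes "finite A" "Poly_Mapping.keys f \<subseteq> A"
  shows "subst x f = (\<Sum>m\<in>A. Const (cf f m) * (\<Prod>i\<in>UNIV. x i ^ m i))"
  unfolding subst_def using assms by (intro sum.mono_neutral_left) (auto simp: in_keys_iff)

lemma subst_zero [simp]: "subst x 0 = 0"
  by (simp add: subst_def)

lemma subst_single: "subst x (Poly_Mapping.single m a) = Const a * (\<Prod>i\<in>UNIV. x i ^ m i)"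
  by (subst subst_superset[of "{m}"]) auto

lemma subst_add: "subst x (f + g) = subst x f + subst x g"
proof -
  let ?A = "Poly_Mapping.keys f \<union> Poly_Mapping.keys g"
  have "subst x (f + g) = (\<Sum>m\<in>?A. Const (cf (f + g) m) * (\<Prod>i\<in>UNIV. x i ^ m i))"
    by (rule subst_superset) (simp_all add: Poly_Mapping.keys_add)
  then show ?thesis
    by (simp add: subst_superset[of ?A] lookup_add single_add distrib_right sum.distrib)
qed

lemma subst_sum: "subst x (sum f A) = (\<Sum>a\<in>A. subst x (f a))"
  by (induction A rule: infinite_finite_induct) (auto simp: subst_add)

lemma subst_Const [simp]: "subst x (Const a) = Const a"
  by (simp add: subst_single)

lemma Const_mult: "Const (a * b) = (Const a * Const b :: ('i, 'r::comm_ring_1) mpoly)"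
  by (simp add: mult_single)

lemma subst_mult: "subst x (f * g) = subst x f * subst x g"
proof (induction f rule: mpoly_induct)
  case (single m a)
  show ?case
  proof (induction g rule: mpoly_induct)
    case (single m' b)
    show ?case unfolding mult_single by (simp add: subst_single Const_mult power_add prod.distrib mult_ac)
  next
    case (add g h)
    then show ?case by (simp add: distrib_left subst_add)
  qed
next
  case (add f g)
  then show ?case by (simp add: distrib_right subst_add)
qed

lemma subst_one [simp]: "subst x 1 = 1"
  using subst_Const[of x 1] by simp

lemma subst_power: "subst x (f ^ k) = subst x f ^ k"
  by (induction k) (auto simp: subst_mult)

lemma subst_prod: "subst x (prod f A) = (\<Prod>a\<in>A. subst x (f a))"
  by (induction A rule: infinite_finite_induct) (auto simp: subst_mult)

lemma subst_Var [simp]: "subst x (Var i) = x i"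
proof -
  have "(\<Prod>j\<in>UNIV. x j ^ (if j = i then 1 else 0)) = (\<Prod>j\<in>UNIV. if j = i then x j else 1)"
    by (intro prod.cong) auto
  then show ?thesis by (simp add: Var_def subst_single)
qed

lemma subst_subst: "subst y (subst x f) = subst (\<lambda>i. subst y (x i)) f"
proof (induction f rule: mpoly_induct)
  case (single m a)
  show ?case by (simp add: subst_single subst_mult subst_prod subst_power)
qed (simp add: subst_add)

lemma single_power: "Poly_Mapping.single m 1 ^ k = (Poly_Mapping.single (\<lambda>i. k * m i) 1 :: ('i, 'r::comm_ring_1) mpoly)"
proof (induction k)
  case 0
  show ?case by (simp add: zero_fun_def[symmetric])
next
  case (Suc k)
  then show ?case by (simp add: mult_single plus_fun_def)
qed

lemma prod_single: "(\<Prod>i\<in>A. Poly_Mapping.single (m i) (1::'r::comm_ring_1)) = Poly_Mapping.single (\<Sum>i\<in>A. m i) 1"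
  by (induction A rule: infinite_finite_induct) (auto simp: mult_single)

lemma sum_fun_apply: "(\<Sum>a\<in>A. f a) x = (\<Sum>a\<in>A. f a x)"
  by (induction A rule: infinite_finite_induct) auto

lemma single_conv_Var:
  "Poly_Mapping.single m a = (Const a * (\<Prod>i\<in>UNIV. Var i ^ m i) :: ('i::finite, 'r::comm_ring_1) mpoly)"
proof -
  have "(\<Sum>i\<in>UNIV. (\<lambda>j. m i * (if j = i then 1 else 0))) = m"
    by (rule ext) (simp add: sum_fun_apply if_distrib[of "(*) _"] cong: if_cong)
  then show ?thesis
    by (simp add: Var_def single_power prod_single mult_single)
qed

lemma subst_Var_id [simp]: "subst Var f = f"
  by (induction f rule: mpoly_induct) (simp_all add: subst_single single_conv_Var[symmetric] subst_add)

section \<open>Total degree and order of vanishing\<close>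

definition tdeg :: "('i::finite \<Rightarrow> nat) \<Rightarrow> nat" where "tdeg m = (\<Sum>i\<in>UNIV. m i)"

lemma tdeg_add: "tdeg (m + m') = tdeg m + tdeg m'"
  by (simp add: tdeg_def sum.distrib)

lemma tdeg_0 [simp]: "tdeg 0 = 0"
  by (simp add: tdeg_def)

lemma tdeg_zero_iff: "tdeg m = 0 \<longleftrightarrow> m = 0"
  by (auto simp: tdeg_def fun_eq_iff)

lemma finite_exponents: "finite {m :: 'i::finite \<Rightarrow> nat. \<forall>i. m i \<le> n}"
proof -
  have "{m :: 'i \<Rightarrow> nat. \<forall>i. m i \<le> n} = PiE UNIV (\<lambda>_. {..n})"
    by (auto simp: PiE_def Pi_def)
  then show ?thesis by (simp add: finite_PiE)
qed

lemma card_exponents: "card {m :: 'i::finite \<Rightarrow> nat. \<forall>i. m i \<le> n} = (n + 1) ^ CARD('i)"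
proof -
  have "{m :: 'i \<Rightarrow> nat. \<forall>i. m i \<le> n} = PiE UNIV (\<lambda>_. {..n})"
    by (auto simp: PiE_def Pi_def)
  then show ?thesis by (simp add: card_PiE)
qed

lemma le_tdeg: "m i \<le> tdeg m"
  unfolding tdeg_def by (rule member_le_sum) auto

lemma finite_tdeg_le: "finite {m :: 'i::finite \<Rightarrow> nat. tdeg m \<le> n}"
  by (rule finite_subset[OF _ finite_exponents[of n]]) (auto intro: order_trans[OF le_tdeg])

definition deg_le :: "nat \<Rightarrow> ('i::finite, 'r::zero) mpoly \<Rightarrow> bool" where
  "deg_le n f \<longleftrightarrow> (\<forall>m. cf f m \<noteq> 0 \<longrightarrow> tdeg m \<le> n)"

definition ord_ge :: "nat \<Rightarrow> ('i::finite, 'r::zero) mpoly \<Rightarrow> bool" where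
  "ord_ge d f \<longleftrightarrow> (\<forall>m. cf f m \<noteq> 0 \<longrightarrow> d \<le> tdeg m)"

lemma deg_le_mono: "deg_le n f \<Longrightarrow> n \<le> n' \<Longrightarrow> deg_le n' f"
  by (auto simp: deg_le_def)

lemma ord_ge_mono: "ord_ge d f \<Longrightarrow> d' \<le> d \<Longrightarrow> ord_ge d' f"
  by (auto simp: ord_ge_def)

lemma deg_le_zero [simp]: "deg_le n 0" by (simp add: deg_le_def)
lemma ord_ge_zero [simp]: "ord_ge n 0" by (simp add: ord_ge_def)
lemma ord_ge_0 [simp]: "ord_ge 0 f" by (simp add: ord_ge_def)

lemma deg_le_add: "deg_le n f \<Longrightarrow> deg_le n g \<Longrightarrow> deg_le n (f + g)"
  unfolding deg_le_def lookup_add by (metis add.right_neutral)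

lemma ord_ge_add: "ord_ge n f \<Longrightarrow> ord_ge n g \<Longrightarrow> ord_ge n (f + g)"
  unfolding ord_ge_def lookup_add by (metis add.right_neutral)

lemma deg_le_sum: "(\<And>a. a \<in> A \<Longrightarrow> deg_le n (f a)) \<Longrightarrow> deg_le n (sum f A)"
  by (induction A rule: infinite_finite_induct) (auto intro: deg_le_add)

lemma ord_ge_sum: "(\<And>a. a \<in> A \<Longrightarrow> ord_ge n (f a)) \<Longrightarrow> ord_ge n (sum f A)"
  by (induction A rule: infinite_finite_induct) (auto intro: ord_ge_add)

lemma cf_mult_nonzero:
  assumes "cf (f * g) m \<noteq> 0"
  obtains a b where "m = a + b" "cf f a \<noteq> 0" "cf g b \<noteq> 0"
  using keys_mult[of f g] assms by (auto simp: in_keys_iff)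

lemma deg_le_mult: "deg_le a f \<Longrightarrow> deg_le b g \<Longrightarrow> deg_le (a + b) (f * g)"
  unfolding deg_le_def[of "a + b"]
  by (auto elim!: cf_mult_nonzero simp: tdeg_add deg_le_def intro!: add_mono)

lemma ord_ge_mult: "ord_ge a f \<Longrightarrow> ord_ge b g \<Longrightarrow> ord_ge (a + b) (f * g)"
  unfolding ord_ge_def[of "a + b"]
  by (auto elim!: cf_mult_nonzero simp: tdeg_add ord_ge_def intro!: add_mono)

lemma deg_le_Const [simp]: "deg_le n (Const a)"
  by (auto simp: deg_le_def lookup_single when_def)

lemma deg_le_one [simp]: "deg_le n (1 :: ('i::finite, 'r::comm_ring_1) mpoly)"
  by (metis deg_le_Const single_one)

lemma tdeg_unit: "tdeg (\<lambda>j. if j = i then 1 else 0) = 1"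
  by (simp add: tdeg_def)

lemma deg_le_Var [simp]: "deg_le (Suc 0) (Var i)"
  using tdeg_unit[of i] by (auto simp: deg_le_def Var_def lookup_single when_def)

lemma ord_ge_Var [simp]: "ord_ge (Suc 0) (Var i)"
  using tdeg_unit[of i] by (auto simp: ord_ge_def Var_def lookup_single when_def)

lemma deg_le_Const_mult: "deg_le n f \<Longrightarrow> deg_le n (Const a * f)"
  using deg_le_mult[of 0 "Const a"] by simp

lemma ord_ge_Const_mult: "ord_ge n f \<Longrightarrow> ord_ge n (Const a * f)"
  using ord_ge_mult[of 0 "Const a"] by simp

lemma deg_le_power: "deg_le 1 f \<Longrightarrow> deg_le k (f ^ k)"
  for f :: "('i::finite, 'r::comm_ring_1) mpoly"
  by (induction k) (auto dest: deg_le_mult)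

lemma ord_ge_power: "ord_ge 1 f \<Longrightarrow> ord_ge k (f ^ k)"
  for f :: "('i::finite, 'r::comm_ring_1) mpoly"
  by (induction k) (auto dest: ord_ge_mult)

lemma deg_le_prod:
  fixes f :: "'b \<Rightarrow> ('i::finite, 'r::comm_ring_1) mpoly"
  shows "(\<And>a. a \<in> A \<Longrightarrow> deg_le (n a) (f a)) \<Longrightarrow> deg_le (sum n A) (prod f A)"
  by (induction A rule: infinite_finite_induct) (auto intro: deg_le_mult)

lemma ord_ge_prod:
  fixes f :: "'b \<Rightarrow> ('i::finite, 'r::comm_ring_1) mpoly"
  shows "(\<And>a. a \<in> A \<Longrightarrow> ord_ge (n a) (f a)) \<Longrightarrow> ord_ge (sum n A) (prod f A)"
  by (induction A rule: infinite_finite_induct) (auto intro: ord_ge_mult)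

lemma deg_le_subst:
  assumes "deg_le n f" "\<And>i. deg_le 1 (x i)"
  shows "deg_le n (subst x f)"
  unfolding subst_def
proof (intro deg_le_sum deg_le_Const_mult)
  fix m assume "m \<in> Poly_Mapping.keys f"
  then have "tdeg m \<le> n" using assms(1) by (auto simp: deg_le_def in_keys_iff)
  moreover have "deg_le (tdeg m) (\<Prod>i\<in>UNIV. x i ^ m i)"
    unfolding tdeg_def by (intro deg_le_prod deg_le_power assms(2))
  ultimately show "deg_le n (\<Prod>i\<in>UNIV. x i ^ m i)" by (rule deg_le_mono[rotated])
qed

lemma ord_ge_subst:
  assumes "ord_ge n f" "\<And>i. ord_ge 1 (x i)"
  shows "ord_ge n (subst x f)"
  unfolding subst_def
proof (intro ord_ge_sum ord_ge_Const_mult)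
  fix m assume "m \<in> Poly_Mapping.keys f"
  then have "n \<le> tdeg m" using assms(1) by (auto simp: ord_ge_def in_keys_iff)
  moreover have "ord_ge (tdeg m) (\<Prod>i\<in>UNIV. x i ^ m i)"
    unfolding tdeg_def by (intro ord_ge_prod ord_ge_power assms(2))
  ultimately show "ord_ge n (\<Prod>i\<in>UNIV. x i ^ m i)" by (rule ord_ge_mono[rotated])
qed

lemma cf_Const_mult: "cf (Const c * f) m = c * cf f m"
  for f :: "('i, 'r::comm_ring_1) mpoly"
proof (induction f rule: mpoly_induct)
  case (single m' a)
  show ?case by (simp add: mult_single lookup_single when_def flip: zero_fun_def)
qed (simp add: distrib_left lookup_add)

text \<open>Only the constant term of \<open>g\<close> can contribute to a monomial of the lowest
  possible degree. Hence multiplying by a polynomial that does not vanish at a point only rescales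
  the lowest-order part there.\<close>

lemma cf_mult_lowest:
  fixes f g :: "('i::finite, 'r::comm_ring_1) mpoly"
  assumes "ord_ge (tdeg m) f"
  shows "cf (f * g) m = cf g 0 * cf f m"
proof -
  have g: "g = Const (cf g 0) + (g - Const (cf g 0))" by simp
  have "ord_ge 1 (g - Const (cf g 0))"
    unfolding ord_ge_def
    by (auto simp: lookup_minus lookup_single when_def Suc_le_eq split: if_splits)
      (use tdeg_zero_iff neq0_conv in blast)+
  then have "ord_ge (tdeg m + 1) (f * (g - Const (cf g 0)))"
    using assms by (intro ord_ge_mult)
  then have z: "cf (f * (g - Const (cf g 0))) m = 0"
    unfolding ord_ge_def by force
  have "f * g = Const (cf g 0) * f + f * (g - Const (cf g 0))"
    by (simp add: algebra_simps)
  then show ?thesis using z by (simp add: lookup_add cf_Const_mult)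
qed

text \<open>The coefficients of \<open>shift c f\<close> are the Taylor coefficients of
  \<open>f\<close> at \<open>c\<close>. Obtaining them by substitution instead of differentiation
  makes them meaningful in every characteristic.\<close>

definition shift :: "('i::finite \<Rightarrow> 'r) \<Rightarrow> ('i, 'r) mpoly \<Rightarrow> ('i, 'r::comm_ring_1) mpoly" where
  "shift c = subst (\<lambda>i. Var i + Const (c i))"

lemma shift_shift: "shift c (shift d f) = shift (\<lambda>i. c i + d i) f"
  by (simp add: shift_def subst_subst subst_add single_add add.assoc)

lemma shift_0 [simp]: "shift (\<lambda>i. 0) f = f"
  by (simp add: shift_def)

lemma shift_cancel: "shift (\<lambda>i. - c i) (shift c f) = f"
  by (simp add: shift_shift)

lemma deg_le_shift: "deg_le n f \<Longrightarrow> deg_le n (shift c f)"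
  unfolding shift_def by (intro deg_le_subst deg_le_add) auto

section \<open>Coefficients along one block of variables\<close>

definition embed_exp :: "'t \<Rightarrow> ('b \<Rightarrow> nat) \<Rightarrow> ('t \<times> 'b \<Rightarrow> nat)" where
  "embed_exp t m = (\<lambda>(t', b). if t' = t then m b else 0)"

text \<open>If \<open>\<rho>\<close> vanishes on the variables \<open>(t, b)\<close>, then \<open>slice t \<rho> f\<close> is the coefficient of \<open>x\<^sup>\<rho>\<close> in \<open>f\<close>,
  viewed as a polynomial in these variables.\<close>

definition slice :: "'t \<Rightarrow> ('t \<times> 'b \<Rightarrow> nat) \<Rightarrow> ('t \<times> 'b, 'r::zero) mpoly \<Rightarrow> ('b, 'r) mpoly" where
  "slice t \<rho> = Poly_Mapping.map_key (\<lambda>m. \<rho> + embed_exp t m)"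

lemma inj_slice_exp: "inj (\<lambda>m. \<rho> + embed_exp t m)"
proof (rule injI)
  fix m m'
  assume "\<rho> + embed_exp t m = \<rho> + embed_exp t m'"
  then have "(\<rho> + embed_exp t m) (t, b) = (\<rho> + embed_exp t m') (t, b)" for b by simp
  then show "m = m'" by (auto simp: embed_exp_def)
qed

lemma cf_slice: "cf (slice t \<rho> f) m = cf f (\<rho> + embed_exp t m)"
  unfolding slice_def by (simp add: Poly_Mapping.map_key.rep_eq[OF inj_slice_exp])

lemma slice_add: "slice t \<rho> (f + g) = slice t \<rho> f + slice t \<rho> g"
  unfolding slice_def by (rule map_key_plus[OF inj_slice_exp])

lemma tdeg_embed_exp: "tdeg (embed_exp t m) = tdeg m"
  for m :: "'b::finite \<Rightarrow> nat" and t :: "'t::finite"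
proof -
  have "tdeg (embed_exp t m) = (\<Sum>t'\<in>UNIV. \<Sum>b\<in>UNIV. if t' = t then m b else 0)"
    by (simp add: tdeg_def embed_exp_def sum.cartesian_product UNIV_Times_UNIV[symmetric] del: UNIV_Times_UNIV)
  also have "\<dots> = (\<Sum>t'\<in>UNIV. if t' = t then (\<Sum>b\<in>UNIV. m b) else 0)"
    by (intro sum.cong) auto
  finally show ?thesis by (simp add: tdeg_def)
qed

lemma subst_embed_single:
  fixes m :: "'b::finite \<Rightarrow> nat" and t :: "'t::finite"
  shows "subst (\<lambda>b. Var (t, b)) (Poly_Mapping.single m a) = Poly_Mapping.single (embed_exp t m) (a::'r::comm_ring_1)"
proof -
  have "(\<Sum>b\<in>UNIV. (\<lambda>j. m b * (if j = (t, b) then 1 else 0))) = embed_exp t m"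
    by (rule ext) (auto simp: sum_fun_apply embed_exp_def sum.delta' if_distrib cong: if_cong split: if_splits)
  then show ?thesis
    by (simp add: Var_def single_power prod_single mult_single subst_single)
qed

lemma slice_monomial_mult:
  fixes h :: "('b::finite, 'r::comm_ring_1) mpoly" and t :: "'t::finite"
  assumes "\<And>b. \<rho> (t, b) = 0" "\<And>b. \<rho>' (t, b) = 0"
  shows "slice t \<rho> (Poly_Mapping.single \<rho>' 1 * subst (\<lambda>b. Var (t, b)) h) = (if \<rho> = \<rho>' then h else 0)"
proof (induction h rule: mpoly_induct)
  case (single m a)
  have *: "\<rho>' + embed_exp t m = \<rho> + embed_exp t m' \<longleftrightarrow> \<rho> = \<rho>' \<and> m = m'" for m'
  proof
    assume eq: "\<rho>' + embed_exp t m = \<rho> + embed_exp t m'"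
    have pt: "\<rho>' k + embed_exp t m k = \<rho> k + embed_exp t m' k" for k
      using fun_cong[OF eq, of k] by simp
    have "m b = m' b" for b using pt[of "(t, b)"] assms by (simp add: embed_exp_def)
    then have m: "m = m'" by blast
    then show "\<rho> = \<rho>' \<and> m = m'" using pt by auto
  qed simp
  show ?case
    by (rule poly_mapping_eqI) (auto simp: cf_slice subst_embed_single mult_single lookup_single when_def *)
next
  case (add f g)
  then show ?case by (auto simp: subst_add distrib_left slice_add)
qed

text \<open>A translation inside the block \<open>t\<close> leaves all other variables alone. By
  linearity a monomial suffices, split into its part in the block and the rest. Later the block is a
  plane, and the translation moves the centre of expansion along that plane.\<close>

lemma slice_shift:
  fixes f :: "('t::finite \<times> 'b::finite, 'r::comm_ring_1) mpoly"
  assumes \<rho>: "\<And>b. \<rho> (t, b) = 0"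
  shows "slice t \<rho> (shift (\<lambda>(t', b). if t' = t then c b else 0) f) = shift c (slice t \<rho> f)"
proof (induction f rule: mpoly_induct)
  case (single m a)
  define \<rho>' where "\<rho>' = (\<lambda>(t', b). if t' = t then 0 else m (t', b))"
  define m1 where "m1 = (\<lambda>b. m (t, b))"
  have m: "m = \<rho>' + embed_exp t m1" by (auto simp: \<rho>'_def m1_def embed_exp_def)
  have \<rho>': "\<And>b. \<rho>' (t, b) = 0" by (simp add: \<rho>'_def)
  have split: "Poly_Mapping.single m a = Poly_Mapping.single \<rho>' 1 * subst (\<lambda>b. Var (t, b)) (Poly_Mapping.single m1 a)"
    by (simp add: subst_embed_single mult_single m)
  let ?c = "\<lambda>(t', b). if t' = t then c b else 0"
  have 1: "shift ?c (Poly_Mapping.single \<rho>' 1) = Poly_Mapping.single \<rho>' 1"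
  proof -
    have "(\<Prod>i\<in>UNIV. (Var i + Const (?c i)) ^ \<rho>' i) = (\<Prod>i\<in>UNIV. (Var i :: ('t \<times> 'b, 'r) mpoly) ^ \<rho>' i)"
      by (rule prod.cong) (auto simp: \<rho>'_def split: prod.splits)
    moreover have "shift ?c (Poly_Mapping.single \<rho>' 1) = (\<Prod>i\<in>UNIV. (Var i + Const (?c i)) ^ \<rho>' i)"
      unfolding shift_def subst_single by simp
    ultimately show ?thesis
      using single_conv_Var[of \<rho>' "1::'r"] by simp
  qed
  have 2: "shift ?c (subst (\<lambda>b. Var (t, b)) h) = subst (\<lambda>b. Var (t, b)) (shift c h)" for h :: "('b, 'r) mpoly"
    by (simp add: shift_def subst_subst subst_add)
  have slm: "slice t \<rho> (Poly_Mapping.single \<rho>' 1 * subst (\<lambda>b. Var (t, b)) h) = (if \<rho> = \<rho>' then h else 0)"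
    for h :: "('b, 'r) mpoly"
    by (rule slice_monomial_mult) (use \<rho> \<rho>' in auto)
  have "shift ?c (Poly_Mapping.single m a) = Poly_Mapping.single \<rho>' 1 * subst (\<lambda>b. Var (t, b)) (shift c (Poly_Mapping.single m1 a))"
    unfolding split 2[symmetric] by (simp add: 1[unfolded shift_def] shift_def subst_mult)
  then have L: "slice t \<rho> (shift ?c (Poly_Mapping.single m a)) = (if \<rho> = \<rho>' then shift c (Poly_Mapping.single m1 a) else 0)"
    by (simp only: slm)
  have R: "slice t \<rho> (Poly_Mapping.single m a) = (if \<rho> = \<rho>' then Poly_Mapping.single m1 a else 0)"
    by (simp only: split slm)
  show ?case unfolding L R by (simp add: shift_def)
next
  case (add f g)
  then show ?case by (simp add: shift_def subst_add slice_add)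
qed

section \<open>Linear algebra\<close>

text \<open>A field is handled as a factor \<open>e R\<close> of a commutative ring \<open>R\<close>, cut out by an idempotent \<open>e\<close>:
  the scalars are the \<open>x\<close> with \<open>e * x = x\<close>. This makes the type-class libraries available for a
  field that is only given by a carrier set.\<close>

locale idem_field =
  fixes e :: "'r::comm_ring_1"
  assumes idem: "e * e = e" and e_nonzero: "e \<noteq> 0"
    and inverse_exists: "\<And>x. e * x = x \<Longrightarrow> x \<noteq> 0 \<Longrightarrow> \<exists>y. e * y = y \<and> x * y = e"
begin

lemma scalar_mult: "e * x = x \<Longrightarrow> e * (a * x) = a * x"
  by (metis mult.left_commute)

lemma scalar_sum: "(\<And>j. j \<in> J \<Longrightarrow> e * f j = f j) \<Longrightarrow> e * sum f J = sum f J"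
  by (simp add: sum_distrib_left)

lemma scalar_mult_nonzero:
  assumes "e * x = x" "e * y = y" "x \<noteq> 0" "y \<noteq> 0"
  shows "x * y \<noteq> 0"
proof
  assume "x * y = 0"
  obtain z where z: "x * z = e" using inverse_exists assms by blast
  have "(x * y) * z = (x * z) * y" by (simp add: mult_ac)
  then have "y = (x * y) * z" using z assms(2) by simp
  then show False using assms \<open>x * y = 0\<close> by simp
qed

text \<open>Gaussian elimination, by induction on the equations. The coefficients \<open>a\<close>
  are arbitrary ring elements: since the unknowns are scalars, only \<open>e * a i j\<close>
  matters. The Taylor coefficients of monomials with coefficient 1, to which this is applied, need
  not be scalars.\<close>

lemma homogeneous_solution:
  assumes "finite I" "finite J" "card I < card J"
  shows "\<exists>c. (\<forall>j. e * c j = c j) \<and> (\<exists>j\<in>J. c j \<noteq> 0) \<and> (\<forall>i\<in>I. (\<Sum>j\<in>J. a i j * c j) = 0)"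
  using assms
proof (induction I arbitrary: J a rule: finite_induct)
  case empty
  then obtain j where "j \<in> J" by fastforce
  then show ?case using e_nonzero idem by (intro exI[of _ "\<lambda>_. e"]) auto
next
  case (insert i I)
  show ?case
  proof (cases "\<forall>j\<in>J. e * a i j = 0")
    case True
    obtain c where c: "\<forall>j. e * c j = c j" "\<exists>j\<in>J. c j \<noteq> 0" "\<forall>i\<in>I. (\<Sum>j\<in>J. a i j * c j) = 0"
      using insert.IH[of J a] insert.prems insert.hyps by auto
    have "a i j * c j = 0" if "j \<in> J" for j
    proof -
      have "a i j * c j = (e * a i j) * c j" using c(1) by (simp add: mult.commute[of e] mult.assoc)
      then show ?thesis using True that by simp
    qed
    then have "(\<Sum>j\<in>J. a i j * c j) = 0" by simp
    then show ?thesis using c by (intro exI[of _ c]) auto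
  next
    case False
    then obtain j0 where j0: "j0 \<in> J" "e * a i j0 \<noteq> 0" by blast
    obtain y where y: "e * y = y" "(e * a i j0) * y = e"
      using inverse_exists[of "e * a i j0"] j0 idem by (auto simp flip: mult.assoc)
    have y2: "a i j0 * y = e" using y by (simp add: mult.commute[of e] mult.assoc)
    let ?J = "J - {j0}"
    have "card I < card ?J" using insert j0 by (simp add: card_Diff_singleton)
    then obtain c where c: "\<forall>j. e * c j = c j" "\<exists>j\<in>?J. c j \<noteq> 0"
        "\<forall>k\<in>I. (\<Sum>j\<in>?J. (a k j - a k j0 * y * a i j) * c j) = 0"
      using insert.IH[of ?J "\<lambda>k j. a k j - a k j0 * y * a i j"] insert.prems insert.hyps by auto
    define s where "s = (\<Sum>j\<in>?J. a i j * c j)"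
    \<comment> \<open>The value at the pivot \<open>j0\<close> is the one that equation
      \<open>i\<close> dictates.\<close>
    define d where "d = c(j0 := - y * s)"
    have sume: "e * s = s" unfolding s_def
      by (intro scalar_sum scalar_mult) (use c(1) in blast)
    have split: "(\<Sum>j\<in>J. b j * d j) = b j0 * (- y * s) + (\<Sum>j\<in>?J. b j * c j)" for b
      using insert.prems j0 by (simp add: sum.remove[of J j0] d_def)
    show ?thesis
    proof (intro exI[of _ d] conjI ballI)
      show "\<forall>j. e * d j = d j" using c(1) y(1) by (auto simp: d_def mult.assoc[symmetric])
      show "\<exists>j\<in>J. d j \<noteq> 0" using c(2) by (auto simp: d_def)
      fix k assume "k \<in> insert i I"
      then consider "k = i" | "k \<in> I" by blast
      then show "(\<Sum>j\<in>J. a k j * d j) = 0"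
      proof cases
        case 1
        have "a i j0 * (- y * s) = - (e * s)"
          by (simp add: y2[symmetric] mult.assoc)
        then show ?thesis unfolding split 1 using sume by (simp add: s_def)
      next
        case 2
        have "(\<Sum>j\<in>?J. (a k j - a k j0 * y * a i j) * c j) = (\<Sum>j\<in>?J. a k j * c j) - a k j0 * y * s"
          unfolding s_def sum_distrib_left by (simp add: left_diff_distrib sum_subtractf mult.assoc)
        then have "(\<Sum>j\<in>?J. a k j * c j) = a k j0 * y * s" using c(3) 2 by simp
        then show ?thesis unfolding split by (simp add: mult.assoc)
      qed
    qed
  qed
qed

text \<open>\<open>B\<close> is the greedy basis: a functional is kept if and only if its predecessors do not determine it.\<close>

lemma card_greedy_basis:
  fixes \<kappa> :: "'x \<Rightarrow> 'k::linorder" and a :: "'x \<Rightarrow> 'j \<Rightarrow> 'r" and J :: "'j set"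
  defines "\<phi> \<equiv> \<lambda>x v. \<Sum>j\<in>J. a x j * v j"
  assumes fin: "finite X" "finite J" and inj: "inj_on \<kappa> X"
    and nondeg: "\<And>v. (\<And>j. e * v j = v j) \<Longrightarrow> (\<And>x. x \<in> X \<Longrightarrow> \<phi> x v = 0) \<Longrightarrow> \<forall>j\<in>J. v j = 0"
    and B: "B = {x\<in>X. \<exists>v. (\<forall>j. e * v j = v j) \<and> \<phi> x v \<noteq> 0 \<and> (\<forall>y\<in>X. \<kappa> y < \<kappa> x \<longrightarrow> \<phi> y v = 0)}"
  shows "card B = card J"
proof (rule antisym)
  have finB: "finite B" and BX: "B \<subseteq> X" using fin B by auto
  have minimal: "\<exists>x\<in>Y. \<forall>y\<in>Y. \<kappa> x \<le> \<kappa> y" if "Y \<subseteq> X" "Y \<noteq> {}" for Y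
  proof -
    have "finite (\<kappa> ` Y)" using that fin(1) finite_subset by blast
    then have "Min (\<kappa> ` Y) \<in> \<kappa> ` Y" "\<forall>y\<in>Y. Min (\<kappa> ` Y) \<le> \<kappa> y" using that by auto
    then show ?thesis by (metis imageE)
  qed
  show "card J \<le> card B"
  proof (rule ccontr)
    assume "\<not> card J \<le> card B"
    then obtain v where v: "\<forall>j. e * v j = v j" "\<exists>j\<in>J. v j \<noteq> 0" "\<forall>x\<in>B. \<phi> x v = 0"
      using homogeneous_solution[OF finB fin(2), of a] unfolding \<phi>_def by auto
    \<comment> \<open>The first functional that does not kill \<open>v\<close> would itself belong
      to \<open>B\<close>.\<close>
    then have "{x\<in>X. \<phi> x v \<noteq> 0} \<noteq> {}" using nondeg[of v] by blast
    then obtain x where x: "x \<in> X" "\<phi> x v \<noteq> 0" "\<forall>y\<in>{x\<in>X. \<phi> x v \<noteq> 0}. \<kappa> x \<le> \<kappa> y"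
      using minimal[of "{x\<in>X. \<phi> x v \<noteq> 0}"] by blast
    then have "\<forall>y\<in>X. \<kappa> y < \<kappa> x \<longrightarrow> \<phi> y v = 0" by (auto simp: not_le[symmetric])
    then have "x \<in> B" unfolding B using v(1) x by blast
    then show False using v(3) x by blast
  qed
  show "card B \<le> card J"
  proof (rule ccontr)
    assume lt: "\<not> card B \<le> card J"
    have "\<forall>x\<in>B. \<exists>v. (\<forall>j. e * v j = v j) \<and> \<phi> x v \<noteq> 0 \<and> (\<forall>y\<in>X. \<kappa> y < \<kappa> x \<longrightarrow> \<phi> y v = 0)"
      using B by blast
    then obtain v where v: "\<And>x j. x \<in> B \<Longrightarrow> e * v x j = v x j" "\<And>x. x \<in> B \<Longrightarrow> \<phi> x (v x) \<noteq> 0"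
       "\<And>x y. x \<in> B \<Longrightarrow> y \<in> X \<Longrightarrow> \<kappa> y < \<kappa> x \<Longrightarrow> \<phi> y (v x) = 0"
      by metis
    obtain c where c: "\<forall>x. e * c x = c x" "\<exists>x\<in>B. c x \<noteq> 0" "\<forall>j\<in>J. (\<Sum>x\<in>B. v x j * c x) = 0"
      using homogeneous_solution[OF fin(2) finB, of "\<lambda>j x. v x j"] lt by auto
    \<comment> \<open>The witnesses \<open>v x\<close> are triangular with respect to
      \<open>B\<close>: at the element of \<open>Y\<close> with the smallest key, every other term
      of the combination vanishes.\<close>
    define Y where "Y = {x\<in>B. c x \<noteq> 0}"
    obtain x where x: "x \<in> Y" "\<forall>y\<in>Y. \<kappa> x \<le> \<kappa> y"
      using minimal[of Y] c(2) BX by (auto simp: Y_def)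
    have xB: "x \<in> B" "c x \<noteq> 0" "x \<in> X" using x BX by (auto simp: Y_def)
    have zero: "\<phi> x (v y) * c y = 0" if "y \<in> B" "y \<noteq> x" for y
    proof (cases "c y = 0")
      case False
      then have "\<kappa> x \<le> \<kappa> y" using x that by (auto simp: Y_def)
      moreover have "\<kappa> x \<noteq> \<kappa> y" using inj that xB BX by (auto dest: inj_onD)
      ultimately show ?thesis using v(3)[of y x] that xB by auto
    qed simp
    have "(\<Sum>y\<in>B. \<phi> x (v y) * c y) = (\<Sum>j\<in>J. a x j * (\<Sum>y\<in>B. v y j * c y))"
      unfolding \<phi>_def sum_distrib_left sum_distrib_right
      by (subst sum.swap) (simp add: mult.assoc)
    also have "\<dots> = 0" using c(3) by simp
    also have "(\<Sum>y\<in>B. \<phi> x (v y) * c y) = \<phi> x (v x) * c x"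
      using zero finB xB by (subst sum.remove[of B x]) auto
    finally have "\<phi> x (v x) * c x = 0" .
    moreover have "e * \<phi> x (v x) = \<phi> x (v x)"
      unfolding \<phi>_def by (intro scalar_sum scalar_mult v(1)[OF xB(1)])
    ultimately show False using scalar_mult_nonzero[OF _ _ v(2)[OF xB(1)] xB(2)] c(1) by simp
  qed
qed

end

section \<open>Independent vanishing conditions on a plane\<close>

lemma tdeg_bool: "tdeg m = m False + m True"
  by (simp add: tdeg_def UNIV_bool)

lemma exponent_bool_eqI: "tdeg m = tdeg m' \<Longrightarrow> m False = m' False \<Longrightarrow> m = m'"
  by (rule ext) (metis (full_types) tdeg_bool add_left_cancel)

lemma card_tdeg_between:
  "card {m :: bool \<Rightarrow> nat. n' < tdeg m \<and> tdeg m \<le> n} \<le> (n - n') * (n + 1)"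
proof -
  let ?f = "\<lambda>m :: bool \<Rightarrow> nat. (tdeg m, m False)"
  have "card {m :: bool \<Rightarrow> nat. n' < tdeg m \<and> tdeg m \<le> n} \<le> card ({n'<..n} \<times> {..n})"
  proof (rule card_inj_on_le[of ?f])
    show "inj_on ?f {m. n' < tdeg m \<and> tdeg m \<le> n}"
      by (rule inj_onI) (auto intro: exponent_bool_eqI)
    show "?f ` {m. n' < tdeg m \<and> tdeg m \<le> n} \<subseteq> {n'<..n} \<times> {..n}"
      by (auto simp: tdeg_bool)
  qed auto
  then show ?thesis by simp
qed

lemma card_tdeg_le: "card {m :: bool \<Rightarrow> nat. tdeg m \<le> n} \<le> (n + 1) ^ 2"
proof -
  have "card {m :: bool \<Rightarrow> nat. tdeg m \<le> n} \<le> card {m :: bool \<Rightarrow> nat. \<forall>i. m i \<le> n}"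
    by (rule card_mono) (auto simp: finite_exponents intro: order_trans[OF le_tdeg])
  then show ?thesis by (simp add: card_exponents)
qed

lemma card_tdeg_diff:
  "card {m :: bool \<Rightarrow> nat. tdeg m \<le> n} \<le> card {m :: bool \<Rightarrow> nat. tdeg m \<le> n'} + (n - n') * (n + 1)"
proof -
  have "{m :: bool \<Rightarrow> nat. tdeg m \<le> n} \<subseteq> {m. tdeg m \<le> n'} \<union> {m. n' < tdeg m \<and> tdeg m \<le> n}" by auto
  then have "card {m :: bool \<Rightarrow> nat. tdeg m \<le> n} \<le> card ({m :: bool \<Rightarrow> nat. tdeg m \<le> n'} \<union> {m. n' < tdeg m \<and> tdeg m \<le> n})"
    by (intro card_mono) (auto intro: finite_subset[OF _ finite_tdeg_le])
  also have "\<dots> \<le> card {m :: bool \<Rightarrow> nat. tdeg m \<le> n'} + card {m :: bool \<Rightarrow> nat. n' < tdeg m \<and> tdeg m \<le> n}"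
    by (rule card_Un_le)
  finally show ?thesis using card_tdeg_between[of n' n] by simp
qed

context idem_field
begin

definition scalar_poly :: "('i, 'r) mpoly \<Rightarrow> bool" where
  "scalar_poly f \<longleftrightarrow> (\<forall>m. e * cf f m = cf f m)"

lemma scalar_poly_iff: "scalar_poly f \<longleftrightarrow> Const e * f = f"
  unfolding scalar_poly_def poly_mapping_eq_iff fun_eq_iff cf_Const_mult ..

lemma scalar_poly_subst: "scalar_poly f \<Longrightarrow> scalar_poly (subst x f)"
  unfolding scalar_poly_iff by (metis subst_mult subst_Const)

lemma scalar_poly_shift: "scalar_poly f \<Longrightarrow> scalar_poly (shift c f)"
  unfolding shift_def by (rule scalar_poly_subst)

lemma scalar_poly_mult: "scalar_poly f \<Longrightarrow> scalar_poly (f * g)"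
  unfolding scalar_poly_iff by (metis mult.assoc)

definition polys :: "nat \<Rightarrow> ('i::finite, 'r) mpoly set" where
  "polys n = {h. deg_le n h \<and> scalar_poly h}"

text \<open>The conditions at the points of a plane are processed in the order of this key; the handicap
  \<open>\<beta> q\<close> delays those at \<open>q\<close>. The handicaps of different points will be distinct modulo \<open>M\<close>, so
  that keys never agree for different points.\<close>

definition key :: "nat \<Rightarrow> ('q \<Rightarrow> nat) \<Rightarrow> 'q \<times> (bool \<Rightarrow> nat) \<Rightarrow> nat \<times> nat" where
  "key M \<beta> = (\<lambda>(q, m). (M * tdeg m + \<beta> q, m False))"

definition basis :: "'q set \<Rightarrow> ('q \<Rightarrow> bool \<Rightarrow> 'r) \<Rightarrow> nat \<Rightarrow> nat \<Rightarrow> ('q \<Rightarrow> nat) \<Rightarrow> 'q \<Rightarrow> (bool \<Rightarrow> nat) set" where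
  "basis P c M n \<beta> q = {m. \<exists>h\<in>polys n. cf (shift (c q) h) m \<noteq> 0 \<and>
     (\<forall>q'\<in>P. \<forall>m'. key M \<beta> (q', m') < key M \<beta> (q, m) \<longrightarrow> cf (shift (c q') h) m' = 0)}"

lemma basis_subset: "basis P c M n \<beta> q \<subseteq> {m. tdeg m \<le> n}"
  unfolding basis_def polys_def using deg_le_shift by (auto simp: deg_le_def)

lemma finite_basis: "finite (basis P c M n \<beta> q)"
  using basis_subset finite_tdeg_le by (rule finite_subset)

lemma card_basis_le: "card (basis P c M n \<beta> q) \<le> (n + 1) ^ 2"
  using card_mono[OF finite_tdeg_le basis_subset] card_tdeg_le by (rule order_trans)

lemma basis_mono_degree: "n \<le> n' \<Longrightarrow> basis P c M n \<beta> q \<subseteq> basis P c M n' \<beta> q"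
  unfolding basis_def polys_def using deg_le_mono by blast

lemma polys_eq_0I:
  assumes "h \<in> polys n" "\<And>m. tdeg m \<le> n \<Longrightarrow> cf (shift c h) m = 0"
  shows "h = 0"
proof -
  have "deg_le n (shift c h)" using assms(1) by (auto simp: polys_def intro: deg_le_shift)
  then have "shift c h = 0"
    by (intro poly_mapping_eqI) (use assms(2) in \<open>auto simp: deg_le_def\<close>)
  then show ?thesis by (metis shift_cancel shift_def subst_zero)
qed

text \<open>All conditions of degree up to \<open>n\<close> at \<open>q'\<close> precede every
  condition at \<open>q\<close>, and they already force a polynomial of degree \<open>n\<close> to
  be zero. This is what separates joints whose handicaps are far apart.\<close>

lemma basis_empty:
  assumes "q' \<in> P" "M * n + \<beta> q' < \<beta> q"
  shows "basis P c M n \<beta> q = {}"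
proof (rule equals0I)
  fix m assume "m \<in> basis P c M n \<beta> q"
  then obtain h where h: "h \<in> polys n" "cf (shift (c q) h) m \<noteq> 0"
      "\<And>m'. key M \<beta> (q', m') < key M \<beta> (q, m) \<Longrightarrow> cf (shift (c q') h) m' = 0"
    using assms(1) unfolding basis_def by blast
  have "h = 0"
  proof (rule polys_eq_0I[OF h(1) h(3)])
    fix m' :: "bool \<Rightarrow> nat" assume "tdeg m' \<le> n"
    then have "M * tdeg m' \<le> M * n" by (rule mult_le_mono2)
    then have "M * tdeg m' + \<beta> q' < M * tdeg m + \<beta> q" using assms(2) by linarith
    then show "key M \<beta> (q', m') < key M \<beta> (q, m)" by (simp add: key_def)
  qed
  then show False using h(2) by (simp add: shift_def)
qed

text \<open>Delaying the conditions at \<open>p\<close> only removes predecessors of the conditions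
  at other points, so the old witnesses remain valid.\<close>

lemma basis_mono_handicap:
  assumes "\<beta> p \<le> \<beta>' p" "\<And>q. q \<noteq> p \<Longrightarrow> \<beta>' q = \<beta> q" "q \<noteq> p"
  shows "basis P c M n \<beta> q \<subseteq> basis P c M n \<beta>' q"
proof -
  have le: "\<beta> q' \<le> \<beta>' q'" for q' using assms by (cases "q' = p") auto
  have "key M \<beta> (q', m') < key M \<beta> (q, m)" if "key M \<beta>' (q', m') < key M \<beta>' (q, m)" for q' m' m
  proof -
    have "\<beta> q' \<le> \<beta>' q'" "\<beta>' q = \<beta> q" using le assms by auto
    then show ?thesis using that by (simp add: key_def) linarith
  qed
  then show ?thesis unfolding basis_def by blast
qed

text \<open>The kept conditions are a greedy basis of the dual of \<open>polys n\<close>.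
  Nondegeneracy holds because the Taylor coefficients at a single point determine a polynomial, and
  distinct residues of the handicaps modulo \<open>M\<close> make the keys injective.\<close>

lemma sum_card_basis:
  fixes c :: "'q \<Rightarrow> bool \<Rightarrow> 'r"
  assumes fin: "finite P" and ne: "P \<noteq> {}" and inj: "inj_on (\<lambda>q. \<beta> q mod M) P" and M: "M > 0"
  shows "(\<Sum>q\<in>P. card (basis P c M n \<beta> q)) = card {m :: bool \<Rightarrow> nat. tdeg m \<le> n}"
proof -
  define J where "J = {m :: bool \<Rightarrow> nat. tdeg m \<le> n}"
  define a where "a = (\<lambda>(q, m) j. cf (shift (c q) (Poly_Mapping.single j 1)) m)"
  define pol where "pol v = (\<Sum>j\<in>J. Poly_Mapping.single j (v j :: 'r))" for v
  have finJ: "finite J" unfolding J_def by (rule finite_tdeg_le)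
  have cf_pol: "cf (pol v) j = (if j \<in> J then v j else 0)" for v j
    unfolding pol_def lookup_sum lookup_single when_def using finJ by (simp add: sum.delta)
  have pol_polys: "pol v \<in> polys n" if "\<And>j. e * v j = v j" for v
    using that by (simp add: polys_def scalar_poly_def deg_le_def cf_pol) (simp add: J_def)
  have single: "Poly_Mapping.single j x = Const x * Poly_Mapping.single j 1" for j :: "bool \<Rightarrow> nat" and x :: 'r
    by (simp add: mult_single)
  have phi: "(\<Sum>j\<in>J. a (q, m) j * v j) = cf (shift (c q) (pol v)) m" for q m v
  proof -
    have "shift (c q) (pol v) = (\<Sum>j\<in>J. Const (v j) * shift (c q) (Poly_Mapping.single j 1))"
      unfolding pol_def shift_def subst_sum by (subst single) (simp only: subst_mult subst_Const)
    then show ?thesis by (simp add: lookup_sum cf_Const_mult a_def mult.commute)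
  qed
  have pol_cf: "pol (cf h) = h" if "h \<in> polys n" for h
    by (rule poly_mapping_eqI) (use that in \<open>auto simp: cf_pol polys_def deg_le_def J_def\<close>)
  define B where "B = Sigma P (basis P c M n \<beta>)"
  have "card B = card J"
  proof (rule card_greedy_basis[where \<kappa> = "key M \<beta>" and a = a and X = "P \<times> J"])
    show "finite (P \<times> J)" "finite J" using fin finJ by auto
    show "inj_on (key M \<beta>) (P \<times> J)"
    proof (rule inj_onI, clarify)
      fix q m q' m' assume q: "q \<in> P" "q' \<in> P" and eq: "key M \<beta> (q, m) = key M \<beta> (q', m')"
      then have eq': "M * tdeg m + \<beta> q = M * tdeg m' + \<beta> q'" "m False = m' False" by (auto simp: key_def)
      then have "\<beta> q mod M = \<beta> q' mod M" by (metis mod_mult_self4)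
      then have qq: "q = q'" using inj q by (auto dest: inj_onD)
      then have "tdeg m = tdeg m'" using eq' M by simp
      then show "q = q' \<and> m = m'" using exponent_bool_eqI eq'(2) qq by blast
    qed
    fix v assume v: "\<And>j. e * v j = v j" and 0: "\<And>x. x \<in> P \<times> J \<Longrightarrow> (\<Sum>j\<in>J. a x j * v j) = 0"
    obtain q where q: "q \<in> P" using ne by blast
    have "pol v = 0"
      by (rule polys_eq_0I[OF pol_polys[OF v], of "c q"]) (use 0 q in \<open>auto simp: phi[symmetric] J_def\<close>)
    then show "\<forall>j\<in>J. v j = 0" using cf_pol[of v] by (metis lookup_zero)
  next
    show "B = {x \<in> P \<times> J. \<exists>v. (\<forall>j. e * v j = v j) \<and> (\<Sum>j\<in>J. a x j * v j) \<noteq> 0 \<and>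
       (\<forall>y\<in>P \<times> J. key M \<beta> y < key M \<beta> x \<longrightarrow> (\<Sum>j\<in>J. a y j * v j) = 0)}" (is "B = ?R")
    proof (intro Set.set_eqI iffI)
      fix x assume "x \<in> B"
      obtain q m where x: "x = (q, m)" by (cases x)
      from \<open>x \<in> B\<close> have q: "q \<in> P" and m: "m \<in> basis P c M n \<beta> q" by (auto simp: B_def x)
      obtain h where h: "h \<in> polys n" "cf (shift (c q) h) m \<noteq> 0"
        "\<forall>q'\<in>P. \<forall>m'. key M \<beta> (q', m') < key M \<beta> (q, m) \<longrightarrow> cf (shift (c q') h) m' = 0"
        using m unfolding basis_def by blast
      have "\<forall>j. e * cf h j = cf h j" using h(1) by (simp add: polys_def scalar_poly_def)
      moreover have "m \<in> J" using subsetD[OF basis_subset m] by (simp add: J_def)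
      ultimately have "(q, m) \<in> P \<times> J \<and> (\<exists>v. (\<forall>j. e * v j = v j) \<and> (\<Sum>j\<in>J. a (q, m) j * v j) \<noteq> 0 \<and>
         (\<forall>y\<in>P \<times> J. key M \<beta> y < key M \<beta> (q, m) \<longrightarrow> (\<Sum>j\<in>J. a y j * v j) = 0))"
        using q h by (intro conjI exI[of _ "cf h"]) (auto simp: phi pol_cf)
      then show "x \<in> ?R" unfolding x by blast
    next
      fix x assume "x \<in> ?R"
      obtain q m where x: "x = (q, m)" by (cases x)
      from \<open>x \<in> ?R\<close> obtain v where q: "q \<in> P" and v: "\<forall>j. e * v j = v j" "(\<Sum>j\<in>J. a (q, m) j * v j) \<noteq> 0"
        and *: "\<forall>y\<in>P \<times> J. key M \<beta> y < key M \<beta> (q, m) \<longrightarrow> (\<Sum>j\<in>J. a y j * v j) = 0"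
        unfolding x by blast
      have polv: "pol v \<in> polys n" using v(1) by (intro pol_polys) auto
      have "cf (shift (c q') (pol v)) m' = 0" if "q' \<in> P" "key M \<beta> (q', m') < key M \<beta> (q, m)" for q' m'
      proof (cases "m' \<in> J")
        case True
        then show ?thesis using * that phi by auto
      next
        case False
        then show ?thesis using polv deg_le_shift unfolding polys_def deg_le_def J_def by blast
      qed
      then show "x \<in> B" using v(2) q polv unfolding B_def basis_def phi x by auto
    qed
  qed
  moreover have "card B = (\<Sum>q\<in>P. card (basis P c M n \<beta> q))"
    unfolding B_def by (rule card_SigmaI) (simp_all add: fin finite_basis)
  ultimately show ?thesis by (simp add: J_def)
qed

section \<open>The effect of raising one handicap\<close>

lemma cf_mult_0: "cf (f * g) 0 = cf f 0 * cf g 0"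
  for f g :: "('i::finite, 'r) mpoly"
  using cf_mult_lowest[of 0 f g] by (simp add: mult.commute)

lemma cf_prod_0: "cf (prod f A) 0 = (\<Prod>a\<in>A. cf (f a) 0)"
  for f :: "'q \<Rightarrow> ('i::finite, 'r) mpoly"
  by (induction A rule: infinite_finite_induct) (simp_all add: cf_mult_0 flip: zero_fun_def)

lemma scalar_prod_nonzero:
  assumes "finite A" "\<And>a. a \<in> A \<Longrightarrow> e * d a = d a \<and> d a \<noteq> 0" "e * x = x" "x \<noteq> 0"
  shows "prod d A * x \<noteq> 0 \<and> e * (prod d A * x) = prod d A * x"
  using assms
proof (induction A rule: finite_induct)
  case (insert a A)
  have "d a * (prod d A * x) \<noteq> 0" by (rule scalar_mult_nonzero) (use insert in auto)
  moreover have "e * (d a * (prod d A * x)) = d a * (prod d A * x)"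
    by (rule scalar_mult) (use insert in auto)
  ultimately show ?case using insert.hyps by (simp add: mult.assoc)
qed auto

text \<open>Raising the handicap of \<open>p\<close> by one step is compensated by multiplying with linear forms that
  vanish at the other points but not at \<open>p\<close>.\<close>

lemma basis_raise_handicap:
  fixes c :: "'q \<Rightarrow> bool \<Rightarrow> 'r"
  assumes fin: "finite P" and p: "p \<in> P" and inj: "inj_on (\<lambda>q. \<beta> q mod M) P" and M: "M > 0"
    and c: "\<And>q b. e * c q b = c q b" "inj_on c P"
    and n: "n' + card P \<le> n"
  shows "basis P c M n' \<beta> p \<subseteq> basis P c M n (\<beta>(p := \<beta> p + M)) p"
proof
  let ?\<beta> = "\<beta>(p := \<beta> p + M)"
  fix m assume "m \<in> basis P c M n' \<beta> p"
  then obtain h where h: "h \<in> polys n'" "cf (shift (c p) h) m \<noteq> 0"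
    and h0: "\<And>q m'. q \<in> P \<Longrightarrow> key M \<beta> (q, m') < key M \<beta> (p, m) \<Longrightarrow> cf (shift (c q) h) m' = 0"
    unfolding basis_def by blast
  define P' where "P' = P - {p}"
  have finP': "finite P'" using fin by (simp add: P'_def)
  have "\<exists>b. c q b \<noteq> c p b" if "q \<in> P'" for q
    using that p c(2) unfolding P'_def by (metis DiffE ext inj_onD insertI1)
  then obtain b where b: "\<And>q. q \<in> P' \<Longrightarrow> c q (b q) \<noteq> c p (b q)" by metis
  define l :: "'q \<Rightarrow> (bool, 'r) mpoly" where "l q = Var (b q) - Const (c q (b q))" for q
  have l: "l q = Var (b q) + Const (- c q (b q))" for q by (simp add: l_def single_uminus)
  define u where "u = prod l P'"
  have shift_u: "shift d u = (\<Prod>q\<in>P'. Var (b q) + Const (d (b q) - c q (b q)))" for d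
    by (simp add: u_def shift_def subst_prod l subst_add add.assoc single_add[symmetric])
  have shift_hu: "shift d (h * u) = shift d h * shift d u" for d by (simp add: shift_def subst_mult)
  have "deg_le (\<Sum>q\<in>P'. 1) u"
    unfolding u_def l by (intro deg_le_prod deg_le_add) auto
  then have "deg_le (n' + card P') (h * u)"
    using h(1) by (intro deg_le_mult) (auto simp: polys_def)
  moreover have "card P' \<le> card P" unfolding P'_def using fin by (intro card_mono) auto
  ultimately have "deg_le n (h * u)" using n by (auto elim: deg_le_mono)
  then have hu: "h * u \<in> polys n" using h(1) by (simp add: polys_def scalar_poly_mult)
  \<comment> \<open>At \<open>p\<close> every condition of lower degree comes earlier and is
    satisfied by \<open>h\<close>, so \<open>m\<close> belongs to the lowest-order part.\<close>
  have ord_p: "ord_ge (tdeg m) (shift (c p) h)"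
    unfolding ord_ge_def
  proof (intro allI impI leI notI)
    fix m' assume *: "cf (shift (c p) h) m' \<noteq> 0" "tdeg m' < tdeg m"
    then show False using h0[OF p, of m'] M by (simp add: key_def)
  qed
  have at_p: "cf (shift (c p) (h * u)) m' = cf (shift (c p) u) 0 * cf (shift (c p) h) m'" if "tdeg m' \<le> tdeg m" for m'
    unfolding shift_hu by (rule cf_mult_lowest) (rule ord_ge_mono[OF ord_p that])
  have u0: "cf (shift (c p) u) 0 = (\<Prod>q\<in>P'. c p (b q) - c q (b q))"
    unfolding shift_u cf_prod_0
  proof (rule prod.cong)
    fix q
    have "cf (Var (b q) :: (bool, 'r) mpoly) 0 = 0"
      using ord_ge_Var[of "b q"] unfolding ord_ge_def by force
    then show "cf (Var (b q) + Const (c p (b q) - c q (b q))) 0 = c p (b q) - c q (b q)"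
      by (simp add: lookup_add)
  qed simp
  have "scalar_poly (shift (c p) h)" using h(1) by (auto simp: polys_def intro: scalar_poly_shift)
  then have "cf (shift (c p) u) 0 * cf (shift (c p) h) m \<noteq> 0"
    unfolding u0 using finP' b[symmetric] h(2) c(1)
    by (intro scalar_prod_nonzero[THEN conjunct1]) (auto simp: right_diff_distrib scalar_poly_def)
  then have nz: "cf (shift (c p) (h * u)) m \<noteq> 0" using at_p by simp
  have "cf (shift (c q) (h * u)) m' = 0" if q: "q \<in> P" and less: "key M ?\<beta> (q, m') < key M ?\<beta> (p, m)" for q m'
  proof (cases "q = p")
    case True
    have less': "key M \<beta> (p, m') < key M \<beta> (p, m)" using less True by (simp add: key_def)
    then have "M * tdeg m' \<le> M * tdeg m" by (auto simp: key_def)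
    then have "tdeg m' \<le> tdeg m" using M by simp
    then show ?thesis using at_p h0[OF p less'] True by simp
  next
    case False
    \<comment> \<open>A tie would make the two handicaps agree modulo \<open>M\<close>.\<close>
    have "M * tdeg m' + \<beta> q \<noteq> M * tdeg m + \<beta> p + M"
    proof
      assume "M * tdeg m' + \<beta> q = M * tdeg m + \<beta> p + M"
      then have "(M * tdeg m' + \<beta> q) mod M = (M * tdeg m + \<beta> p + M) mod M" by simp
      then have "\<beta> q mod M = \<beta> p mod M" by simp
      then show False using inj q p False by (auto dest: inj_onD)
    qed
    then have less': "M * tdeg m' + \<beta> q < M * tdeg m + \<beta> p + M"
      using less False by (auto simp: key_def)
    \<comment> \<open>One degree is worth exactly one step \<open>M\<close> of the handicap, so
      before the raise the degrees below \<open>tdeg m'\<close> already come earlier. The missing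
      order is supplied by the factor of \<open>u\<close> that vanishes at \<open>q\<close>.\<close>
    have "ord_ge (tdeg m') (shift (c q) h)"
      unfolding ord_ge_def
    proof (intro allI impI leI notI)
      fix m'' assume *: "cf (shift (c q) h) m'' \<noteq> 0" "tdeg m'' < tdeg m'"
      then have "M * (tdeg m'' + 1) \<le> M * tdeg m'" by (intro mult_le_mono2) simp
      then have "M * tdeg m'' + \<beta> q < M * tdeg m + \<beta> p" using less' by simp
      then show False using h0[OF q, of m''] * by (simp add: key_def)
    qed
    moreover have "ord_ge 1 (shift (c q) u)"
    proof -
      have "q \<in> P'" using q False by (simp add: P'_def)
      then have "shift (c q) u = Var (b q) * (\<Prod>q'\<in>P' - {q}. Var (b q') + Const (c q (b q') - c q' (b q')))"
        unfolding shift_u using finP' by (simp add: prod.remove[of P' q])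
      then show ?thesis using ord_ge_mult[OF ord_ge_Var ord_ge_0] by simp
    qed
    ultimately have "ord_ge (tdeg m' + 1) (shift (c q) (h * u))"
      unfolding shift_hu by (rule ord_ge_mult)
    then show ?thesis unfolding ord_ge_def by force
  qed
  then show "m \<in> basis P c M n ?\<beta> p"
    unfolding basis_def using hu nz by blast
qed

text \<open>Multiplying by the linear forms raises the degree, so degree \<open>n\<close> after the
  raise is compared with degree \<open>n - card P\<close> before it. Passing between these degrees
  without a raise changes the total over the plane by at most \<open>card P * (n + 1)\<close>. No
  point loses by the larger degree, so \<open>p\<close> alone gains at most this much.\<close>

lemma card_basis_raise_handicap:
  fixes c :: "'q \<Rightarrow> bool \<Rightarrow> 'r"
  assumes fin: "finite P" and p: "p \<in> P" and inj: "inj_on (\<lambda>q. \<beta> q mod M) P" and M: "M > 0"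
    and c: "\<And>q b. e * c q b = c q b" "inj_on c P" and n: "card P \<le> n"
  shows "card (basis P c M n \<beta> p) \<le> card (basis P c M n (\<beta>(p := \<beta> p + M)) p) + card P * (n + 1)"
proof -
  define n' where "n' = n - card P"
  have n': "n' \<le> n" "n - n' = card P" "n' + card P \<le> n" using n by (auto simp: n'_def)
  have ne: "P \<noteq> {}" using p by blast
  have mono: "card (basis P c M n' \<beta> q) \<le> card (basis P c M n \<beta> q)" for q
    by (intro card_mono finite_basis basis_mono_degree n')
  have "(\<Sum>q\<in>P. card (basis P c M n \<beta> q)) \<le> (\<Sum>q\<in>P. card (basis P c M n' \<beta> q)) + card P * (n + 1)"
    unfolding sum_card_basis[OF fin ne inj M] using card_tdeg_diff[of n n'] n'(2) by simp
  moreover have "(\<Sum>q\<in>P-{p}. card (basis P c M n' \<beta> q)) \<le> (\<Sum>q\<in>P-{p}. card (basis P c M n \<beta> q))"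
    by (intro sum_mono mono)
  ultimately have "card (basis P c M n \<beta> p) \<le> card (basis P c M n' \<beta> p) + card P * (n + 1)"
    using fin p by (simp add: sum.remove[of P p])
  also have "card (basis P c M n' \<beta> p) \<le> card (basis P c M n (\<beta>(p := \<beta> p + M)) p)"
    by (intro card_mono finite_basis basis_raise_handicap) (use assms n' in auto)
  finally show ?thesis by simp
qed

end

section \<open>Conditions at joints\<close>

context idem_field
begin

text \<open>One factor \<open>e\<close> in front absorbs all the copies of \<open>e\<close> inside,
  because \<open>e\<close> is idempotent.\<close>

lemma Const_e_subst:
  fixes x :: "'i::finite \<Rightarrow> ('j, 'r) mpoly"
  shows "Const e * subst (\<lambda>i. Const e * x i) f = Const e * subst x f"
proof (induction f rule: mpoly_induct)
  case (single m a)
  have ee: "(Const e :: ('j, 'r) mpoly) * Const e = Const e"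
    unfolding Const_mult[symmetric] idem ..
  have "x * x ^ k = x" if "x * x = x" for x :: "('j, 'r) mpoly" and k
    using that by (induction k) (simp_all flip: mult.assoc)
  from this[OF ee] have "(Const e :: ('j, 'r) mpoly) * Const e ^ k = Const e" for k .
  then have *: "Const e * (Const e ^ k * y) = Const e * y" for k and y :: "('j, 'r) mpoly"
    by (simp flip: mult.assoc)
  have prod: "(\<Prod>i\<in>UNIV. (Const e * x i) ^ m i) = Const e ^ (\<Sum>i\<in>UNIV. m i) * (\<Prod>i\<in>UNIV. x i ^ m i)"
    by (simp add: power_mult_distrib prod.distrib power_sum)
  show ?case unfolding subst_single prod mult.left_commute[of _ "Const a"] * ..
qed (simp add: subst_add distrib_left)

lemma subst_Const_e_Var: "scalar_poly f \<Longrightarrow> subst (\<lambda>i. Const e * Var i) f = f"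
  using Const_e_subst[of Var f] scalar_poly_subst[of f "\<lambda>i. Const e * Var i"]
  by (simp add: scalar_poly_iff)

end

lemma order_exists:
  assumes "f \<noteq> 0"
  shows "\<exists>d. ord_ge d f \<and> \<not> ord_ge (Suc d) f"
proof -
  obtain m where "cf f m \<noteq> 0" using assms by (metis poly_mapping_eqI lookup_zero)
  then have "\<not> ord_ge (Suc (tdeg m)) f" by (auto simp: ord_ge_def)
  then show ?thesis using ex_least_nat_less[of "\<lambda>d. \<not> ord_ge d f"] by auto
qed

text \<open>\<open>pt q\<close> is a joint, \<open>pl q t\<close> for \<open>t :: 't\<close> are the planes through it, \<open>og f\<close> and \<open>dir f\<close> are a
  base point and two direction vectors of the plane \<open>f\<close>, and \<open>crd f q\<close> are the coordinates of
  \<open>pt q\<close> on \<open>f\<close>. The last assumption says that the directions of the planes through a joint span.\<close>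

locale joint_config = idem_field e
  for e :: "'r::comm_ring_1" +
  fixes P :: "'q set" and pt :: "'q \<Rightarrow> 'l::finite \<Rightarrow> 'r" and pl :: "'q \<Rightarrow> 't::finite \<Rightarrow> 'f"
    and og :: "'f \<Rightarrow> 'l \<Rightarrow> 'r" and dir :: "'f \<Rightarrow> bool \<Rightarrow> 'l \<Rightarrow> 'r" and crd :: "'f \<Rightarrow> 'q \<Rightarrow> bool \<Rightarrow> 'r"
  assumes finite_P: "finite P" and inj_pt: "inj_on pt P"
    and scalar_crd: "\<And>f q b. e * crd f q b = crd f q b"
    and incidence: "\<And>q t l. q \<in> P \<Longrightarrow>
      pt q l = og (pl q t) l + (\<Sum>b\<in>UNIV. dir (pl q t) b l * crd (pl q t) q b)"
    and spanning: "\<And>q. q \<in> P \<Longrightarrow> \<exists>A. \<forall>l l'.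
      (\<Sum>k\<in>UNIV. dir (pl q (fst k)) (snd k) l * A k l') = (if l = l' then e else 0)"
begin

definition on_plane :: "'f \<Rightarrow> 'q set" where "on_plane f = {q \<in> P. f \<in> range (pl q)}"

definition weight :: "nat \<Rightarrow> nat \<Rightarrow> ('q \<Rightarrow> nat) \<Rightarrow> 'f \<Rightarrow> 'q \<Rightarrow> nat" where
  "weight M n \<beta> f q = card (basis (on_plane f) (crd f) M n \<beta> q)"

lemma finite_on_plane: "finite (on_plane f)"
  using finite_P by (simp add: on_plane_def)

lemma incidence': "q \<in> on_plane f \<Longrightarrow> pt q l = og f l + (\<Sum>b\<in>UNIV. dir f b l * crd f q b)"
  using incidence by (auto simp: on_plane_def)

lemma inj_crd: "inj_on (crd f) (on_plane f)"
proof (rule inj_onI)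
  fix q q' assume q: "q \<in> on_plane f" "q' \<in> on_plane f" "crd f q = crd f q'"
  then have "pt q = pt q'" using incidence' by (intro ext) auto
  then show "q = q'" using inj_pt q by (auto simp: on_plane_def dest: inj_onD)
qed

text \<open>The displacement from a joint in coordinates adapted to its planes: the variables
  \<open>(t, False)\<close> and \<open>(t, True)\<close> run along the plane
  \<open>pl q t\<close>.\<close>

definition frame :: "'q \<Rightarrow> 'l \<Rightarrow> ('t \<times> bool, 'r) mpoly" where
  "frame q l = (\<Sum>k\<in>UNIV. Const (dir (pl q (fst k)) (snd k) l) * Var k)"

text \<open>Frame and centre are separate arguments because a polynomial is expanded in the frame of
  one joint around other points of its planes.\<close>

definition local_expansion :: "'q \<Rightarrow> ('l \<Rightarrow> 'r) \<Rightarrow> ('l, 'r) mpoly \<Rightarrow> ('t \<times> bool, 'r) mpoly" where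
  "local_expansion q x = subst (\<lambda>l. Const (x l) + frame q l)"

lemma local_expansion_alt: "local_expansion q x g = subst (frame q) (shift x g)"
  by (simp add: local_expansion_def shift_def subst_subst subst_add add.commute)

lemma ord_ge_frame: "ord_ge 1 (frame q l)"
  unfolding frame_def by (intro ord_ge_sum ord_ge_Const_mult) auto

lemma deg_le_frame: "deg_le 1 (frame q l)"
  unfolding frame_def by (intro deg_le_sum deg_le_Const_mult) auto

lemma ord_ge_local_expansion: "ord_ge d (shift x g) \<Longrightarrow> ord_ge d (local_expansion q x g)"
  unfolding local_expansion_alt by (rule ord_ge_subst[OF _ ord_ge_frame])

text \<open>Linear forms \<open>y\<close> built from the coefficients in \<open>spanning\<close>
  undo the substitution \<open>frame q\<close> up to the factor \<open>e\<close>, which the scalar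
  polynomial \<open>g\<close> absorbs; and substituting linear forms cannot lower the order.\<close>

lemma ord_ge_local_expansion_imp:
  assumes "q \<in> P" "scalar_poly g" "ord_ge d (local_expansion q x g)"
  shows "ord_ge d (shift x g)"
proof -
  obtain A where A: "\<And>l l'. (\<Sum>k\<in>UNIV. dir (pl q (fst k)) (snd k) l * A k l') = (if l = l' then e else 0)"
    using spanning[OF assms(1)] by blast
  define y where "y k = (\<Sum>l'\<in>UNIV. Const (A k l') * Var l' :: ('l, 'r) mpoly)" for k
  have y: "subst y (frame q l) = Const e * Var l" for l
  proof -
    have "subst y (frame q l) = (\<Sum>k\<in>UNIV. \<Sum>l'\<in>UNIV. Const (dir (pl q (fst k)) (snd k) l * A k l') * Var l')"
      by (simp add: frame_def subst_sum subst_mult y_def sum_distrib_left Const_mult mult.assoc)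
    also have "\<dots> = (\<Sum>l'\<in>UNIV. (\<Sum>k\<in>UNIV. Const (dir (pl q (fst k)) (snd k) l * A k l')) * Var l')"
      by (subst sum.swap) (simp add: sum_distrib_right)
    also have "\<dots> = (\<Sum>l'\<in>UNIV. Const (if l = l' then e else 0) * Var l')"
    proof (rule sum.cong)
      fix l'
      have "(\<Sum>k\<in>B. Const (dir (pl q (fst k)) (snd k) l * A k l')) =
          (Const (\<Sum>k\<in>B. dir (pl q (fst k)) (snd k) l * A k l') :: ('l, 'r) mpoly)" for B
        by (induction B rule: infinite_finite_induct) (simp_all add: single_add)
      then show "(\<Sum>k\<in>UNIV. Const (dir (pl q (fst k)) (snd k) l * A k l')) * Var l' =
          (Const (if l = l' then e else 0) * Var l' :: ('l, 'r) mpoly)"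
        by (simp add: A)
    qed simp
    also have "\<dots> = (\<Sum>l'\<in>UNIV. if l' = l then Const e * Var l else 0)"
      by (rule sum.cong) auto
    finally show ?thesis by simp
  qed
  have "ord_ge d (subst y (local_expansion q x g))"
    using assms(3)
  proof (rule ord_ge_subst)
    show "ord_ge 1 (y k)" for k unfolding y_def by (intro ord_ge_sum ord_ge_Const_mult) auto
  qed
  also have "subst y (local_expansion q x g) = shift x g"
    unfolding local_expansion_alt subst_subst y
    by (rule subst_Const_e_Var) (rule scalar_poly_shift[OF assms(2)])
  finally show ?thesis .
qed

text \<open>If the part of \<nu> on one plane was not kept, the coefficient polynomial
  \<open>h\<close> on that plane violates an earlier condition too. This contradicts the choice of
  \<open>p\<close> or, when the keys tie in the first component, the choice of \<nu>.\<close>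

lemma vanishing:
  assumes ne: "P \<noteq> {}" and inj: "inj_on (\<lambda>q. \<beta> q mod M) P" and M: "M > 0" and g: "g \<in> polys n"
    and van: "\<And>q \<nu>. q \<in> P \<Longrightarrow>
      (\<And>t. (\<lambda>b. \<nu> (t, b)) \<in> basis (on_plane (pl q t)) (crd (pl q t)) M n \<beta> q) \<Longrightarrow>
      cf (local_expansion q (pt q) g) \<nu> = 0"
  shows "g = 0"
proof (rule ccontr)
  assume "g \<noteq> 0"
  have gs: "scalar_poly g" and gd: "deg_le n g" using g by (auto simp: polys_def)
  have "shift (pt q) g \<noteq> 0" for q
    using \<open>g \<noteq> 0\<close> by (metis shift_cancel shift_def subst_zero)
  then have "\<forall>q. \<exists>d. ord_ge d (shift (pt q) g) \<and> \<not> ord_ge (Suc d) (shift (pt q) g)"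
    using order_exists by blast
  then obtain v where v: "\<And>q. ord_ge (v q) (shift (pt q) g)" "\<And>q. \<not> ord_ge (Suc (v q)) (shift (pt q) g)"
    by metis
  obtain p where p: "p \<in> P" and pmin: "\<And>q. q \<in> P \<Longrightarrow> M * v p + \<beta> p \<le> M * v q + \<beta> q"
    using ex_has_least_nat[of "\<lambda>q. q \<in> P" _ "\<lambda>q. M * v q + \<beta> q"] ne by blast
  let ?G = "local_expansion p (pt p) g"
  have G: "ord_ge (v p) ?G" "\<not> ord_ge (Suc (v p)) ?G"
    using ord_ge_local_expansion[OF v(1)] ord_ge_local_expansion_imp[OF p gs] v(2) by blast+
  then have "\<exists>\<nu>. cf ?G \<nu> \<noteq> 0 \<and> tdeg \<nu> = v p" unfolding ord_ge_def by (metis not_less_eq_eq le_antisym)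
  \<comment> \<open>Minimising the sum of the \<open>False\<close>-exponents matches the second
    component of \<open>key\<close> and settles the ties at \<open>p\<close>.\<close>
  then obtain \<nu> where \<nu>: "cf ?G \<nu> \<noteq> 0" "tdeg \<nu> = v p"
    and \<nu>min: "\<And>\<nu>'. cf ?G \<nu>' \<noteq> 0 \<Longrightarrow> tdeg \<nu>' = v p \<Longrightarrow> (\<Sum>t\<in>UNIV. \<nu> (t, False)) \<le> (\<Sum>t\<in>UNIV. \<nu>' (t, False))"
    using ex_has_least_nat[of "\<lambda>\<nu>. cf ?G \<nu> \<noteq> 0 \<and> tdeg \<nu> = v p" _ "\<lambda>\<nu>. \<Sum>t\<in>UNIV. \<nu> (t, False)"] by blast
  obtain t where t: "(\<lambda>b. \<nu> (t, b)) \<notin> basis (on_plane (pl p t)) (crd (pl p t)) M n \<beta> p"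
    using van[OF p] \<nu>(1) by blast
  define f where "f = pl p t"
  define \<nu>1 where "\<nu>1 = (\<lambda>b. \<nu> (t, b))"
  define \<rho> where "\<rho> = (\<lambda>(t', b). if t' = t then 0 else \<nu> (t', b))"
  have \<nu>_split: "\<nu> = \<rho> + embed_exp t \<nu>1"
    by (auto simp: \<nu>1_def \<rho>_def embed_exp_def)
  have \<rho>t: "\<rho> (t, b) = 0" for b by (simp add: \<rho>_def)
  have pf: "p \<in> on_plane f" using p by (simp add: on_plane_def f_def)
  \<comment> \<open>Centred at the base point of the plane, so that a translation by
    \<open>crd f q\<close> in the block \<open>t\<close> brings the centre to any joint
    \<open>q\<close> on \<open>f\<close>. The frame stays that of \<open>p\<close>.\<close>
  define H where "H = local_expansion p (og f) g"
  define h where "h = slice t \<rho> H"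
  have H_shift: "shift (\<lambda>(t', b). if t' = t then crd f q b else 0) H = local_expansion p (pt q) g"
    if q: "q \<in> on_plane f" for q
  proof -
    let ?c = "\<lambda>(t', b). if t' = t then crd f q b else 0"
    have "subst (\<lambda>k. Var k + Const (?c k)) (Const (og f l) + frame p l) = Const (pt q l) + frame p l" for l
    proof -
      have "subst (\<lambda>k. Var k + Const (?c k)) (frame p l) =
          (\<Sum>k\<in>UNIV. Const (dir (pl p (fst k)) (snd k) l * ?c k)) + frame p l"
        by (simp add: frame_def subst_sum subst_mult distrib_left sum.distrib Const_mult add.commute)
      also have "(\<Sum>k\<in>UNIV. Const (dir (pl p (fst k)) (snd k) l * ?c k)) =
          (\<Sum>k\<in>{t} \<times> UNIV. Const (dir (pl p (fst k)) (snd k) l * ?c k) :: ('t \<times> bool, 'r) mpoly)"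
        by (rule sum.mono_neutral_right) (auto split: if_splits)
      also have "\<dots> = (\<Sum>b\<in>UNIV. Const (dir f b l * crd f q b))"
        by (simp add: sum.cartesian_product[symmetric] f_def UNIV_bool)
      finally have *: "subst (\<lambda>k. Var k + Const (?c k)) (frame p l) =
          (\<Sum>b\<in>UNIV. Const (dir f b l * crd f q b)) + frame p l" .
      show ?thesis
        unfolding subst_add subst_Const * by (simp add: incidence'[OF q] UNIV_bool single_add add_ac)
    qed
    then show ?thesis
      unfolding H_def local_expansion_def shift_def subst_subst by simp
  qed
  have D: "cf (shift (crd f q) h) m = cf (local_expansion p (pt q) g) (\<rho> + embed_exp t m)"
    if q: "q \<in> on_plane f" for q m
    unfolding h_def using slice_shift[where t=t and \<rho>=\<rho> and c="crd f q" and f=H, OF \<rho>t]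
    by (simp add: H_shift[OF q] cf_slice[symmetric])
  have Hd: "deg_le n H"
    unfolding H_def local_expansion_def
    by (rule deg_le_subst[OF gd]) (intro deg_le_add deg_le_frame deg_le_Const)
  have Hs: "scalar_poly H" unfolding H_def local_expansion_def by (rule scalar_poly_subst[OF gs])
  have "deg_le n h"
    unfolding deg_le_def
  proof (intro allI impI)
    fix m assume "cf h m \<noteq> 0"
    then have "tdeg (\<rho> + embed_exp t m) \<le> n" using Hd by (simp add: h_def cf_slice deg_le_def)
    then show "tdeg m \<le> n" by (simp add: tdeg_add tdeg_embed_exp)
  qed
  moreover have "scalar_poly h" using Hs by (simp add: scalar_poly_def h_def cf_slice)
  ultimately have h: "h \<in> polys n" by (simp add: polys_def)
  have "cf (shift (crd f p) h) \<nu>1 \<noteq> 0" using \<nu>(1) D[OF pf] \<nu>_split by simp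
  then obtain q m where q: "q \<in> on_plane f" and less: "key M \<beta> (q, m) < key M \<beta> (p, \<nu>1)"
    and nz: "cf (shift (crd f q) h) m \<noteq> 0"
    using t h unfolding basis_def f_def[symmetric] \<nu>1_def[symmetric] by blast
  have nz': "cf (local_expansion p (pt q) g) (\<rho> + embed_exp t m) \<noteq> 0" using nz D[OF q] by simp
  have qP: "q \<in> P" using q by (simp add: on_plane_def)
  have vq: "v q \<le> tdeg \<rho> + tdeg m"
  proof -
    have "v q \<le> tdeg (\<rho> + embed_exp t m)"
      using ord_ge_local_expansion[OF v(1)[of q]] nz' unfolding ord_ge_def by blast
    then show ?thesis by (simp add: tdeg_add tdeg_embed_exp)
  qed
  have vp: "v p = tdeg \<rho> + tdeg \<nu>1"
    using \<nu>(2) \<nu>_split by (metis tdeg_add tdeg_embed_exp)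
  have "M * v q \<le> M * tdeg \<rho> + M * tdeg m" using mult_le_mono2[OF vq, of M] by (simp add: distrib_left)
  moreover have "M * v p = M * tdeg \<rho> + M * tdeg \<nu>1" by (simp add: vp distrib_left)
  \<comment> \<open>Minimality of \<open>p\<close> reverses the inequality in \<open>less\<close>
    for the first components, so only a tie is left. It forces \<open>q = p\<close>, and then
    \<open>\<rho> + embed_exp t m\<close> beats \<nu>.\<close>
  ultimately have "M * tdeg \<nu>1 + \<beta> p \<le> M * tdeg m + \<beta> q" using pmin[OF qP] by linarith
  then have eq: "M * tdeg m + \<beta> q = M * tdeg \<nu>1 + \<beta> p" and lt: "m False < \<nu>1 False"
    using less by (auto simp: key_def)
  from eq have "\<beta> q mod M = \<beta> p mod M" by (metis mod_mult_self4)
  then have qp: "q = p" using inj qP p by (auto dest: inj_onD)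
  then have "tdeg m = tdeg \<nu>1" using eq M by simp
  then have "tdeg (\<rho> + embed_exp t m) = v p" by (simp add: vp tdeg_add tdeg_embed_exp)
  then have "(\<Sum>t'\<in>UNIV. \<nu> (t', False)) \<le> (\<Sum>t'\<in>UNIV. (\<rho> + embed_exp t m) (t', False))"
    using \<nu>min nz' qp by blast
  moreover have "(\<Sum>t'\<in>UNIV. (\<rho> + embed_exp t m) (t', False)) < (\<Sum>t'\<in>UNIV. \<nu> (t', False))"
    by (rule sum_strict_mono_ex1) (use lt in \<open>auto simp: \<nu>_split embed_exp_def \<rho>_def\<close>)
  ultimately show False by simp
qed

text \<open>With fewer conditions than monomials, a non-zero polynomial would satisfy them all,
  against \<open>vanishing\<close>. The monomials with every exponent at most \<open>k\<close> are
  used because their number is an exact power and their degrees stay within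
  \<open>n\<close>.\<close>

lemma sum_weights_ge:
  assumes ne: "P \<noteq> {}" and inj: "inj_on (\<lambda>q. \<beta> q mod M) P" and M: "M > 0"
    and n: "n = CARD('l) * k"
  shows "(k + 1) ^ CARD('l) \<le> (\<Sum>q\<in>P. \<Prod>t\<in>UNIV. weight M n \<beta> (pl q t) q)"
proof (rule ccontr)
  assume less: "\<not> ?thesis"
  define I where "I = Sigma P (\<lambda>q. PiE UNIV (\<lambda>t. basis (on_plane (pl q t)) (crd (pl q t)) M n \<beta> q))"
  define J where "J = {\<mu> :: 'l \<Rightarrow> nat. \<forall>i. \<mu> i \<le> k}"
  have finI: "finite I" unfolding I_def
    by (intro finite_SigmaI finite_P finite_PiE finite_basis) auto
  have "card I = (\<Sum>q\<in>P. \<Prod>t\<in>UNIV. weight M n \<beta> (pl q t) q)"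
    unfolding I_def weight_def by (subst card_SigmaI) (auto simp: finite_P card_PiE intro!: finite_PiE finite_basis)
  then have card: "card I < card J" using less by (simp add: J_def card_exponents)
  have finJ: "finite J" unfolding J_def by (rule finite_exponents)
  define a where "a = (\<lambda>(q, \<nu>) j. cf (local_expansion q (pt q) (Poly_Mapping.single j 1)) (\<lambda>(t, b). \<nu> t b))"
  obtain v where v: "\<forall>j. e * v j = v j" "\<exists>j\<in>J. v j \<noteq> 0" "\<forall>i\<in>I. (\<Sum>j\<in>J. a i j * v j) = 0"
    using homogeneous_solution[OF finI finJ card, of a] by blast
  define g where "g = (\<Sum>j\<in>J. Poly_Mapping.single j (v j))"
  have cf_g: "cf g j = (if j \<in> J then v j else 0)" for j
    unfolding g_def lookup_sum lookup_single when_def using finJ by (simp add: sum.delta)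
  have single: "Poly_Mapping.single j x = Const x * Poly_Mapping.single j 1" for j :: "'l \<Rightarrow> nat" and x :: 'r
    by (simp add: mult_single)
  have "tdeg j \<le> n" if "j \<in> J" for j
  proof -
    have "tdeg j \<le> (\<Sum>i\<in>(UNIV :: 'l set). k)" unfolding tdeg_def using that by (intro sum_mono) (auto simp: J_def)
    then show ?thesis by (simp add: n)
  qed
  then have g: "g \<in> polys n"
    using v(1) unfolding polys_def by (auto simp: deg_le_def scalar_poly_def cf_g)
  have "cf (local_expansion q (pt q) g) \<nu> = 0"
    if q: "q \<in> P" and \<nu>: "\<And>t. (\<lambda>b. \<nu> (t, b)) \<in> basis (on_plane (pl q t)) (crd (pl q t)) M n \<beta> q" for q \<nu>
  proof -
    have "(q, \<lambda>t b. \<nu> (t, b)) \<in> I" using q \<nu> by (auto simp: I_def)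
    then have "(\<Sum>j\<in>J. a (q, \<lambda>t b. \<nu> (t, b)) j * v j) = 0" using v(3) by blast
    moreover have "local_expansion q (pt q) g =
        (\<Sum>j\<in>J. Const (v j) * local_expansion q (pt q) (Poly_Mapping.single j 1))"
      unfolding g_def local_expansion_def subst_sum by (subst single) (simp only: subst_mult subst_Const)
    ultimately show ?thesis by (simp add: lookup_sum cf_Const_mult a_def mult.commute)
  qed
  then have "g = 0" by (rule vanishing[OF ne inj M g])
  then have "v j = 0" if "j \<in> J" for j using cf_g[of j] that by simp
  then show False using v(2) by blast
qed

end

section \<open>The choice of handicaps\<close>

text \<open>Exchanging one factor at a time costs at most
  \<open>D * U ^ (card A - 1)\<close>.\<close>

lemma prod_diff_le:
  fixes b b' :: "'t \<Rightarrow> nat"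
  assumes "finite A" "\<And>t. b t \<le> b' t + D" "\<And>t. b t \<le> U" "\<And>t. b' t \<le> U"
  shows "prod b A \<le> prod b' A + card A * D * U ^ (card A - 1)"
  using assms(1)
proof (induction A rule: finite_induct)
  case (insert t A)
  have UA: "U * (card A * D * U ^ (card A - 1)) = card A * D * U ^ card A"
    by (cases "card A") (auto simp: algebra_simps)
  have pr: "prod b' A \<le> U ^ card A" using prod_mono[of A b' "\<lambda>_. U"] assms(4) by simp
  have "b t * prod b A \<le> b t * prod b' A + b t * (card A * D * U ^ (card A - 1))"
    using mult_le_mono2[OF insert.IH, of "b t"] by (simp add: distrib_left)
  also have "\<dots> \<le> (b' t + D) * prod b' A + U * (card A * D * U ^ (card A - 1))"
    by (intro add_mono mult_le_mono1 assms)
  also have "\<dots> \<le> b' t * prod b' A + D * U ^ card A + card A * D * U ^ card A"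
    unfolding UA using mult_le_mono2[OF pr, of D] by (simp add: distrib_right)
  finally show ?case using insert.hyps by (simp add: algebra_simps)
qed simp

text \<open>Pigeonhole on the blocks \<open>a q div g\<close>: since \<open>q0\<close> lies above
  the first \<open>card P\<close> blocks, the remaining \<open>card P - 1\<close> points leave one
  of these empty. The threshold is the upper end of the empty block.\<close>

lemma exists_gap:
  fixes a :: "'q \<Rightarrow> nat"
  assumes "finite P" "q0 \<in> P" "card P * g \<le> a q0" "g > 0"
  shows "\<exists>t>0. (\<exists>q\<in>P. t \<le> a q) \<and> (\<forall>q\<in>P. a q < t \<longrightarrow> a q + g \<le> t)"
proof -
  define h where "h q = a q div g" for q
  have h0: "card P \<le> h q0" unfolding h_def using assms by (metis div_le_mono nonzero_mult_div_cancel_right not_gr0)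
  have "card (h ` (P - {q0})) < card P"
    using card_image_le[of "P - {q0}" h] card_Diff1_less[OF assms(1,2)] assms(1) by simp
  then have "\<not> {..<card P} \<subseteq> h ` (P - {q0})"
    using card_mono[of "h ` (P - {q0})" "{..<card P}"] assms(1) by auto
  then obtain j where j': "j < card P" "j \<notin> h ` (P - {q0})" by auto
  have j: "j < card P" "j \<notin> h ` P"
  proof -
    show "j \<notin> h ` P"
    proof
      assume "j \<in> h ` P"
      then obtain q where "q \<in> P" "j = h q" by blast
      then show False using j' h0 by (cases "q = q0") auto
    qed
  qed (rule j')
  show ?thesis
  proof (intro exI[of _ "Suc j * g"] conjI ballI impI)
    show "0 < Suc j * g" using assms by simp
    have "Suc j * g \<le> card P * g" using j(1) by (intro mult_le_mono1) simp
    then show "\<exists>q\<in>P. Suc j * g \<le> a q" using assms by (meson le_trans)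
    fix q assume q: "q \<in> P" "a q < Suc j * g"
    then have "h q < Suc j" unfolding h_def by (simp add: less_mult_imp_div_less)
    then have "h q < j" using j q by (metis image_eqI less_SucE)
    then have "Suc (h q) * g \<le> j * g" by (intro mult_le_mono1) simp
    moreover have "a q < Suc (h q) * g" unfolding h_def using assms(4)
      by (simp add: dividend_less_div_times)
    ultimately show "a q + g \<le> Suc j * g" by simp
  qed
qed

lemma joint_config_subset:
  assumes "joint_config e P pt pl og dir crd" "Q \<subseteq> P"
  shows "joint_config e Q pt pl og dir crd"
proof -
  interpret joint_config e P pt pl og dir crd by fact
  show ?thesis
  proof unfold_locales
    show "finite Q" using assms(2) finite_P by (rule finite_subset)
    show "inj_on pt Q" using inj_pt assms(2) by (rule inj_on_subset)
  qed (use scalar_crd incidence spanning assms(2) in blast)+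
qed

context joint_config
begin

definition planes_of :: "'q set \<Rightarrow> 'f set" where "planes_of S = (\<Union>q\<in>S. range (pl q))"

lemma finite_planes_of: "finite S \<Longrightarrow> finite (planes_of S)"
  by (simp add: planes_of_def)

text \<open>Starting from equal handicaps, the handicap of a joint of too large weight is raised again and
  again. Since the weights always have a large sum, this never stops, and eventually the handicaps of
  some joints are far above those of all others. No plane carries joints of both kinds, because on
  such a plane the former would have weight \<open>0\<close>.\<close>

lemma closed_subset:
  assumes t3: "CARD('t) = 3" and l6: "CARD('l) = 6"
    and ne: "P \<noteq> {}" and J: "card P \<le> J" and y: "y > 0" "y ^ 3 = 4 * real J"
  shows "\<exists>S\<subseteq>P. S \<noteq> {} \<and> (\<forall>p\<in>S. \<forall>q\<in>P - S. range (pl p) \<inter> range (pl q) = {}) \<and>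
    real (card S) \<le> 36 * y * real (card (planes_of S))"
proof -
  \<comment> \<open>Raising a handicap lowers the weight of its joint by at most \<open>T' = T / 2\<close>, and \<open>4 J T' = x\<^sup>6\<close>.\<close>
  define x where "x = 93312 * J ^ 2"
  define T where "T = 46656 * J * x ^ 5"
  define T' where "T' = 23328 * J * x ^ 5"
  \<comment> \<open>This makes the lower bound of \<open>sum_weights_ge\<close> exactly
    \<open>x ^ 6\<close>.\<close>
  define n where "n = 6 * (x - 1)"
  define M where "M = card P"
  have M: "M > 0" using ne finite_P by (simp add: M_def card_gt_0_iff)
  then have J0: "J > 0" using J by (simp add: M_def)
  then have x0: "x > 0" by (simp add: x_def)
  have "J \<le> J ^ 2" by (simp add: power2_eq_square)
  then have nJ: "J \<le> n" unfolding n_def x_def using J0 by linarith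
  have n1: "n + 1 \<le> 6 * x" using x0 by (simp add: n_def)
  have JT: "2 * (J * T) = x ^ 6"
    by (simp add: T_def power_Suc[of x 5, simplified] mult.assoc[symmetric])
      (simp add: x_def power2_eq_square)
  obtain idx where idx: "bij_betw idx P {..<M}"
    using ex_bij_betw_finite_nat[OF finite_P] by (auto simp: M_def atLeast0LessThan)
  \<comment> \<open>\<open>a q\<close> counts the raises of \<open>q\<close>; \<open>idx q\<close>
    is its residue modulo \<open>M\<close>, which never changes.\<close>
  define \<beta> where "\<beta> a q = idx q + M * a q" for a q
  have idxM: "idx q < M" if "q \<in> P" for q using idx that by (auto simp: bij_betw_def)
  have inj: "inj_on (\<lambda>q. \<beta> a q mod M) P" for a
    using idx by (auto simp: \<beta>_def bij_betw_def inj_on_def idxM)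
  define W where "W a q = (\<Prod>t\<in>UNIV. weight M n (\<beta> a) (pl q t) q)" for a q
  have \<beta>_upd: "\<beta> (a(p := Suc (a p))) = (\<beta> a)(p := \<beta> a p + M)" for a p
    by (auto simp: \<beta>_def)
  have W_other: "W a q \<le> W (a(p := Suc (a p))) q" if "q \<noteq> p" for a p q
    unfolding W_def \<beta>_upd weight_def
    by (intro prod_mono conjI le0 card_mono finite_basis basis_mono_handicap[where p=p]) (use that in auto)
  have W_raise: "W a p \<le> W (a(p := Suc (a p))) p + T'" if p: "p \<in> P" for a p
  proof -
    let ?b = "\<lambda>t. weight M n (\<beta> a) (pl p t) p" and ?b' = "\<lambda>t. weight M n (\<beta> (a(p := Suc (a p)))) (pl p t) p"
    have b: "?b t \<le> ?b' t + J * (6 * x)" for t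
    proof -
      have op: "p \<in> on_plane (pl p t)" using p by (simp add: on_plane_def)
      have sub: "on_plane (pl p t) \<subseteq> P" by (auto simp: on_plane_def)
      have le: "card (on_plane (pl p t)) \<le> J" using card_mono[OF finite_P sub] J by simp
      have "?b t \<le> ?b' t + card (on_plane (pl p t)) * (n + 1)"
        unfolding weight_def \<beta>_upd
        by (rule card_basis_raise_handicap[OF finite_on_plane op inj_on_subset[OF inj sub] M scalar_crd inj_crd])
          (use le nJ in simp)
      also have "card (on_plane (pl p t)) * (n + 1) \<le> J * (6 * x)" by (intro mult_le_mono le n1)
      finally show ?thesis by (simp del: fun_upd_apply)
    qed
    have U: "weight M n \<gamma> f q \<le> 36 * x ^ 2" for \<gamma> f q
    proof -
      have "weight M n \<gamma> f q \<le> (n + 1) ^ 2" unfolding weight_def by (rule card_basis_le)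
      also have "\<dots> \<le> (6 * x) ^ 2" using n1 by (rule power_mono) simp
      finally show ?thesis by (simp add: power_mult_distrib)
    qed
    have "W a p \<le> W (a(p := Suc (a p))) p + card (UNIV :: 't set) * (J * (6 * x)) * (36 * x ^ 2) ^ (card (UNIV :: 't set) - 1)"
      unfolding W_def by (rule prod_diff_le[OF _ b U U]) simp
    also have "card (UNIV :: 't set) * (J * (6 * x)) * (36 * x ^ 2) ^ (card (UNIV :: 't set) - 1) = T'"
    proof -
      have x5: "x ^ 5 = x * (x ^ 2) ^ 2" by (simp add: eval_nat_numeral)
      show ?thesis unfolding T'_def x5 t3 by (simp add: power_mult_distrib)
    qed
    finally show ?thesis .
  qed
  \<comment> \<open>Only joints with product above \<open>T\<close> are raised, so a joint that was
    raised keeps at least \<open>T - T' = T'\<close>: its own raise costs at most \<open>T'\<close>,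
    and raises elsewhere do not lower its product.\<close>
  have process: "\<exists>a. (\<forall>q\<in>P. a q > 0 \<longrightarrow> T' \<le> W a q) \<and> sum a P = K" for K
  proof (induction K)
    case 0
    show ?case by (rule exI[of _ "\<lambda>_. 0"]) simp
  next
    case (Suc K)
    then obtain a where a: "\<forall>q\<in>P. a q > 0 \<longrightarrow> T' \<le> W a q" "sum a P = K" by blast
    have "\<exists>q\<in>P. T < W a q"
    proof (rule ccontr)
      assume "\<not> ?thesis"
      then have "\<And>q. q \<in> P \<Longrightarrow> W a q \<le> T" by (auto simp: not_less)
      then have "sum (W a) P \<le> card P * T" using sum_bounded_above[of P "W a" T] by simp
      also have "\<dots> \<le> J * T" using J by simp
      also have "\<dots> < x ^ 6" using JT zero_less_power[OF x0, of 6] by linarith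
      finally have "sum (W a) P < x ^ 6" .
      moreover have "x ^ 6 \<le> sum (W a) P"
        using sum_weights_ge[OF ne inj M, of n "x - 1" a] x0 unfolding W_def l6 by (simp add: n_def)
      ultimately show False by simp
    qed
    then obtain p where p: "p \<in> P" "T < W a p" by blast
    let ?a = "a(p := Suc (a p))"
    have "T' \<le> W ?a p" using W_raise[OF p(1), of a] p(2) by (simp add: T_def T'_def)
    moreover have "T' \<le> W ?a q" if "q \<in> P" "q \<noteq> p" "?a q > 0" for q
      using a(1) W_other[OF that(2), of a] that by (auto intro: order_trans)
    ultimately have "\<forall>q\<in>P. ?a q > 0 \<longrightarrow> T' \<le> W ?a q" by auto
    moreover have "sum ?a P = Suc K"
      using a(2) finite_P p(1) by (simp add: sum.remove[of P p])
    ultimately show ?case by blast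
  qed
  \<comment> \<open>With this many raises some joint receives at least
    \<open>card P * (n + 1)\<close> of them, which is enough for a gap of length
    \<open>n + 1\<close>.\<close>
  obtain a where a: "\<And>q. q \<in> P \<Longrightarrow> a q > 0 \<Longrightarrow> T' \<le> W a q" "sum a P = card P * (card P * (n + 1))"
    using process by metis
  have "\<exists>q\<in>P. card P * (n + 1) \<le> a q"
  proof (rule ccontr)
    assume "\<not> ?thesis"
    then have "sum a P < (\<Sum>q\<in>P. card P * (n + 1))" by (intro sum_strict_mono finite_P ne) auto
    then show False using a(2) by simp
  qed
  then obtain q0 where q0: "q0 \<in> P" "card P * (n + 1) \<le> a q0" by blast
  have "\<exists>t>0. (\<exists>q\<in>P. t \<le> a q) \<and> (\<forall>q\<in>P. a q < t \<longrightarrow> a q + (n + 1) \<le> t)"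
    by (rule exists_gap[of P q0 "n + 1" a]) (use finite_P q0 in simp_all)
  then obtain t where t: "t > 0" "\<exists>q\<in>P. t \<le> a q" "\<And>q. q \<in> P \<Longrightarrow> a q < t \<Longrightarrow> a q + (n + 1) \<le> t"
    by blast
  define S where "S = {q\<in>P. t \<le> a q}"
  have SP: "S \<subseteq> P" and S: "S \<noteq> {}" using t by (auto simp: S_def)
  have finS: "finite S" using SP finite_P by (rule finite_subset)
  have T'0: "T' > 0" using J0 x0 by (simp add: T'_def)
  have WS: "T' \<le> W a p" if "p \<in> S" for p using that a(1) t(1) by (auto simp: S_def)
  have closed: "range (pl p) \<inter> range (pl q) = {}" if p: "p \<in> S" and q: "q \<in> P - S" for p q
  proof (rule ccontr)
    assume "range (pl p) \<inter> range (pl q) \<noteq> {}"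
    then obtain i j where ij: "pl p i = pl q j" by auto
    have "a q < t" "t \<le> a p" using p q by (auto simp: S_def)
    then have "a q + (n + 1) \<le> a p" using t(3)[of q] q by simp
    \<comment> \<open>The gap is \<open>n + 1\<close> rather than \<open>n\<close>: the additional
      \<open>M\<close> absorbs the residue \<open>idx q < M\<close>.\<close>
    then have "M * (a q + (n + 1)) \<le> M * a p" by (rule mult_le_mono2)
    moreover have "idx q < M" using q by (intro idxM) auto
    ultimately have "M * n + \<beta> a q < \<beta> a p" by (simp add: \<beta>_def algebra_simps)
    moreover have "q \<in> on_plane (pl p i)" using q ij by (auto simp: on_plane_def)
    ultimately have "weight M n (\<beta> a) (pl p i) p = 0"
      unfolding weight_def by (simp add: basis_empty)
    then have "W a p = 0" unfolding W_def by (simp add: prod_zero_iff) blast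
    then show False using WS[OF p] T'0 by simp
  qed
  have xy: "real T' * y ^ 3 = real x ^ 6"
  proof -
    have "real T' * y ^ 3 = real (2 * (J * T))" unfolding y(2) by (simp add: T_def T'_def)
    then show ?thesis unfolding JT by simp
  qed
  \<comment> \<open>A product of at least \<open>T' = x ^ 6 / y ^ 3\<close> means that the largest
    of the three weights is at least \<open>x ^ 2 / y\<close>.\<close>
  have "\<exists>i. real x ^ 2 \<le> real (weight M n (\<beta> a) (pl p i) p) * y" if p: "p \<in> S" for p
  proof (rule ccontr)
    assume "\<not> ?thesis"
    then have less: "real (weight M n (\<beta> a) (pl p i) p) * y < real x ^ 2" for i by (simp add: not_le)
    have "(\<Prod>i\<in>(UNIV::'t set). real (weight M n (\<beta> a) (pl p i) p) * y) < (\<Prod>i\<in>(UNIV::'t set). real x ^ 2)"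
      by (rule prod_mono_strict) (use less y x0 in \<open>auto simp: less_imp_le\<close>)
    also have "(\<Prod>i\<in>(UNIV::'t set). real x ^ 2) = real x ^ 6" by (simp add: t3 power_mult[symmetric])
    also have "(\<Prod>i\<in>(UNIV::'t set). real (weight M n (\<beta> a) (pl p i) p) * y) = real (W a p) * y ^ 3"
      by (simp add: prod.distrib t3 W_def)
    finally have "real (W a p) * y ^ 3 < real x ^ 6" .
    moreover have "real T' * y ^ 3 \<le> real (W a p) * y ^ 3"
      using WS[OF p] y by (intro mult_right_mono) auto
    ultimately show False using xy by simp
  qed
  then obtain i where i: "\<And>p. p \<in> S \<Longrightarrow> real x ^ 2 \<le> real (weight M n (\<beta> a) (pl p (i p)) p) * y" by metis
  \<comment> \<open>Each joint is charged to one plane where its weight is at least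
    \<open>x ^ 2 / y\<close>. The weights on a plane add up to at most \<open>36 * x ^ 2\<close>, so
    no plane is charged more than \<open>36 * y\<close> times.\<close>
  define \<tau> where "\<tau> p = pl p (i p)" for p
  have finN: "finite (planes_of S)" using finS by (rule finite_planes_of)
  have \<tau>N: "\<tau> ` S \<subseteq> planes_of S" by (auto simp: \<tau>_def planes_of_def)
  have "(\<Sum>p\<in>S. weight M n (\<beta> a) (\<tau> p) p) = (\<Sum>f\<in>planes_of S. \<Sum>p\<in>{p\<in>S. \<tau> p = f}. weight M n (\<beta> a) (\<tau> p) p)"
    using sum.group[OF finS finN \<tau>N, of "\<lambda>p. weight M n (\<beta> a) (\<tau> p) p"] by simp
  also have "\<dots> \<le> (\<Sum>f\<in>planes_of S. 36 * x ^ 2)"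
  proof (rule sum_mono)
    fix f assume f: "f \<in> planes_of S"
    then have op: "on_plane f \<noteq> {}" using SP by (auto simp: planes_of_def on_plane_def)
    have sub: "on_plane f \<subseteq> P" by (auto simp: on_plane_def)
    have "(\<Sum>p\<in>{p\<in>S. \<tau> p = f}. weight M n (\<beta> a) (\<tau> p) p) = (\<Sum>p\<in>{p\<in>S. \<tau> p = f}. weight M n (\<beta> a) f p)"
      by (rule sum.cong) auto
    also have "\<dots> \<le> (\<Sum>p\<in>on_plane f. weight M n (\<beta> a) f p)"
      by (rule sum_mono2[OF finite_on_plane]) (use SP in \<open>auto simp: on_plane_def \<tau>_def\<close>)
    also have "\<dots> = card {m :: bool \<Rightarrow> nat. tdeg m \<le> n}"
      unfolding weight_def by (rule sum_card_basis[OF finite_on_plane op inj_on_subset[OF inj sub] M])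
    also have "\<dots> \<le> (n + 1) ^ 2" by (rule card_tdeg_le)
    also have "\<dots> \<le> (6 * x) ^ 2" using n1 by (rule power_mono) simp
    finally show "(\<Sum>p\<in>{p\<in>S. \<tau> p = f}. weight M n (\<beta> a) (\<tau> p) p) \<le> 36 * x ^ 2"
      by (simp add: power_mult_distrib)
  qed
  finally have le: "(\<Sum>p\<in>S. weight M n (\<beta> a) (\<tau> p) p) \<le> card (planes_of S) * (36 * x ^ 2)" by simp
  have "real (card S) * real x ^ 2 = (\<Sum>p\<in>S. real x ^ 2)" by simp
  also have "\<dots> \<le> (\<Sum>p\<in>S. real (weight M n (\<beta> a) (\<tau> p) p) * y)"
    unfolding \<tau>_def by (rule sum_mono) (rule i)
  also have "\<dots> = real (\<Sum>p\<in>S. weight M n (\<beta> a) (\<tau> p) p) * y" by (simp add: sum_distrib_right)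
  also have "\<dots> \<le> real (card (planes_of S) * (36 * x ^ 2)) * y"
    using y by (intro mult_right_mono of_nat_mono le) simp
  finally have "real (card S) * real x ^ 2 \<le> (36 * y * real (card (planes_of S))) * real x ^ 2"
    by (simp add: mult_ac)
  then have "real (card S) \<le> 36 * y * real (card (planes_of S))" using x0 by simp
  with SP S closed show ?thesis by (intro exI[of _ S] conjI ballI)
qed

text \<open>A closed subset and its complement share no plane, so joints and planes both add up. The
  value \<open>y\<close> stays tied to the whole of \<open>P\<close>; the parameter \<open>J\<close>
  of \<open>closed_subset\<close> provides the same \<open>y\<close> for every subset.\<close>

lemma card_le_planes:
  assumes t3: "CARD('t) = 3" and l6: "CARD('l) = 6" and y: "y > 0" "y ^ 3 = 4 * real (card P)"
    and "Q \<subseteq> P"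
  shows "real (card Q) \<le> 36 * y * real (card (planes_of Q))"
proof -
  have "finite Q" using \<open>Q \<subseteq> P\<close> finite_P by (rule finite_subset)
  then show ?thesis using \<open>Q \<subseteq> P\<close>
  proof (induction Q rule: finite_psubset_induct)
    case (psubset Q)
    show ?case
    proof (cases "Q = {}")
      case False
      interpret Q: joint_config e Q pt pl og dir crd
        by (rule joint_config_subset[OF joint_config_axioms psubset.prems])
      have "card Q \<le> card P" using psubset.prems finite_P by (rule card_mono[rotated])
      then obtain S where S: "S \<subseteq> Q" "S \<noteq> {}" "\<And>p q. p \<in> S \<Longrightarrow> q \<in> Q - S \<Longrightarrow> range (pl p) \<inter> range (pl q) = {}"
        and cS: "real (card S) \<le> 36 * y * real (card (planes_of S))"
        using Q.closed_subset[OF t3 l6 False _ y] by metis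
      have fin: "finite S" "finite (Q - S)" using S(1) psubset.hyps finite_subset by auto
      have "Q - S \<subset> Q" using S by blast
      then have cQ: "real (card (Q - S)) \<le> 36 * y * real (card (planes_of (Q - S)))"
        using psubset.IH[of "Q - S"] psubset.prems by blast
      have "planes_of S \<inter> planes_of (Q - S) = {}" using S(3) unfolding planes_of_def by blast
      then have "card (planes_of S \<union> planes_of (Q - S)) = card (planes_of S) + card (planes_of (Q - S))"
        by (intro card_Un_disjoint finite_planes_of fin)
      moreover have "planes_of S \<union> planes_of (Q - S) = planes_of Q" using S(1) unfolding planes_of_def by blast
      moreover have "card Q = card S + card (Q - S)"
        using card_Un_disjoint[OF fin] S(1) by (simp add: Un_absorb1)
      ultimately show ?thesis using cS cQ by (simp add: distrib_left)
    qed (use y in simp)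
  qed
qed

text \<open>Cubing the linear estimate and inserting \<open>y ^ 3 = 4 * card P\<close> cancels one
  factor \<open>card P\<close>; the constant is \<open>4 * 36 ^ 3\<close>.\<close>

theorem joints_squared_le:
  assumes t3: "CARD('t) = 3" and l6: "CARD('l) = 6"
  shows "real (card P) ^ 2 \<le> 186624 * real (card (planes_of P)) ^ 3"
proof (cases "P = {}")
  case False
  then have P0: "real (card P) > 0" using finite_P by (simp add: card_gt_0_iff)
  define y where "y = root 3 (4 * real (card P))"
  have y: "y > 0" "y ^ 3 = 4 * real (card P)" using P0 by (simp_all add: y_def)
  have "real (card P) \<le> 36 * y * real (card (planes_of P))"
    by (rule card_le_planes[OF t3 l6 y]) simp
  then have "real (card P) ^ 3 \<le> (36 * y * real (card (planes_of P))) ^ 3"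
    by (rule power_mono) simp
  also have "\<dots> = (186624 * real (card (planes_of P)) ^ 3) * real (card P)"
    by (simp add: power_mult_distrib y(2))
  finally have "real (card P) ^ 2 * real (card P) \<le> (186624 * real (card (planes_of P)) ^ 3) * real (card P)"
    by (simp add: eval_nat_numeral mult_ac)
  then show ?thesis using P0 by simp
qed simp

end

section \<open>Flats over a field given by a carrier set\<close>

context idem_field
begin

text \<open>Row \<open>k0\<close> is a combination of the other rows. Dropping it leaves fewer
  equations than unknowns, and a solution of these kills row \<open>k0\<close> as well.\<close>

lemma singular_functional:
  assumes K: "finite K" "card K = n" and c: "\<And>k. e * c k = c k" "k0 \<in> K" "c k0 \<noteq> 0"
    and dep: "\<And>l. l < n \<Longrightarrow> (\<Sum>k\<in>K. c k * V k l) = 0"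
    and V: "\<And>k l. e * V k l = V k l"
  shows "\<exists>f. (\<forall>l. e * f l = f l) \<and> (\<exists>l<n. f l \<noteq> 0) \<and> (\<forall>k\<in>K. (\<Sum>l<n. V k l * f l) = 0)"
proof -
  have "card (K - {k0}) < card {..<n}" using K c(2) by (metis card_Diff1_less card_lessThan)
  then obtain f where f: "\<forall>l. e * f l = f l" "\<exists>l\<in>{..<n}. f l \<noteq> 0" "\<forall>k\<in>K - {k0}. (\<Sum>l<n. V k l * f l) = 0"
    using homogeneous_solution[of "K - {k0}" "{..<n}" V] K(1) by auto
  have "(\<Sum>k\<in>K. c k * (\<Sum>l<n. V k l * f l)) = (\<Sum>l<n. (\<Sum>k\<in>K. c k * V k l) * f l)"
    unfolding sum_distrib_left sum_distrib_right by (subst sum.swap) (simp add: mult.assoc)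
  also have "\<dots> = 0" by (simp add: dep)
  also have "(\<Sum>k\<in>K. c k * (\<Sum>l<n. V k l * f l)) = c k0 * (\<Sum>l<n. V k0 l * f l)"
    using f(3) K c(2) by (subst sum.remove[of K k0]) auto
  finally have "c k0 * (\<Sum>l<n. V k0 l * f l) = 0" .
  moreover have "e * (\<Sum>l<n. V k0 l * f l) = (\<Sum>l<n. V k0 l * f l)"
    by (intro scalar_sum scalar_mult) (use f(1) in blast)
  ultimately have "(\<Sum>l<n. V k0 l * f l) = 0" using scalar_mult_nonzero[OF c(1)] c(3) by blast
  then have "(\<Sum>l<n. V k l * f l) = 0" if "k \<in> K" for k using f(3) that by (cases "k = k0") auto
  then show ?thesis using f(1,2) by blast
qed

text \<open>With the right-hand side as a further column, indexed by \<open>None\<close>, there are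
  more unknowns than equations. Independence makes the coefficient of the new column non-zero, and
  dividing by it solves the system.\<close>

lemma spanning_of_independent:
  assumes K: "finite K" "finite L" "card K = card L"
    and indep: "\<And>c. (\<And>k. e * c k = c k) \<Longrightarrow> (\<And>l. l \<in> L \<Longrightarrow> (\<Sum>k\<in>K. V k l * c k) = 0) \<Longrightarrow> \<forall>k\<in>K. c k = 0"
  shows "\<exists>a. \<forall>l\<in>L. (\<Sum>k\<in>K. V k l * a k) = (if l = l' then e else 0)"
proof -
  define V' where "V' l k = (case k of None \<Rightarrow> if l = l' then e else 0 | Some k \<Rightarrow> V k l)" for l k
  let ?K = "insert None (Some ` K)"
  have "card L < card ?K" using K by (subst card_insert_disjoint) (auto simp: card_image)
  then obtain c where c: "\<forall>k. e * c k = c k" "\<exists>k\<in>?K. c k \<noteq> 0" "\<forall>l\<in>L. (\<Sum>k\<in>?K. V' l k * c k) = 0"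
    using homogeneous_solution[of L ?K V'] K by auto
  have eq: "(if l = l' then e else 0) * c None + (\<Sum>k\<in>K. V k l * c (Some k)) = 0" if "l \<in> L" for l
  proof -
    have "(\<Sum>k\<in>?K. V' l k * c k) = V' l None * c None + (\<Sum>k\<in>Some ` K. V' l k * c k)"
      using K by (subst sum.insert) auto
    then show ?thesis using c(3) that by (simp add: V'_def sum.reindex)
  qed
  have "c None \<noteq> 0"
  proof
    assume 0: "c None = 0"
    have "\<forall>k\<in>K. c (Some k) = 0" by (rule indep) (use c(1) eq 0 in auto)
    then show False using c(2) 0 by auto
  qed
  then obtain y where y: "c None * y = e" using inverse_exists c(1) by blast
  show ?thesis
  proof (intro exI[of _ "\<lambda>k. - (c (Some k) * y)"] ballI)
    fix l assume "l \<in> L"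
    have "(\<Sum>k\<in>K. V k l * - (c (Some k) * y)) = - ((\<Sum>k\<in>K. V k l * c (Some k)) * y)"
      by (simp add: sum_distrib_right sum_negf mult.assoc)
    also have "(\<Sum>k\<in>K. V k l * c (Some k)) = - ((if l = l' then e else 0) * c None)"
      using eq[OF \<open>l \<in> L\<close>] by (simp add: add_eq_0_iff2)
    also have "- (- ((if l = l' then e else 0) * c None) * y) = (if l = l' then e else 0) * (c None * y)"
      by (simp add: mult.assoc)
    also have "\<dots> = (if l = l' then e else 0)" by (simp add: y idem)
    finally show "(\<Sum>k\<in>K. V k l * - (c (Some k) * y)) = (if l = l' then e else 0)" .
  qed
qed

end

section \<open>Independence and flats in an embedded field\<close>

definition indep_family :: "('a, 'm) ring_scheme \<Rightarrow> nat \<Rightarrow> 'j set \<Rightarrow> ('j \<Rightarrow> nat \<Rightarrow> 'a) \<Rightarrow> bool" where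
  "indep_family F d I v \<longleftrightarrow>
     (\<forall>c \<in> I \<rightarrow> carrier F.
        (\<forall>i<d. (\<Oplus>\<^bsub>F\<^esub>j\<in>I. c j \<otimes>\<^bsub>F\<^esub> v j i) = \<zero>\<^bsub>F\<^esub>) \<longrightarrow> (\<forall>j\<in>I. c j = \<zero>\<^bsub>F\<^esub>))"

lemma lin_indep_eq: "lin_indep F d k v \<longleftrightarrow> indep_family F d {..<k} v"
  unfolding lin_indep_def indep_family_def Ball_def lessThan_iff ..

text \<open>The unit of the field goes to an idempotent \<open>e\<close>, not necessarily to 1, so
  that the field may be one factor of a product. The range condition identifies its image with the
  scalars of \<open>e\<close>.\<close>

locale embedded_field = field F for F (structure) +
  fixes \<iota> :: "'a \<Rightarrow> 'r::comm_ring_1" and e :: 'r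
  assumes \<iota>_add: "a \<in> carrier F \<Longrightarrow> b \<in> carrier F \<Longrightarrow> \<iota> (a \<oplus> b) = \<iota> a + \<iota> b"
    and \<iota>_mult: "a \<in> carrier F \<Longrightarrow> b \<in> carrier F \<Longrightarrow> \<iota> (a \<otimes> b) = \<iota> a * \<iota> b"
    and \<iota>_one: "\<iota> \<one> = e"
    and \<iota>_inj: "inj_on \<iota> (carrier F)"
    and \<iota>_range: "e * x = x \<longleftrightarrow> x \<in> \<iota> ` carrier F"
begin

lemma \<iota>_zero: "\<iota> \<zero> = 0"
  using \<iota>_add[of \<zero> \<zero>] by simp

lemma e_\<iota>: "a \<in> carrier F \<Longrightarrow> e * \<iota> a = \<iota> a"
  using \<iota>_range by blast

lemma \<iota>_eq_0_iff: "a \<in> carrier F \<Longrightarrow> \<iota> a = 0 \<longleftrightarrow> a = \<zero>"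
  using \<iota>_inj \<iota>_zero by (metis inj_onD zero_closed)

sublocale idem_field e
proof
  show "e * e = e" using e_\<iota>[OF one_closed] by (simp add: \<iota>_one)
  show "e \<noteq> 0" using \<iota>_eq_0_iff[OF one_closed] by (simp add: \<iota>_one)
  fix x assume "e * x = x" "x \<noteq> 0"
  then obtain a where a: "a \<in> carrier F" "x = \<iota> a" "a \<noteq> \<zero>" using \<iota>_range \<iota>_zero by blast
  then have u: "a \<in> Units F" by (simp add: field_Units)
  have "inv a \<in> carrier F" using u by simp
  moreover have "x * \<iota> (inv a) = e" using u a by (simp add: \<iota>_mult[symmetric] \<iota>_one)
  ultimately show "\<exists>y. e * y = y \<and> x * y = e" using e_\<iota> by blast
qed

definition \<kappa> :: "'r \<Rightarrow> 'a" where "\<kappa> = inv_into (carrier F) \<iota>"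

lemma \<kappa>: "e * x = x \<Longrightarrow> \<kappa> x \<in> carrier F \<and> \<iota> (\<kappa> x) = x"
  unfolding \<kappa>_def \<iota>_range by (simp add: inv_into_into f_inv_into_f)

lemma \<iota>_finsum: "f \<in> A \<rightarrow> carrier F \<Longrightarrow> \<iota> (\<Oplus>j\<in>A. f j) = (\<Sum>j\<in>A. \<iota> (f j))"
  by (induction A rule: infinite_finite_induct) (auto simp: \<iota>_zero \<iota>_add Pi_def)

lemma \<iota>_linear_combination:
  assumes "c \<in> A \<rightarrow> carrier F" "\<And>j. j \<in> A \<Longrightarrow> v j \<in> carrier F"
  shows "\<iota> (\<Oplus>j\<in>A. c j \<otimes> v j) = (\<Sum>j\<in>A. \<iota> (c j) * \<iota> (v j))"
proof -
  have "\<iota> (\<Oplus>j\<in>A. c j \<otimes> v j) = (\<Sum>j\<in>A. \<iota> (c j \<otimes> v j))" by (rule \<iota>_finsum) (use assms in auto)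
  then show ?thesis using assms by (simp add: Pi_iff \<iota>_mult)
qed

lemma affine_space_carrier: "x \<in> affine_space F d \<Longrightarrow> i < d \<Longrightarrow> x i \<in> carrier F"
  by (auto simp: affine_space_def)

lemma affine_space_eqI:
  "x \<in> affine_space F d \<Longrightarrow> y \<in> affine_space F d \<Longrightarrow> (\<And>i. i < d \<Longrightarrow> \<iota> (x i) = \<iota> (y i)) \<Longrightarrow> x = y"
  unfolding affine_space_def by (rule PiE_ext) (use \<iota>_inj in \<open>auto dest: inj_onD\<close>)

lemma indep_family_iff:
  assumes v: "v \<in> I \<rightarrow> affine_space F d"
  shows "indep_family F d I v \<longleftrightarrow> (\<forall>c. (\<forall>j. e * c j = c j) \<longrightarrow>
    (\<forall>i<d. (\<Sum>j\<in>I. c j * \<iota> (v j i)) = 0) \<longrightarrow> (\<forall>j\<in>I. c j = 0))"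
proof -
  have vc: "v j i \<in> carrier F" if "j \<in> I" "i < d" for i j
    using v that affine_space_carrier by blast
  have lc: "\<iota> (\<Oplus>j\<in>I. c j \<otimes> v j i) = (\<Sum>j\<in>I. \<iota> (c j) * \<iota> (v j i))" if "c \<in> I \<rightarrow> carrier F" "i < d" for c i
    by (rule \<iota>_linear_combination) (use vc that in auto)
  have cl: "(\<Oplus>j\<in>I. c j \<otimes> v j i) \<in> carrier F" if "c \<in> I \<rightarrow> carrier F" "i < d" for c i
    by (rule finsum_closed) (use vc that in auto)
  show ?thesis
  proof (intro iffI allI impI ballI)
    fix c j assume li: "indep_family F d I v" and c: "\<forall>j. e * c j = c j"
      and 0: "\<forall>i<d. (\<Sum>j\<in>I. c j * \<iota> (v j i)) = 0" and j: "j \<in> I"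
    have \<kappa>c: "\<kappa> \<circ> c \<in> I \<rightarrow> carrier F" "\<And>j. \<iota> ((\<kappa> \<circ> c) j) = c j" using c \<kappa> by auto
    have "\<forall>i<d. (\<Oplus>j\<in>I. (\<kappa> \<circ> c) j \<otimes> v j i) = \<zero>"
      using lc[OF \<kappa>c(1)] cl[OF \<kappa>c(1)] \<iota>_eq_0_iff 0 unfolding \<kappa>c(2) by metis
    then have "(\<kappa> \<circ> c) j = \<zero>" using li \<kappa>c(1) j unfolding indep_family_def by blast
    then show "c j = 0" using \<kappa>c(2) \<iota>_zero by metis
  next
    assume R: "\<forall>c. (\<forall>j. e * c j = c j) \<longrightarrow> (\<forall>i<d. (\<Sum>j\<in>I. c j * \<iota> (v j i)) = 0) \<longrightarrow> (\<forall>j\<in>I. c j = 0)"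
    show "indep_family F d I v"
      unfolding indep_family_def
    proof (intro ballI impI allI)
      fix c j assume c: "c \<in> I \<rightarrow> carrier F" and 0: "\<forall>i<d. (\<Oplus>j\<in>I. c j \<otimes> v j i) = \<zero>" and j: "j \<in> I"
      define c' where "c' j = (if j \<in> I then \<iota> (c j) else 0)" for j
      have "\<forall>j. e * c' j = c' j" using c e_\<iota> by (auto simp: c'_def)
      moreover have "(\<Sum>j\<in>I. c' j * \<iota> (v j i)) = 0" if "i < d" for i
        using lc[OF c that] 0 that by (simp add: c'_def \<iota>_zero)
      ultimately have "\<forall>j\<in>I. c' j = 0" using R by blast
      then have "c' j = 0" using j by blast
      then show "c j = \<zero>" using j c \<iota>_eq_0_iff[of "c j"] by (auto simp: c'_def)
    qed
  qed
qed

definition flat_set :: "nat \<Rightarrow> nat \<Rightarrow> (nat \<Rightarrow> 'a) \<Rightarrow> (nat \<Rightarrow> nat \<Rightarrow> 'a) \<Rightarrow> (nat \<Rightarrow> 'a) set" where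
  "flat_set d k p v = (\<lambda>c. \<lambda>i\<in>{..<d}. p i \<oplus> (\<Oplus>j\<in>{..<k}. c j \<otimes> v j i)) ` ({..<k} \<rightarrow> carrier F)"

lemma flat_iff: "flat F d k A \<longleftrightarrow>
    (\<exists>p\<in>affine_space F d. \<exists>v\<in>{..<k} \<rightarrow> affine_space F d. lin_indep F d k v \<and> A = flat_set d k p v)"
  unfolding flat_def flat_set_def ..

lemma flat_set_iff:
  assumes p: "p \<in> affine_space F d" and v: "v \<in> {..<k} \<rightarrow> affine_space F d"
  shows "x \<in> flat_set d k p v \<longleftrightarrow> x \<in> affine_space F d \<and>
    (\<exists>c. (\<forall>j. e * c j = c j) \<and> (\<forall>i<d. \<iota> (x i) = \<iota> (p i) + (\<Sum>j<k. c j * \<iota> (v j i))))"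
proof -
  have vc: "v j i \<in> carrier F" if "j < k" "i < d" for i j
    using v that affine_space_carrier by blast
  have pc: "p i \<in> carrier F" if "i < d" for i using p that affine_space_carrier by blast
  have cl: "(\<Oplus>j\<in>{..<k}. c j \<otimes> v j i) \<in> carrier F" if "c \<in> {..<k} \<rightarrow> carrier F" "i < d" for c i
    by (rule finsum_closed) (use vc that in auto)
  have lc: "\<iota> (p i \<oplus> (\<Oplus>j\<in>{..<k}. c j \<otimes> v j i)) = \<iota> (p i) + (\<Sum>j<k. \<iota> (c j) * \<iota> (v j i))"
    if "c \<in> {..<k} \<rightarrow> carrier F" "i < d" for c i
    using \<iota>_linear_combination[of c "{..<k}" "\<lambda>j. v j i"] vc pc cl that by (simp add: \<iota>_add)
  have aff: "(\<lambda>i\<in>{..<d}. p i \<oplus> (\<Oplus>j\<in>{..<k}. c j \<otimes> v j i)) \<in> affine_space F d"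
    if "c \<in> {..<k} \<rightarrow> carrier F" for c
    unfolding affine_space_def using pc cl[OF that] by auto
  show ?thesis
  proof
    assume "x \<in> flat_set d k p v"
    then obtain c where c: "c \<in> {..<k} \<rightarrow> carrier F" and x: "x = (\<lambda>i\<in>{..<d}. p i \<oplus> (\<Oplus>j\<in>{..<k}. c j \<otimes> v j i))"
      unfolding flat_set_def by blast
    define c' where "c' j = (if j < k then \<iota> (c j) else 0)" for j
    have "\<forall>j. e * c' j = c' j" using c e_\<iota> by (auto simp: c'_def)
    moreover have "\<forall>i<d. \<iota> (x i) = \<iota> (p i) + (\<Sum>j<k. c' j * \<iota> (v j i))"
      using lc[OF c] by (simp add: x c'_def)
    moreover have "x \<in> affine_space F d" unfolding x by (rule aff[OF c])
    ultimately show "x \<in> affine_space F d \<and>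
      (\<exists>c. (\<forall>j. e * c j = c j) \<and> (\<forall>i<d. \<iota> (x i) = \<iota> (p i) + (\<Sum>j<k. c j * \<iota> (v j i))))" by blast
  next
    assume "x \<in> affine_space F d \<and>
      (\<exists>c. (\<forall>j. e * c j = c j) \<and> (\<forall>i<d. \<iota> (x i) = \<iota> (p i) + (\<Sum>j<k. c j * \<iota> (v j i))))"
    then obtain c where x: "x \<in> affine_space F d" and c: "\<forall>j. e * c j = c j"
      "\<forall>i<d. \<iota> (x i) = \<iota> (p i) + (\<Sum>j<k. c j * \<iota> (v j i))" by blast
    have \<kappa>c: "\<kappa> \<circ> c \<in> {..<k} \<rightarrow> carrier F" "\<And>j. \<iota> ((\<kappa> \<circ> c) j) = c j" using c \<kappa> by auto
    have "x = (\<lambda>i\<in>{..<d}. p i \<oplus> (\<Oplus>j\<in>{..<k}. (\<kappa> \<circ> c) j \<otimes> v j i))"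
    proof (rule affine_space_eqI[OF x aff[OF \<kappa>c(1)]])
      fix i assume i: "i < d"
      then have "\<iota> ((\<lambda>i\<in>{..<d}. p i \<oplus> (\<Oplus>j\<in>{..<k}. (\<kappa> \<circ> c) j \<otimes> v j i)) i) =
          \<iota> (p i \<oplus> (\<Oplus>j\<in>{..<k}. (\<kappa> \<circ> c) j \<otimes> v j i))" by simp
      also have "\<dots> = \<iota> (x i)" unfolding lc[OF \<kappa>c(1) i] \<kappa>c(2) using c(2) i by simp
      finally show "\<iota> (x i) = \<iota> ((\<lambda>i\<in>{..<d}. p i \<oplus> (\<Oplus>j\<in>{..<k}. (\<kappa> \<circ> c) j \<otimes> v j i)) i)" by simp
    qed
    then show "x \<in> flat_set d k p v" unfolding flat_set_def using \<kappa>c(1) by blast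
  qed
qed

text \<open>The kernel of \<open>f\<close> is parametrised by solving for the coordinate
  \<open>j0\<close>: the direction \<open>w j\<close> is a unit vector at an index other than
  \<open>j0\<close>, enumerated by \<open>s\<close>, with the entry at \<open>j0\<close> chosen to
  make \<open>f\<close> vanish.\<close>

lemma hyperplane_of_functional:
  assumes f: "\<And>l. e * f l = f l" and j0: "j0 < Suc n" "f j0 \<noteq> 0" and x: "x \<in> affine_space F (Suc n)"
  shows "\<exists>H. flat F (Suc n) n H \<and> (\<forall>z\<in>affine_space F (Suc n).
    (\<Sum>i<Suc n. f i * (\<iota> (z i) - \<iota> (x i))) = 0 \<longrightarrow> z \<in> H)"
proof -
  obtain y where y: "e * y = y" "f j0 * y = e" using inverse_exists[OF f j0(2)] by blast
  define s where "s j = (if j < j0 then j else Suc j)" for j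
  have s_ne: "s j \<noteq> j0" for j by (simp add: s_def)
  have s_inj: "s j = s j' \<longleftrightarrow> j = j'" for j j' by (auto simp: s_def)
  have s_img: "s ` {..<n} = {..<Suc n} - {j0}"
  proof
    show "s ` {..<n} \<subseteq> {..<Suc n} - {j0}" using s_ne by (auto simp: s_def)
    show "{..<Suc n} - {j0} \<subseteq> s ` {..<n}"
    proof
      fix i assume i: "i \<in> {..<Suc n} - {j0}"
      show "i \<in> s ` {..<n}"
      proof (cases "i < j0")
        case True
        then show ?thesis using j0(1) by (intro image_eqI[of _ _ i]) (auto simp: s_def)
      next
        case False
        then show ?thesis using i by (intro image_eqI[of _ _ "i - 1"]) (auto simp: s_def)
      qed
    qed
  qed
  define w where "w j = (\<lambda>l\<in>{..<Suc n}. if l = s j then \<one> else if l = j0 then \<kappa> (- (f (s j) * y)) else \<zero>)" for j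
  have fy: "e * - (f (s j) * y) = - (f (s j) * y)" for j
    using scalar_mult[OF y(1)] by simp
  have w: "w \<in> {..<n} \<rightarrow> affine_space F (Suc n)"
    unfolding affine_space_def w_def using \<kappa>[OF fy] by auto
  have \<iota>w: "\<iota> (w j l) = (if l = s j then e else if l = j0 then - (f (s j) * y) else 0)" if "l < Suc n" for j l
    using \<kappa>[OF fy, of j] that by (simp add: w_def \<iota>_one \<iota>_zero)
  have comb_s: "(\<Sum>j<n. c j * \<iota> (w j (s j'))) = c j' * e" if "j' < n" for c j'
  proof -
    have "s j' < Suc n" using s_img that by blast
    then have "(\<Sum>j<n. c j * \<iota> (w j (s j'))) = (\<Sum>j<n. if j = j' then c j' * e else 0)"
      by (intro sum.cong) (auto simp: \<iota>w s_inj s_ne)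
    then show ?thesis using that by simp
  qed
  have "lin_indep F (Suc n) n w"
    unfolding lin_indep_eq indep_family_iff[OF w]
  proof (intro allI impI ballI)
    fix c j assume c: "\<forall>j. e * c j = c j" "\<forall>i<Suc n. (\<Sum>j<n. c j * \<iota> (w j i)) = 0" and "j \<in> {..<n}"
    then have j: "j < n" by simp
    have "s j < Suc n" using s_img j by blast
    then have "c j * e = 0" using c(2) comb_s[OF j, of c] by simp
    then show "c j = 0" using c(1) by (metis mult.commute)
  qed
  then have "flat F (Suc n) n (flat_set (Suc n) n x w)" unfolding flat_iff using x w by blast
  moreover have "z \<in> flat_set (Suc n) n x w"
    if z: "z \<in> affine_space F (Suc n)" and fz: "(\<Sum>i<Suc n. f i * (\<iota> (z i) - \<iota> (x i))) = 0" for z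
  proof -
    define d where "d i = (if i < Suc n then \<iota> (z i) - \<iota> (x i) else 0)" for i
    have d: "e * d i = d i" for i
      using affine_space_carrier[OF z, of i] affine_space_carrier[OF x, of i]
      by (simp add: d_def right_diff_distrib e_\<iota>)
    have fd: "f j0 * d j0 + (\<Sum>j<n. f (s j) * d (s j)) = 0"
    proof -
      have "(\<Sum>i<Suc n. f i * (\<iota> (z i) - \<iota> (x i))) = (\<Sum>i<Suc n. f i * d i)"
        by (intro sum.cong) (auto simp: d_def)
      also have "\<dots> = f j0 * d j0 + (\<Sum>i\<in>{..<Suc n} - {j0}. f i * d i)"
        using j0(1) by (intro sum.remove) auto
      also have "(\<Sum>i\<in>{..<Suc n} - {j0}. f i * d i) = (\<Sum>j<n. f (s j) * d (s j))"
        unfolding s_img[symmetric] by (subst sum.reindex) (auto simp: inj_on_def s_inj)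
      finally show ?thesis using fz by simp
    qed
    have "\<iota> (z i) = \<iota> (x i) + (\<Sum>j<n. d (s j) * \<iota> (w j i))" if i: "i < Suc n" for i
    proof (cases "i = j0")
      case True
      have "(\<Sum>j<n. d (s j) * \<iota> (w j i)) = (\<Sum>j<n. - (y * (f (s j) * d (s j))))"
        using i True by (intro sum.cong) (auto simp: \<iota>w s_ne[symmetric] mult_ac)
      also have "\<dots> = - (y * (\<Sum>j<n. f (s j) * d (s j)))" by (simp add: sum_negf sum_distrib_left)
      also have "(\<Sum>j<n. f (s j) * d (s j)) = - (f j0 * d j0)" using fd by (simp add: add_eq_0_iff)
      also have "- (y * - (f j0 * d j0)) = (f j0 * y) * d j0" by (simp add: mult_ac)
      also have "\<dots> = d j0" using y(2) d by simp
      finally show ?thesis using True i by (simp add: d_def)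
    next
      case False
      then have "i \<in> s ` {..<n}" using i unfolding s_img by simp
      then obtain j where j: "j < n" "i = s j" by blast
      have "d (s j) * e = d (s j)" using d[of "s j"] by (simp add: mult.commute)
      then show ?thesis unfolding j(2) comb_s[OF j(1)] using i j(2) by (simp add: d_def)
    qed
    then show ?thesis unfolding flat_set_iff[OF x w] using z d by (intro conjI exI[of _ "\<lambda>j. d (s j)"]) auto
  qed
  ultimately show ?thesis by blast
qed

definition indep_directions :: "nat \<Rightarrow> nat \<Rightarrow> (nat \<Rightarrow> nat \<Rightarrow> nat \<Rightarrow> 'a) \<Rightarrow> bool" where
  "indep_directions d m v \<longleftrightarrow> indep_family F d ({..<m} \<times> {..<2}) (\<lambda>k. v (fst k) (snd k))"

lemma indep_directions_iff:
  assumes "\<forall>t<m. v t \<in> {..<2} \<rightarrow> affine_space F d"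
  shows "indep_directions d m v \<longleftrightarrow> (\<forall>c. (\<forall>k. e * c k = c k) \<longrightarrow>
     (\<forall>l<d. (\<Sum>k\<in>{..<m} \<times> {..<2}. c k * \<iota> (v (fst k) (snd k) l)) = 0) \<longrightarrow>
     (\<forall>k\<in>{..<m} \<times> {..<2}. c k = 0))"
  unfolding indep_directions_def by (rule indep_family_iff) (auto intro!: funcset_mem[OF assms[rule_format]])

text \<open>If the directions were dependent, a non-zero functional would vanish on all of them. Its
  level set through the common point \<open>x\<close> lies in a hyperplane, which would then contain
  every plane.\<close>

lemma indep_directionsI:
  assumes p: "\<And>t. t < m \<Longrightarrow> p t \<in> affine_space F (2 * m)"
    and v: "\<And>t. t < m \<Longrightarrow> v t \<in> {..<2} \<rightarrow> affine_space F (2 * m)"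
    and x: "\<And>t. t < m \<Longrightarrow> x \<in> flat_set (2 * m) 2 (p t) (v t)" and m: "m > 0"
    and not: "\<not> (\<exists>H. hyperplane F (2 * m) H \<and> (\<forall>t<m. flat_set (2 * m) 2 (p t) (v t) \<subseteq> H))"
  shows "indep_directions (2 * m) m v"
proof (rule ccontr)
  let ?K = "{..<m} \<times> {..<2::nat}"
  have vm: "\<forall>t<m. v t \<in> {..<2} \<rightarrow> affine_space F (2 * m)" using v by blast
  assume "\<not> ?thesis"
  then obtain c k0 where c: "\<forall>k. e * c k = c k" "k0 \<in> ?K" "c k0 \<noteq> 0"
    and dep: "\<forall>l<2 * m. (\<Sum>k\<in>?K. c k * \<iota> (v (fst k) (snd k) l)) = 0"
    unfolding indep_directions_iff[OF vm] by blast
  define V where "V k l = (if k \<in> ?K \<and> l < 2 * m then \<iota> (v (fst k) (snd k) l) else 0)" for k l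
  have V: "e * V k l = V k l" for k l
  proof (cases "k \<in> ?K \<and> l < 2 * m")
    case True
    then have "v (fst k) (snd k) \<in> affine_space F (2 * m)" using v[of "fst k"] by auto
    then have "v (fst k) (snd k) l \<in> carrier F" using True affine_space_carrier by blast
    then show ?thesis by (simp add: V_def e_\<iota>)
  qed (auto simp: V_def)
  have "card ?K = 2 * m" by simp
  moreover have "(\<Sum>k\<in>?K. c k * V k l) = 0" if "l < 2 * m" for l
    using dep that by (simp add: V_def cong: sum.cong)
  ultimately obtain f where f: "\<forall>l. e * f l = f l" "\<exists>l<2 * m. f l \<noteq> 0" "\<forall>k\<in>?K. (\<Sum>l<2 * m. V k l * f l) = 0"
    using singular_functional[of ?K "2 * m" c k0 V] c V by auto
  obtain n where n: "2 * m = Suc n" using m by (cases "2 * m") auto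
  obtain j0 where j0: "j0 < Suc n" "f j0 \<noteq> 0" using f(2) n by auto
  have xa: "x \<in> affine_space F (2 * m)" using x[OF m] flat_set_iff[OF p[OF m] v[OF m]] by blast
  obtain H where H: "flat F (Suc n) n H" "\<And>z. z \<in> affine_space F (Suc n) \<Longrightarrow>
      (\<Sum>i<Suc n. f i * (\<iota> (z i) - \<iota> (x i))) = 0 \<Longrightarrow> z \<in> H"
    using hyperplane_of_functional[of f j0 n x] f(1) j0 xa unfolding n by blast
  have "flat_set (2 * m) 2 (p t) (v t) \<subseteq> H" if t: "t < m" for t
  proof
    fix z assume z: "z \<in> flat_set (2 * m) 2 (p t) (v t)"
    then obtain a where a: "z \<in> affine_space F (2 * m)"
      "\<forall>i<2 * m. \<iota> (z i) = \<iota> (p t i) + (\<Sum>b<2. a b * \<iota> (v t b i))"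
      unfolding flat_set_iff[OF p[OF t] v[OF t]] by blast
    obtain a' where a': "\<forall>i<2 * m. \<iota> (x i) = \<iota> (p t i) + (\<Sum>b<2. a' b * \<iota> (v t b i))"
      using x[OF t] unfolding flat_set_iff[OF p[OF t] v[OF t]] by blast
    have "(\<Sum>i<2 * m. f i * (\<iota> (z i) - \<iota> (x i))) = (\<Sum>i<2 * m. \<Sum>b<2. (a b - a' b) * (V (t, b) i * f i))"
    proof (rule sum.cong)
      fix i assume "i \<in> {..<2 * m}"
      then have "\<iota> (z i) - \<iota> (x i) = (\<Sum>b<2. (a b - a' b) * V (t, b) i)"
        using a(2) a' t by (simp add: V_def left_diff_distrib sum_subtractf)
      then show "f i * (\<iota> (z i) - \<iota> (x i)) = (\<Sum>b<2. (a b - a' b) * (V (t, b) i * f i))"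
        by (simp add: sum_distrib_left mult_ac)
    qed simp
    also have "\<dots> = (\<Sum>b<2. (a b - a' b) * (\<Sum>i<2 * m. V (t, b) i * f i))"
      by (subst sum.swap) (simp only: sum_distrib_left)
    also have "\<dots> = 0" using f(3) t by simp
    finally show "z \<in> H" using H(2) a(1) unfolding n by blast
  qed
  moreover have "hyperplane F (2 * m) H" using H(1) n by simp
  ultimately show False using not by blast
qed

text \<open>A direction is the difference of two points of the smaller flat, \<open>p + v b\<close>
  and \<open>p\<close>.\<close>

lemma direction_in_span:
  assumes p: "p \<in> affine_space F d" and v: "v \<in> {..<k} \<rightarrow> affine_space F d"
    and q: "q \<in> affine_space F d" and w: "w \<in> {..<n} \<rightarrow> affine_space F d"
    and sub: "flat_set d k p v \<subseteq> flat_set d n q w" and b: "b < k"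
  shows "\<exists>g. (\<forall>j. e * g j = g j) \<and> (\<forall>l<d. \<iota> (v b l) = (\<Sum>j<n. g j * \<iota> (w j l)))"
proof -
  have vc: "v b l \<in> carrier F" "p l \<in> carrier F" if "l < d" for l
    using v p b that affine_space_carrier by blast+
  define r where "r = (\<lambda>l\<in>{..<d}. p l \<oplus> v b l)"
  have "r \<in> affine_space F d" using vc by (auto simp: r_def affine_space_def)
  then have "r \<in> flat_set d k p v"
    unfolding flat_set_iff[OF p v]
  proof (intro conjI exI[of _ "\<lambda>b'. if b' = b then e else 0"] allI impI)
    fix l assume l: "l < d"
    have "(\<Sum>b'<k. (if b' = b then e else 0) * \<iota> (v b' l)) = (\<Sum>b'<k. if b' = b then e * \<iota> (v b l) else 0)"
      by (intro sum.cong) auto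
    then show "\<iota> (r l) = \<iota> (p l) + (\<Sum>b'<k. (if b' = b then e else 0) * \<iota> (v b' l))"
      using b l vc[OF l] by (simp add: r_def \<iota>_add e_\<iota>)
  qed (auto simp: idem)
  then have "r \<in> flat_set d n q w" using sub by blast
  then obtain g where g: "\<forall>j. e * g j = g j" "\<forall>l<d. \<iota> (r l) = \<iota> (q l) + (\<Sum>j<n. g j * \<iota> (w j l))"
    unfolding flat_set_iff[OF q w] by blast
  have "p \<in> flat_set d k p v"
    unfolding flat_set_iff[OF p v] using p by (intro conjI exI[of _ "\<lambda>_. 0"]) auto
  then have "p \<in> flat_set d n q w" using sub by blast
  then obtain g' where g': "\<forall>j. e * g' j = g' j" "\<forall>l<d. \<iota> (p l) = \<iota> (q l) + (\<Sum>j<n. g' j * \<iota> (w j l))"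
    unfolding flat_set_iff[OF q w] by blast
  show ?thesis
  proof (intro exI[of _ "\<lambda>j. g j - g' j"] conjI allI impI)
    show "e * (g j - g' j) = g j - g' j" for j using g(1) g'(1) by (simp add: right_diff_distrib)
    fix l assume l: "l < d"
    have "\<iota> (v b l) = \<iota> (r l) - \<iota> (p l)" using vc[OF l] l by (simp add: r_def \<iota>_add)
    also have "\<dots> = (\<Sum>j<n. g j * \<iota> (w j l)) - (\<Sum>j<n. g' j * \<iota> (w j l))"
      using g(2) g'(2) l by simp
    finally show "\<iota> (v b l) = (\<Sum>j<n. (g j - g' j) * \<iota> (w j l))"
      by (simp add: left_diff_distrib sum_subtractf)
  qed
qed

text \<open>Equal flats would put a direction of one into the span of the directions of the
  other.\<close>

lemma flats_distinct:
  assumes p: "\<And>t. t < m \<Longrightarrow> p t \<in> affine_space F d"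
    and v: "\<And>t. t < m \<Longrightarrow> v t \<in> {..<2} \<rightarrow> affine_space F d"
    and indep: "indep_directions d m v" and t: "t < m" "t' < m" "t \<noteq> t'"
  shows "flat_set d 2 (p t) (v t) \<noteq> flat_set d 2 (p t') (v t')"
proof
  let ?K = "{..<m} \<times> {..<2::nat}"
  have vm: "\<forall>t<m. v t \<in> {..<2} \<rightarrow> affine_space F d" using v by blast
  assume "flat_set d 2 (p t) (v t) = flat_set d 2 (p t') (v t')"
  then obtain g where g: "\<forall>j. e * g j = g j" "\<forall>l<d. \<iota> (v t 0 l) = (\<Sum>j<2. g j * \<iota> (v t' j l))"
    using direction_in_span[OF p[OF t(1)] v[OF t(1)] p[OF t(2)] v[OF t(2)], of 0] by auto
  define c where "c k = (if k = (t, 0) then e else if fst k = t' then - g (snd k) else 0)" for k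
  have "\<forall>k. e * c k = c k" using g(1) by (auto simp: c_def idem)
  moreover have "(\<Sum>k\<in>?K. c k * \<iota> (v (fst k) (snd k) l)) = 0" if l: "l < d" for l
  proof -
    have "v t 0 l \<in> carrier F" by (rule affine_space_carrier[OF funcset_mem[OF v[OF t(1)]] l]) simp
    then have "e * \<iota> (v t 0 l) = \<iota> (v t 0 l)" by (rule e_\<iota>)
    have "(\<Sum>k\<in>?K. c k * \<iota> (v (fst k) (snd k) l)) =
        c (t, 0) * \<iota> (v t 0 l) + (\<Sum>k\<in>?K - {(t, 0)}. c k * \<iota> (v (fst k) (snd k) l))"
      using t by (subst sum.remove[of ?K "(t, 0)"]) auto
    also have "(\<Sum>k\<in>?K - {(t, 0)}. c k * \<iota> (v (fst k) (snd k) l)) =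
        (\<Sum>k\<in>{t'} \<times> {..<2}. c k * \<iota> (v (fst k) (snd k) l))"
      by (rule sum.mono_neutral_right) (use t in \<open>auto simp: c_def\<close>)
    also have "\<dots> = (\<Sum>j<2. - (g j * \<iota> (v t' j l)))"
    proof -
      have "(\<Sum>k\<in>{t'} \<times> {..<2}. c k * \<iota> (v (fst k) (snd k) l)) = (\<Sum>j<2. c (t', j) * \<iota> (v t' j l))"
        using sum.cartesian_product[of "\<lambda>i j. c (i, j) * \<iota> (v i j l)" "{..<2}" "{t'}"]
        by (simp add: case_prod_unfold)
      then show ?thesis using t(3) by (simp add: c_def)
    qed
    also have "\<dots> = - \<iota> (v t 0 l)" using g(2) l by (simp add: sum_negf)
    finally show ?thesis by (simp add: c_def \<open>e * \<iota> (v t 0 l) = \<iota> (v t 0 l)\<close>)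
  qed
  ultimately have "c (t, 0) = 0"
    using indep t(1) unfolding indep_directions_iff[OF vm] by fastforce
  then show False using e_nonzero by (simp add: c_def)
qed

text \<open>There are \<open>2 * m\<close> independent directions, and a hyperplane has only
  \<open>2 * m - 1\<close>. With \<open>indep_directionsI\<close> this replaces the hyperplane
  condition by independence, which passes to subfields.\<close>

lemma not_in_hyperplane:
  assumes p: "\<And>t. t < m \<Longrightarrow> p t \<in> affine_space F (2 * m)"
    and v: "\<And>t. t < m \<Longrightarrow> v t \<in> {..<2} \<rightarrow> affine_space F (2 * m)" and m: "m > 0"
    and indep: "indep_directions (2 * m) m v"
  shows "\<not> (\<exists>H. hyperplane F (2 * m) H \<and> (\<forall>t<m. flat_set (2 * m) 2 (p t) (v t) \<subseteq> H))"
proof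
  let ?K = "{..<m} \<times> {..<2::nat}"
  have vm: "\<forall>t<m. v t \<in> {..<2} \<rightarrow> affine_space F (2 * m)" using v by blast
  assume "\<exists>H. hyperplane F (2 * m) H \<and> (\<forall>t<m. flat_set (2 * m) 2 (p t) (v t) \<subseteq> H)"
  then obtain H where H: "hyperplane F (2 * m) H" "\<And>t. t < m \<Longrightarrow> flat_set (2 * m) 2 (p t) (v t) \<subseteq> H" by blast
  obtain n where n: "2 * m = Suc n" using m by (cases "2 * m") auto
  then obtain q w where q: "q \<in> affine_space F (2 * m)" and w: "w \<in> {..<n} \<rightarrow> affine_space F (2 * m)"
    and Hq: "H = flat_set (2 * m) n q w" using H(1) unfolding flat_iff by auto
  have "\<exists>g. \<forall>l<2 * m. \<iota> (v t b l) = (\<Sum>j<n. g j * \<iota> (w j l))" if "t < m" "b < 2" for t b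
    using direction_in_span[OF p[OF that(1)] v[OF that(1)] q w _ that(2)] H(2)[OF that(1)] Hq by blast
  then obtain g where g: "\<And>t b l. t < m \<Longrightarrow> b < 2 \<Longrightarrow> l < 2 * m \<Longrightarrow> \<iota> (v t b l) = (\<Sum>j<n. g t b j * \<iota> (w j l))"
    by metis
  have "card {..<n} < card ?K" using n by simp
  then obtain c where c: "\<forall>k. e * c k = c k" "\<exists>k\<in>?K. c k \<noteq> 0" "\<forall>j\<in>{..<n}. (\<Sum>k\<in>?K. g (fst k) (snd k) j * c k) = 0"
    using homogeneous_solution[of "{..<n}" ?K "\<lambda>j k. g (fst k) (snd k) j"] by blast
  have "(\<Sum>k\<in>?K. c k * \<iota> (v (fst k) (snd k) l)) = 0" if l: "l < 2 * m" for l
  proof -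
    have "(\<Sum>k\<in>?K. c k * \<iota> (v (fst k) (snd k) l)) = (\<Sum>k\<in>?K. \<Sum>j<n. g (fst k) (snd k) j * c k * \<iota> (w j l))"
      using l by (intro sum.cong) (auto simp: g sum_distrib_left mult_ac)
    also have "\<dots> = (\<Sum>j<n. (\<Sum>k\<in>?K. g (fst k) (snd k) j * c k) * \<iota> (w j l))"
      by (subst sum.swap) (simp only: sum_distrib_right)
    finally show ?thesis using c(3) by simp
  qed
  then show False using indep c(1,2) unfolding indep_directions_iff[OF vm] by blast
qed

end

section \<open>The bound over an arbitrary field\<close>

context embedded_field
begin

lemma joint_indep_directions:
  assumes og: "\<And>A. A \<in> Q \<Longrightarrow> og A \<in> affine_space F 6"
    and dir: "\<And>A. A \<in> Q \<Longrightarrow> dir A \<in> {..<2} \<rightarrow> affine_space F 6"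
    and A: "\<And>A. A \<in> Q \<Longrightarrow> A = flat_set 6 2 (og A) (dir A)" and x: "x \<in> joints F Q"
  shows "\<exists>T. (\<forall>i<3. T i \<in> Q \<and> x \<in> T i) \<and> indep_directions 6 3 (\<lambda>i. dir (T i))"
proof -
  from x obtain A B D where AQ: "A \<in> Q" "B \<in> Q" "D \<in> Q" and xA: "x \<in> A" "x \<in> B" "x \<in> D"
    and not: "\<not> (\<exists>H. hyperplane F 6 H \<and> A \<subseteq> H \<and> B \<subseteq> H \<and> D \<subseteq> H)"
    unfolding joints_def by blast
  define T where "T i = (if i = 0 then A else if i = 1 then B else D)" for i :: nat
  have T: "T i \<in> Q" "x \<in> T i" for i using AQ xA by (auto simp: T_def)
  have T3: "T 0 = A" "T 1 = B" "T 2 = D" by (auto simp: T_def)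
  have "indep_directions (2 * 3) 3 (\<lambda>i. dir (T i))"
  proof (rule indep_directionsI[where p = "\<lambda>i. og (T i)" and x = x])
    show "\<not> (\<exists>H. hyperplane F (2 * 3) H \<and> (\<forall>t<3. flat_set (2 * 3) 2 (og (T t)) (dir (T t)) \<subseteq> H))"
    proof
      assume "\<exists>H. hyperplane F (2 * 3) H \<and> (\<forall>t<3. flat_set (2 * 3) 2 (og (T t)) (dir (T t)) \<subseteq> H)"
      then obtain H where H: "hyperplane F 6 H" "\<And>t. t < 3 \<Longrightarrow> T t \<subseteq> H" using A T by auto
      have "A \<subseteq> H" "B \<subseteq> H" "D \<subseteq> H" using H(2)[of 0] H(2)[of 1] H(2)[of 2] T3 by auto
      then show False using H(1) not by blast
    qed
  qed (use og dir A T in auto)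
  then show ?thesis using T by auto
qed

text \<open>Stated for finite sets of joints, so that finiteness of the set of all joints can be
  deduced from it.\<close>

lemma card_joints_subset:
  assumes Q: "finite Q" "\<And>A. A \<in> Q \<Longrightarrow> plane F 6 A" and P: "finite P" "P \<subseteq> joints F Q"
  shows "real (card P) ^ 2 \<le> 186624 * real (card Q) ^ 3"
proof -
  have "\<forall>A\<in>Q. \<exists>p v. p \<in> affine_space F 6 \<and> v \<in> {..<2} \<rightarrow> affine_space F 6 \<and> A = flat_set 6 2 p v"
    using Q(2) unfolding flat_iff by blast
  then obtain og0 dir0 where og0: "\<And>A. A \<in> Q \<Longrightarrow> og0 A \<in> affine_space F 6"
    and dir0: "\<And>A. A \<in> Q \<Longrightarrow> dir0 A \<in> {..<2} \<rightarrow> affine_space F 6"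
    and A: "\<And>A. A \<in> Q \<Longrightarrow> A = flat_set 6 2 (og0 A) (dir0 A)"
    by metis
  have "\<forall>x\<in>P. \<exists>T. (\<forall>i<3. T i \<in> Q \<and> x \<in> T i) \<and> indep_directions 6 3 (\<lambda>i. dir0 (T i))"
    using joint_indep_directions[OF og0 dir0 A] P(2) by blast
  then obtain T where T: "\<And>x i. x \<in> P \<Longrightarrow> i < 3 \<Longrightarrow> T x i \<in> Q" "\<And>x i. x \<in> P \<Longrightarrow> i < 3 \<Longrightarrow> x \<in> T x i"
    and indep: "\<And>x. x \<in> P \<Longrightarrow> indep_directions 6 3 (\<lambda>i. dir0 (T x i))"
    by metis
  have "\<exists>c. (\<forall>j. e * c j = c j) \<and> (A \<in> Q \<longrightarrow> x \<in> A \<longrightarrow>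
      (\<forall>i<6. \<iota> (x i) = \<iota> (og0 A i) + (\<Sum>j<2. c j * \<iota> (dir0 A j i))))" for A x
  proof (cases "A \<in> Q \<and> x \<in> A")
    case True
    then have "x \<in> flat_set 6 2 (og0 A) (dir0 A)" using A by blast
    then show ?thesis using flat_set_iff[OF og0 dir0, of A A x] True by blast
  qed (auto intro: exI[of _ "\<lambda>_. 0"])
  then obtain c where c: "\<And>A x j. e * c A x j = c A x j"
    "\<And>A x i. A \<in> Q \<Longrightarrow> x \<in> A \<Longrightarrow> i < 6 \<Longrightarrow> \<iota> (x i) = \<iota> (og0 A i) + (\<Sum>j<2. c A x j * \<iota> (dir0 A j i))"
    by metis
  \<comment> \<open>The numeral types 3 and 6 serve as the finite index types of
    \<open>joint_config\<close>; \<theta>, \<eta> and \<psi> translate them to ranges of natural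
    numbers.\<close>
  obtain \<theta> :: "3 \<Rightarrow> nat" where \<theta>: "bij_betw \<theta> UNIV {..<3}"
    using ex_bij_betw_finite_nat[of "UNIV :: 3 set"] by (auto simp: atLeast0LessThan)
  obtain \<eta> :: "6 \<Rightarrow> nat" where \<eta>: "bij_betw \<eta> UNIV {..<6}"
    using ex_bij_betw_finite_nat[of "UNIV :: 6 set"] by (auto simp: atLeast0LessThan)
  have \<theta>3: "\<theta> t < 3" for t using \<theta> by (auto simp: bij_betw_def)
  have \<eta>6: "\<eta> l < 6" for l using \<eta> by (auto simp: bij_betw_def)
  have \<eta>_surj: "\<exists>l. i = \<eta> l" if "i < 6" for i using \<eta> that by (auto simp: bij_betw_def)
  have ob: "bij_betw (of_bool :: bool \<Rightarrow> nat) UNIV {..<2}"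
    by (auto simp: bij_betw_def inj_on_def UNIV_bool lessThan_Suc numeral_2_eq_2)
  define \<psi> :: "3 \<times> bool \<Rightarrow> nat \<times> nat" where "\<psi> = map_prod \<theta> of_bool"
  have \<psi>: "bij_betw \<psi> UNIV ({..<3} \<times> {..<2})"
    using bij_betw_map_prod[OF \<theta> ob] by (simp add: \<psi>_def)
  define og where "og A l = \<iota> (og0 A (\<eta> l))" for A l
  define dir where "dir A b l = \<iota> (dir0 A (of_bool b) (\<eta> l))" for A b l
  define crd where "crd A x b = c A x (of_bool b)" for A x and b :: bool
  define pl where "pl x t = T x (\<theta> t)" for x t
  define pt where "pt x l = \<iota> (x (\<eta> l))" for x :: "nat \<Rightarrow> 'a" and l
  have Paff: "P \<subseteq> affine_space F 6" using P(2) by (auto simp: joints_def)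
  interpret joint_config e P pt pl og dir crd
  proof unfold_locales
    show "finite P" by (rule P(1))
    show "inj_on pt P"
    proof (rule inj_onI)
      fix x y assume x: "x \<in> P" "y \<in> P" "pt x = pt y"
      show "x = y"
      proof (rule affine_space_eqI)
        fix i :: nat assume "i < 6"
        then obtain l where "i = \<eta> l" using \<eta>_surj by blast
        then show "\<iota> (x i) = \<iota> (y i)" using fun_cong[OF x(3), of l] by (simp add: pt_def)
      qed (use x Paff in auto)
    qed
    show "e * crd f q b = crd f q b" for f q b using c(1) by (simp add: crd_def)
    show "pt q l = og (pl q t) l + (\<Sum>b\<in>UNIV. dir (pl q t) b l * crd (pl q t) q b)"
      if q: "q \<in> P" for q t l
      using c(2)[OF T(1)[OF q \<theta>3] T(2)[OF q \<theta>3] \<eta>6]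
      by (simp add: pt_def og_def dir_def crd_def pl_def UNIV_bool numeral_2_eq_2 mult.commute add_ac)
    show "\<exists>A. \<forall>l l'. (\<Sum>k\<in>UNIV. dir (pl q (fst k)) (snd k) l * A k l') = (if l = l' then e else 0)"
      if q: "q \<in> P" for q
    proof -
      have "\<exists>a. \<forall>l\<in>UNIV. (\<Sum>k\<in>UNIV. dir (pl q (fst k)) (snd k) l * a k) = (if l = l' then e else 0)" for l' :: 6
      proof (rule spanning_of_independent)
        fix d :: "3 \<times> bool \<Rightarrow> 'r"
        assume d: "\<And>k. e * d k = d k" "\<And>l. l \<in> UNIV \<Longrightarrow> (\<Sum>k\<in>UNIV. dir (pl q (fst k)) (snd k) l * d k) = 0"
        define d' where "d' k = d (inv_into UNIV \<psi> k)" for k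
        have d': "d' (\<psi> k) = d k" for k
          using \<psi> by (simp add: d'_def bij_betw_def)
        have "(\<Sum>k\<in>{..<3} \<times> {..<2}. d' k * \<iota> (dir0 (T q (fst k)) (snd k) i)) = 0" if i: "i < 6" for i
        proof -
          obtain l where l: "i = \<eta> l" using \<eta>_surj[OF i] by blast
          have "(\<Sum>k\<in>{..<3} \<times> {..<2}. d' k * \<iota> (dir0 (T q (fst k)) (snd k) i)) =
              (\<Sum>k\<in>UNIV. d' (\<psi> k) * \<iota> (dir0 (T q (fst (\<psi> k))) (snd (\<psi> k)) i))"
            using sum.reindex_bij_betw[OF \<psi>, of "\<lambda>k. d' k * \<iota> (dir0 (T q (fst k)) (snd k) i)"] by simp
          also have "\<dots> = (\<Sum>k\<in>UNIV. dir (pl q (fst k)) (snd k) l * d k)"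
            unfolding d' by (intro sum.cong) (auto simp: dir_def pl_def l \<psi>_def mult.commute)
          finally show ?thesis using d(2) by simp
        qed
        moreover have "\<forall>k. e * d' k = d' k" using d(1) by (simp add: d'_def)
        ultimately have "\<forall>k\<in>{..<3} \<times> {..<2}. d' k = 0"
          using indep[OF q] indep_directions_iff[of 3 "\<lambda>i. dir0 (T q i)" 6] dir0 T(1)[OF q] by blast
        moreover have "\<psi> k \<in> {..<3} \<times> {..<2}" for k using \<psi> by (metis UNIV_I bij_betwE)
        ultimately show "\<forall>k\<in>UNIV. d k = 0" using d' by metis
      qed auto
      then have "\<forall>l'. \<exists>a. \<forall>l. (\<Sum>k\<in>UNIV. dir (pl q (fst k)) (snd k) l * a k) = (if l = l' then e else 0)"
        by blast
      then obtain a where "\<forall>l' l. (\<Sum>k\<in>UNIV. dir (pl q (fst k)) (snd k) l * a l' k) = (if l = l' then e else 0)"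
        by (rule choice[THEN exE])
      then show ?thesis by (intro exI[of _ "\<lambda>k l'. a l' k"]) blast
    qed
  qed
  have "real (card P) ^ 2 \<le> 186624 * real (card (planes_of P)) ^ 3"
    by (rule joints_squared_le) simp_all
  also have "planes_of P \<subseteq> Q" using T(1) \<theta>3 by (auto simp: planes_of_def pl_def)
  then have "real (card (planes_of P)) ^ 3 \<le> real (card Q) ^ 3"
    using Q(1) by (intro power_mono) (auto intro: card_mono)
  finally show ?thesis by simp
qed

end

text \<open>Every field over the type \<open>'a\<close> embeds into the product of all these fields. The factor
  \<^typ>\<open>int\<close> makes the product nontrivial.\<close>

typedef 'a field_prod = "{x :: int \<times> ('a ring \<Rightarrow> 'a).
    \<forall>F. if field F then snd x F \<in> carrier F else snd x F = undefined}"
  by (rule exI[of _ "(0, \<lambda>F. if field F then \<zero>\<^bsub>F\<^esub> else undefined)"])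
    (auto simp: field_def domain_def cring_def ring.ring_simprules)

definition int_part :: "'a field_prod \<Rightarrow> int" where "int_part x = fst (Rep_field_prod x)"

definition component :: "'a ring \<Rightarrow> 'a field_prod \<Rightarrow> 'a" where "component F x = snd (Rep_field_prod x) F"

definition mk_field_prod :: "int \<Rightarrow> ('a ring \<Rightarrow> 'a) \<Rightarrow> 'a field_prod" where
  "mk_field_prod k f = Abs_field_prod (k, \<lambda>F. if field F then f F else undefined)"

lemma component_closed: "field F \<Longrightarrow> component F x \<in> carrier F"
  using Rep_field_prod[of x] by (auto simp: component_def split: if_splits)

lemma field_prod_eqI:
  assumes "int_part x = int_part y" "\<And>F. field F \<Longrightarrow> component F x = component F y"
  shows "x = y"
proof -
  have "snd (Rep_field_prod x) = snd (Rep_field_prod y)"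
  proof
    fix F
    show "snd (Rep_field_prod x) F = snd (Rep_field_prod y) F"
      using assms(2)[of F] Rep_field_prod[of x] Rep_field_prod[of y]
      by (cases "field F") (auto simp: component_def dest!: spec[of _ F])
  qed
  then show ?thesis
    using assms(1) by (simp add: int_part_def Rep_field_prod_inject[symmetric] prod_eq_iff)
qed

lemma mk_field_prod:
  assumes "\<And>F. field F \<Longrightarrow> f F \<in> carrier F"
  shows "int_part (mk_field_prod k f) = k" "field F \<Longrightarrow> component F (mk_field_prod k f) = f F"
proof -
  have "Rep_field_prod (mk_field_prod k f) = (k, \<lambda>F. if field F then f F else undefined)"
    unfolding mk_field_prod_def by (rule Abs_field_prod_inverse) (use assms in auto)
  then show "int_part (mk_field_prod k f) = k" "field F \<Longrightarrow> component F (mk_field_prod k f) = f F"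
    by (simp_all add: int_part_def component_def)
qed

lemma field_cring: "field F \<Longrightarrow> cring F"
  by (simp add: field_def domain_def)

instantiation field_prod :: (type) comm_ring_1
begin

definition "0 = mk_field_prod 0 (\<lambda>F. \<zero>\<^bsub>F\<^esub>)"
definition "1 = mk_field_prod 1 (\<lambda>F. \<one>\<^bsub>F\<^esub>)"
definition "x + y = mk_field_prod (int_part x + int_part y) (\<lambda>F. component F x \<oplus>\<^bsub>F\<^esub> component F y)"
definition "x * y = mk_field_prod (int_part x * int_part y) (\<lambda>F. component F x \<otimes>\<^bsub>F\<^esub> component F y)"
definition "- x = mk_field_prod (- int_part x) (\<lambda>F. \<ominus>\<^bsub>F\<^esub> component F x)"
definition "x - y = mk_field_prod (int_part x - int_part y) (\<lambda>F. component F x \<ominus>\<^bsub>F\<^esub> component F y)"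

lemma field_prod_simps:
  "int_part 0 = 0" "int_part 1 = 1" "int_part (x + y) = int_part x + int_part y"
  "int_part (x * y) = int_part x * int_part y" "int_part (- x) = - int_part x"
  "int_part (x - y) = int_part x - int_part y"
  "field F \<Longrightarrow> component F 0 = \<zero>\<^bsub>F\<^esub>" "field F \<Longrightarrow> component F 1 = \<one>\<^bsub>F\<^esub>"
  "field F \<Longrightarrow> component F (x + y) = component F x \<oplus>\<^bsub>F\<^esub> component F y"
  "field F \<Longrightarrow> component F (x * y) = component F x \<otimes>\<^bsub>F\<^esub> component F y"
  "field F \<Longrightarrow> component F (- x) = \<ominus>\<^bsub>F\<^esub> component F x"
  "field F \<Longrightarrow> component F (x - y) = component F x \<ominus>\<^bsub>F\<^esub> component F y"
  unfolding zero_field_prod_def one_field_prod_def plus_field_prod_def times_field_prod_def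
    uminus_field_prod_def minus_field_prod_def
  by (subst mk_field_prod; simp add: component_closed field_cring cring.cring_simprules)+

instance
proof
  fix x y z :: "'a field_prod"
  show "0 \<noteq> (1 :: 'a field_prod)" using field_prod_simps(1,2) by (metis zero_neq_one)
qed (rule field_prod_eqI; simp add: field_prod_simps algebra_simps;
    simp add: component_closed field_cring cring.cring_simprules)+

end

text \<open>An element goes to its own component, with zero in all others and in the integer part.
  Multiplication by the image of \<open>\<one>\<close> is the projection to this component.\<close>

lemma exists_embedding_ring:
  fixes F :: "'a ring" (structure)
  assumes F: "field F"
  shows "\<exists>(\<iota> :: 'a \<Rightarrow> 'a field_prod) e. embedded_field F \<iota> e"
proof -
  interpret field F by fact
  define \<iota> where "\<iota> a = mk_field_prod 0 (\<lambda>G. if G = F then a else \<zero>\<^bsub>G\<^esub>)" for a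
  have cl: "field G \<Longrightarrow> (if G = F then a else \<zero>\<^bsub>G\<^esub>) \<in> carrier G" if "a \<in> carrier F" for a G
    using that by (auto simp: field_cring cring.cring_simprules)
  have int: "int_part (\<iota> a) = 0" if "a \<in> carrier F" for a
    unfolding \<iota>_def by (rule mk_field_prod(1)) (use cl[OF that] in auto)
  have comp: "component G (\<iota> a) = (if G = F then a else \<zero>\<^bsub>G\<^esub>)" if "field G" "a \<in> carrier F" for a G
    unfolding \<iota>_def by (rule mk_field_prod(2)) (use cl[OF that(2)] that(1) in auto)
  have "embedded_field F \<iota> (\<iota> \<one>)"
  proof unfold_locales
    fix a b assume ab: "a \<in> carrier F" "b \<in> carrier F"
    show "\<iota> (a \<oplus> b) = \<iota> a + \<iota> b"
      by (rule field_prod_eqI) (use ab in \<open>auto simp: int comp field_prod_simps field_cring cring.cring_simprules\<close>)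
    show "\<iota> (a \<otimes> b) = \<iota> a * \<iota> b"
      by (rule field_prod_eqI) (use ab in \<open>auto simp: int comp field_prod_simps field_cring cring.cring_simprules\<close>)
  next
    show "inj_on \<iota> (carrier F)" by (rule inj_onI) (metis F comp)
    fix x
    have "\<iota> \<one> * x = \<iota> (component F x)"
      by (rule field_prod_eqI)
        (use F in \<open>auto simp: int comp field_prod_simps component_closed field_cring cring.cring_simprules\<close>)
    then show "\<iota> \<one> * x = x \<longleftrightarrow> x \<in> \<iota> ` carrier F"
      using component_closed[OF F] comp[OF F] by (metis image_iff)
  qed simp
  then show ?thesis by blast
qed

text \<open>The product is indexed by records of type \<open>'a ring\<close>, so an extended record
  is truncated first.\<close>

lemma exists_embedding:
  fixes F :: "('a, 'm) ring_scheme"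
  assumes F: "field F"
  shows "\<exists>(\<iota> :: 'a \<Rightarrow> 'a field_prod) e. embedded_field F \<iota> e"
proof -
  define F' :: "'a ring" where
    "F' = \<lparr>carrier = carrier F, mult = mult F, one = one F, zero = zero F, add = add F\<rparr>"
  have "(\<lambda>x. x) \<in> ring_iso F F'"
    by (simp add: ring_iso_def ring_hom_def F'_def bij_betw_def)
  then have "field F'"
    using field.ring_iso_imp_img_field[OF F, of "\<lambda>x. x" F'] by (simp add: F'_def)
  then obtain \<iota> :: "'a \<Rightarrow> 'a field_prod" and e where "embedded_field F' \<iota> e"
    using exists_embedding_ring by blast
  then have "embedded_field F \<iota> e"
    using F by (simp add: embedded_field_def embedded_field_axioms_def F'_def)
  then show ?thesis by blast
qed

lemma joints_bound_432:
  fixes F :: "('a, 'm) ring_scheme"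
  assumes F: "field F"
  shows "joints_bound F 432"
  unfolding joints_bound_def
proof (intro allI impI)
  fix N :: nat and Q assume N: "N > 0" and Q: "(\<forall>A\<in>Q. plane F 6 A) \<and> finite Q \<and> card Q = N"
  obtain \<iota> :: "'a \<Rightarrow> 'a field_prod" and e where emb: "embedded_field F \<iota> e"
    using exists_embedding[OF F] by blast
  have sub: "real (card P) \<le> 432 * real N powr (3 / 2)" if P: "finite P" "P \<subseteq> joints F Q" for P
  proof (rule power2_le_imp_le)
    have "real (card P) ^ 2 \<le> 186624 * real N ^ 3"
      using embedded_field.card_joints_subset[OF emb, of Q P] Q P by blast
    also have "\<dots> = (432 * real N powr (3 / 2)) ^ 2"
    proof -
      have "(real N powr (3 / 2)) ^ 2 = real N powr 3" by (simp add: power2_eq_square flip: powr_add)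
      also have "\<dots> = real N ^ 3" using N by (simp add: powr_numeral)
      finally show ?thesis by (simp add: power_mult_distrib)
    qed
    finally show "real (card P) ^ 2 \<le> (432 * real N powr (3 / 2)) ^ 2" .
  qed simp
  have "finite (joints F Q)"
  proof (rule ccontr)
    assume "infinite (joints F Q)"
    \<comment> \<open>An infinite set would contain a finite subset that exceeds the bound.\<close>
    then obtain P where P: "finite P" "card P = nat \<lceil>432 * real N powr (3 / 2)\<rceil> + 1" "P \<subseteq> joints F Q"
      using infinite_arbitrarily_large by blast
    have "432 * real N powr (3 / 2) \<le> real (nat \<lceil>432 * real N powr (3 / 2)\<rceil>)" by (rule real_nat_ceiling_ge)
    then show False using sub[OF P(1,3)] unfolding P(2) of_nat_add of_nat_1 by linarith
  qed
  then show "finite (joints F Q) \<and> real (card (joints F Q)) \<le> 432 * real N powr (3 / 2)"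
    using sub by blast
qed

section \<open>Descent to a countable subfield\<close>

text \<open>Expressions over countably many generators: there are only countably many, and their
  values form a subfield.\<close>

datatype field_term = Gen nat | One | Neg field_term | Inv field_term
  | Add field_term field_term | Mult field_term field_term

instance field_term :: countable
  by countable_datatype

lemma (in field) countable_subfield:
  assumes "finite G" "G \<subseteq> carrier R"
  shows "\<exists>K. subfield K R \<and> countable K \<and> G \<subseteq> K"
proof -
  define g where "g = from_nat_into (insert \<one> G)"
  have g: "range g = insert \<one> G"
    unfolding g_def using assms(1) by (intro range_from_nat_into) (auto intro: countable_finite)
  \<comment> \<open>The inverse of zero is given the value zero, so that every expression has a
    value in the field.\<close>
  define ev where "ev = rec_field_term g \<one> (\<lambda>_ a. \<ominus> a) (\<lambda>_ a. if a = \<zero> then \<zero> else inv a)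
    (\<lambda>_ _ a b. a \<oplus> b) (\<lambda>_ _ a b. a \<otimes> b)"
  have ev: "ev (Gen n) = g n" "ev One = \<one>" "ev (Neg s) = \<ominus> ev s"
    "ev (Inv s) = (if ev s = \<zero> then \<zero> else inv (ev s))"
    "ev (Add s t) = ev s \<oplus> ev t" "ev (Mult s t) = ev s \<otimes> ev t" for n s t
    by (simp_all add: ev_def)
  have "g n \<in> carrier R" for n using g assms(2) by (metis insertE one_closed rangeI subsetD)
  then have closed: "ev t \<in> carrier R" for t
    by (induction t) (auto simp: ev field_Units)
  have "subring (range ev) R"
  proof (rule subringI)
    show "range ev \<subseteq> carrier R" using closed by blast
    show "\<one> \<in> range ev" using ev(2) by (metis rangeI)
  next
    fix h assume "h \<in> range ev"
    then obtain s where "h = ev s" by blast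
    then have "\<ominus> h = ev (Neg s)" by (simp add: ev(3))
    then show "\<ominus> h \<in> range ev" by blast
  next
    fix h k assume "h \<in> range ev" "k \<in> range ev"
    then obtain s t where "h = ev s" "k = ev t" by blast
    then have "h \<otimes> k = ev (Mult s t)" "h \<oplus> k = ev (Add s t)" by (simp_all add: ev(5,6))
    then show "h \<otimes> k \<in> range ev" "h \<oplus> k \<in> range ev" by blast+
  qed
  moreover have "inv k \<in> range ev" if k: "k \<in> range ev - {\<zero>}" for k
  proof -
    obtain s where "k = ev s" using k by blast
    then have "inv k = ev (Inv s)" using k by (simp add: ev(4))
    then show ?thesis by blast
  qed
  ultimately have "subfield (range ev) R" by (rule subfieldI')
  moreover have "G \<subseteq> range ev" 
  proof
    fix a assume "a \<in> G"
    then obtain n where "a = g n" using g by blast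
    then show "a \<in> range ev" using ev(1) by (metis rangeI)
  qed
  ultimately show ?thesis by blast
qed

text \<open>Numbering a countable subfield transports its operations to a set of natural numbers;
  \<omega> undoes the numbering.\<close>

lemma countable_field_hom:
  fixes F :: "('a, 'm) ring_scheme" (structure)
  assumes F: "field F" and G: "finite G" "G \<subseteq> carrier F"
  shows "\<exists>(L :: nat ring) \<omega>. field L \<and> \<omega> \<in> ring_hom L F \<and> inj_on \<omega> (carrier L) \<and> G \<subseteq> \<omega> ` carrier L"
proof -
  interpret field F by fact
  obtain K where K: "subfield K F" "countable K" "G \<subseteq> K" using countable_subfield[OF G] by blast
  define FK where "FK = F\<lparr>carrier := K\<rparr>"
  have FK: "field FK" unfolding FK_def using K(1) by (rule subfield_iff(2))
  then interpret FK: field FK .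
  have KF: "K \<subseteq> carrier F" using K(1) by (rule subfieldE(3))
  have inj: "inj_on (to_nat_on K) (carrier FK)" using inj_on_to_nat_on[OF K(2)] by (simp add: FK_def)
  define L where "L = image_ring (to_nat_on K) FK"
  define \<omega> where "\<omega> = inv_into (carrier FK) (to_nat_on K)"
  have "field L" unfolding L_def by (rule FK.inj_imp_image_ring_is_field[OF inj])
  moreover have iso: "\<omega> \<in> ring_iso L FK"
    unfolding L_def \<omega>_def by (rule ring_iso_set_sym[OF FK.ring_axioms inj_imp_image_ring_iso[OF inj]])
  have "\<omega> \<in> ring_hom L F"
    using iso KF by (auto simp: ring_iso_def ring_hom_def FK_def)
  moreover have "bij_betw \<omega> (carrier L) K"
    using iso by (simp add: ring_iso_def FK_def)
  ultimately show ?thesis using K(3) by (metis bij_betw_def)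
qed

section \<open>Transfer of a configuration to the countable field\<close>

lemma indep_family_hom:
  fixes F :: "('a, 'm) ring_scheme" and L :: "('b, 'n) ring_scheme"
  assumes hom: "ring_hom_cring L F \<omega>" and inj: "inj_on \<omega> (carrier L)"
    and v: "v' \<in> I \<rightarrow> affine_space L d" "\<And>j i. j \<in> I \<Longrightarrow> i < d \<Longrightarrow> \<omega> (v' j i) = v j i"
    and indep: "indep_family F d I v"
  shows "indep_family L d I v'"
  unfolding indep_family_def
proof (intro ballI impI)
  interpret ring_hom_cring L F \<omega> by fact
  fix c j assume c: "c \<in> I \<rightarrow> carrier L" and 0: "\<forall>i<d. (\<Oplus>\<^bsub>L\<^esub>j\<in>I. c j \<otimes>\<^bsub>L\<^esub> v' j i) = \<zero>\<^bsub>L\<^esub>" and j: "j \<in> I"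
  have vc: "v' j i \<in> carrier L" if "j \<in> I" "i < d" for i j
    using v(1) that by (auto simp: affine_space_def)
  have fv: "v j i \<in> carrier F" if "j \<in> I" "i < d" for i j
    using hom_closed[OF vc[OF that]] v(2)[OF that] by simp
  have "(\<Oplus>\<^bsub>F\<^esub>j\<in>I. \<omega> (c j) \<otimes>\<^bsub>F\<^esub> v j i) = \<zero>\<^bsub>F\<^esub>" if i: "i < d" for i
  proof -
    have "(\<Oplus>\<^bsub>F\<^esub>j\<in>I. \<omega> (c j) \<otimes>\<^bsub>F\<^esub> v j i) = (\<Oplus>\<^bsub>F\<^esub>j\<in>I. (\<omega> \<circ> (\<lambda>j. c j \<otimes>\<^bsub>L\<^esub> v' j i)) j)"
      using c vc i v(2) fv by (intro S.finsum_cong') (auto simp: Pi_iff)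
    also have "\<dots> = \<omega> (\<Oplus>\<^bsub>L\<^esub>j\<in>I. c j \<otimes>\<^bsub>L\<^esub> v' j i)"
      using c vc i by (intro hom_finsum[symmetric]) auto
    finally show ?thesis using 0 i by simp
  qed
  moreover have "(\<lambda>j. \<omega> (c j)) \<in> I \<rightarrow> carrier F" using c by auto
  moreover from this have "(\<forall>i<d. (\<Oplus>\<^bsub>F\<^esub>j\<in>I. \<omega> (c j) \<otimes>\<^bsub>F\<^esub> v j i) = \<zero>\<^bsub>F\<^esub>) \<longrightarrow>
      (\<forall>j\<in>I. \<omega> (c j) = \<zero>\<^bsub>F\<^esub>)"
    by (rule bspec[OF indep[unfolded indep_family_def], where x = "\<lambda>j. \<omega> (c j)"])
  ultimately have "\<omega> (c j) = \<omega> \<zero>\<^bsub>L\<^esub>" unfolding hom_zero using j by blast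
  then show "c j = \<zero>\<^bsub>L\<^esub>" by (rule inj_onD[OF inj]) (use c j in auto)
qed

text \<open>The inequality \<open>card Q' \<le> card Q\<close> suffices because the bound is
  monotone in the number of planes. The implication about empty sets guards the hypothesis that this
  number is positive.\<close>

lemma joints_transfer:
  fixes F :: "('a, 'm) ring_scheme"
  assumes F: "field F" and Q: "finite Q" "\<And>A. A \<in> Q \<Longrightarrow> plane F 6 A" and P: "finite P" "P \<subseteq> joints F Q"
  shows "\<exists>(L :: nat ring) Q' P'. field L \<and> finite Q' \<and> (\<forall>A\<in>Q'. plane L 6 A) \<and> card Q' \<le> card Q \<and>
    (Q' = {} \<longrightarrow> Q = {}) \<and> P' \<subseteq> joints L Q' \<and> card P' = card P"
proof -
  obtain \<iota> :: "'a \<Rightarrow> 'a field_prod" and e where "embedded_field F \<iota> e" using exists_embedding[OF F] by blast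
  then interpret F: embedded_field F \<iota> e .
  have "\<forall>A\<in>Q. \<exists>p v. p \<in> affine_space F 6 \<and> v \<in> {..<2} \<rightarrow> affine_space F 6 \<and> lin_indep F 6 2 v \<and> A = F.flat_set 6 2 p v"
    using Q(2) unfolding F.flat_iff by blast
  then obtain og dir where og: "\<And>A. A \<in> Q \<Longrightarrow> og A \<in> affine_space F 6"
    and dir: "\<And>A. A \<in> Q \<Longrightarrow> dir A \<in> {..<2} \<rightarrow> affine_space F 6"
    and li: "\<And>A. A \<in> Q \<Longrightarrow> lin_indep F 6 2 (dir A)"
    and A: "\<And>A. A \<in> Q \<Longrightarrow> A = F.flat_set 6 2 (og A) (dir A)"
    by metis
  have "\<forall>x\<in>P. \<exists>T. (\<forall>i<3. T i \<in> Q \<and> x \<in> T i) \<and> F.indep_directions 6 3 (\<lambda>i. dir (T i))"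
    using F.joint_indep_directions[OF og dir A] P(2) by blast
  then obtain T where T: "\<And>x i. x \<in> P \<Longrightarrow> i < 3 \<Longrightarrow> T x i \<in> Q" "\<And>x i. x \<in> P \<Longrightarrow> i < 3 \<Longrightarrow> x \<in> T x i"
    and indep: "\<And>x. x \<in> P \<Longrightarrow> F.indep_directions 6 3 (\<lambda>i. dir (T x i))"
    by metis
  have "\<exists>c. c \<in> {..<2} \<rightarrow> carrier F \<and> (A \<in> Q \<longrightarrow> x \<in> A \<longrightarrow>
      (\<forall>i<6. x i = og A i \<oplus>\<^bsub>F\<^esub> (\<Oplus>\<^bsub>F\<^esub>j\<in>{..<2}. c j \<otimes>\<^bsub>F\<^esub> dir A j i)))" for A x
  proof (cases "A \<in> Q \<and> x \<in> A")
    case True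
    then have "x \<in> F.flat_set 6 2 (og A) (dir A)" using A by blast
    then show ?thesis unfolding F.flat_set_def by auto
  qed (auto intro: exI[of _ "\<lambda>_. \<zero>\<^bsub>F\<^esub>"])
  then obtain c where c: "\<And>A x. c A x \<in> {..<2} \<rightarrow> carrier F"
    "\<And>A x i. A \<in> Q \<Longrightarrow> x \<in> A \<Longrightarrow> i < 6 \<Longrightarrow> x i = og A i \<oplus>\<^bsub>F\<^esub> (\<Oplus>\<^bsub>F\<^esub>j\<in>{..<2}. c A x j \<otimes>\<^bsub>F\<^esub> dir A j i)"
    by metis
  \<comment> \<open>The coordinates \<open>c\<close> of the joints on their planes are included, so
    that the incidences can be written down over the small field.\<close>
  define G where "G = (\<lambda>(A, i). og A i) ` (Q \<times> {..<6}) \<union> (\<lambda>(A, j, i). dir A j i) ` (Q \<times> {..<2} \<times> {..<6}) \<union>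
    (\<lambda>(x, i). x i) ` (P \<times> {..<6}) \<union> (\<lambda>(A, x, j). c A x j) ` (Q \<times> P \<times> {..<2})"
  have finG: "finite G" unfolding G_def using Q(1) P(1) by simp
  have Paff: "P \<subseteq> affine_space F 6" using P(2) by (auto simp: joints_def)
  have GF: "G \<subseteq> carrier F"
    unfolding G_def using og dir c(1) Paff by (auto simp: affine_space_def Pi_iff PiE_iff)
  obtain L :: "nat ring" and \<omega> where L: "field L" and \<omega>: "\<omega> \<in> ring_hom L F" "inj_on \<omega> (carrier L)" "G \<subseteq> \<omega> ` carrier L"
    using countable_field_hom[OF F finG GF] by blast
  obtain \<iota>2 :: "nat \<Rightarrow> nat field_prod" and e2 where "embedded_field L \<iota>2 e2" using exists_embedding[OF L] by blast
  then interpret L: embedded_field L \<iota>2 e2 .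
  interpret \<omega>: ring_hom_cring L F \<omega> by unfold_locales (rule \<omega>(1))
  define \<chi> where "\<chi> = inv_into (carrier L) \<omega>"
  have \<chi>: "\<chi> a \<in> carrier L" "\<omega> (\<chi> a) = a" if "a \<in> G" for a
    using \<omega>(3) that by (auto simp: \<chi>_def inv_into_into f_inv_into_f)
  define lift where "lift x = (\<lambda>i\<in>{..<6::nat}. \<chi> (x i))" for x
  have lift: "lift x \<in> affine_space L 6" "\<And>i. i < 6 \<Longrightarrow> \<omega> (lift x i) = x i" if "\<forall>i<6. x i \<in> G" for x
    using \<chi> that by (auto simp: lift_def affine_space_def)
  have G_og: "og A i \<in> G" if "A \<in> Q" "i < 6" for A i unfolding G_def using that by force
  have G_dir: "dir A j i \<in> G" if "A \<in> Q" "j < 2" "i < 6" for A j i unfolding G_def using that by force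
  have G_P: "x i \<in> G" if "x \<in> P" "i < 6" for x i unfolding G_def using that by force
  have G_c: "c A x j \<in> G" if "A \<in> Q" "x \<in> P" "j < 2" for A x j unfolding G_def using that by force
  have lift_P: "lift x \<in> affine_space L 6" "\<And>i. i < 6 \<Longrightarrow> \<omega> (lift x i) = x i" if "x \<in> P" for x
    using lift[of x] G_P[OF that] by auto
  define og' where "og' A = lift (og A)" for A
  define dir' where "dir' A j = lift (dir A j)" for A j
  have og': "og' A \<in> affine_space L 6" "\<And>i. i < 6 \<Longrightarrow> \<omega> (og' A i) = og A i" if "A \<in> Q" for A
    using lift[of "og A"] G_og[OF that] by (auto simp: og'_def)
  have dir'1: "dir' A j \<in> affine_space L 6" "\<And>i. i < 6 \<Longrightarrow> \<omega> (dir' A j i) = dir A j i" if "A \<in> Q" "j < 2" for A j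
    using lift[of "dir A j"] G_dir[OF that] by (auto simp: dir'_def)
  have dir': "dir' A \<in> {..<2} \<rightarrow> affine_space L 6" if "A \<in> Q" for A using dir'1 that by auto
  define fl where "fl A = L.flat_set 6 2 (og' A) (dir' A)" for A
  define Q' where "Q' = fl ` Q"
  have plane: "plane L 6 (fl A)" if AQ: "A \<in> Q" for A
  proof -
    have "indep_family L 6 {..<2} (dir' A)"
      using li[OF AQ] dir'1(2)[OF AQ] unfolding lin_indep_eq
      by (intro indep_family_hom[OF \<omega>.ring_hom_cring_axioms \<omega>(2) dir'[OF AQ]]) auto
    then show ?thesis
      unfolding L.flat_iff lin_indep_eq fl_def using og'[OF AQ] dir'[OF AQ] by blast
  qed
  have mem: "lift x \<in> fl A" if x: "x \<in> P" "A \<in> Q" "x \<in> A" for x A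
  proof -
    let ?c = "\<lambda>j. \<chi> (c A x j)"
    let ?y = "\<lambda>i\<in>{..<6}. og' A i \<oplus>\<^bsub>L\<^esub> (\<Oplus>\<^bsub>L\<^esub>j\<in>{..<2}. ?c j \<otimes>\<^bsub>L\<^esub> dir' A j i)"
    have cc: "?c \<in> {..<2} \<rightarrow> carrier L" using \<chi>(1) G_c x by auto
    have "?y = lift x"
    proof
      fix i
      show "?y i = lift x i"
      proof (cases "i < 6")
        case i: True
        have oc: "og' A i \<in> carrier L" and dc: "\<And>j. j < 2 \<Longrightarrow> dir' A j i \<in> carrier L"
          using og'(1)[OF x(2)] dir'1(1)[OF x(2)] i by (auto simp: affine_space_def)
        have sc: "(\<Oplus>\<^bsub>L\<^esub>j\<in>{..<2}. ?c j \<otimes>\<^bsub>L\<^esub> dir' A j i) \<in> carrier L"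
          using cc dc by (intro L.finsum_closed) auto
        have "\<omega> (?y i) = og A i \<oplus>\<^bsub>F\<^esub> \<omega> (\<Oplus>\<^bsub>L\<^esub>j\<in>{..<2}. ?c j \<otimes>\<^bsub>L\<^esub> dir' A j i)"
          using i oc sc og'(2)[OF x(2) i] by simp
        also have "\<omega> (\<Oplus>\<^bsub>L\<^esub>j\<in>{..<2}. ?c j \<otimes>\<^bsub>L\<^esub> dir' A j i) =
            (\<Oplus>\<^bsub>F\<^esub>j\<in>{..<2}. (\<omega> \<circ> (\<lambda>j. ?c j \<otimes>\<^bsub>L\<^esub> dir' A j i)) j)"
          using cc dc by (intro \<omega>.hom_finsum) auto
        also have "\<dots> = (\<Oplus>\<^bsub>F\<^esub>j\<in>{..<2}. c A x j \<otimes>\<^bsub>F\<^esub> dir A j i)"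
        proof (rule F.finsum_cong')
          show "(\<lambda>j. c A x j \<otimes>\<^bsub>F\<^esub> dir A j i) \<in> {..<2} \<rightarrow> carrier F"
            using G_c[OF x(2,1)] G_dir[OF x(2) _ i] GF by auto
          fix j :: nat assume "j \<in> {..<2}"
          then have j: "j < 2" by simp
          have "?c j \<in> carrier L" using cc j by auto
          then show "(\<omega> \<circ> (\<lambda>j. ?c j \<otimes>\<^bsub>L\<^esub> dir' A j i)) j = c A x j \<otimes>\<^bsub>F\<^esub> dir A j i"
            using dc[OF j] \<chi>(2)[OF G_c[OF x(2,1) j]] dir'1(2)[OF x(2) j i] by simp
        qed simp
        also have "og A i \<oplus>\<^bsub>F\<^esub> \<dots> = \<omega> (lift x i)" using c(2)[OF x(2,3) i] lift_P(2)[OF x(1) i] by simp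
        finally have "\<omega> (?y i) = \<omega> (lift x i)" .
        moreover have "?y i \<in> carrier L" using i oc sc by simp
        moreover have "lift x i \<in> carrier L"
          using lift_P(1)[OF x(1)] i by (auto simp: affine_space_def)
        ultimately show ?thesis by (rule inj_onD[OF \<omega>(2)])
      qed (simp add: lift_def)
    qed
    then show ?thesis
      unfolding fl_def L.flat_set_def using cc by (intro image_eqI[where x = ?c]) (simp_all only:)
  qed
  have joint: "lift x \<in> joints L Q'" if x: "x \<in> P" for x
  proof -
    have TQ: "T x i \<in> Q" if "i < 3" for i using T(1) x that by blast
    have ind: "L.indep_directions 6 3 (\<lambda>i. dir' (T x i))"
      unfolding L.indep_directions_def
    proof (rule indep_family_hom[OF \<omega>.ring_hom_cring_axioms \<omega>(2)])
      show "indep_family F 6 ({..<3} \<times> {..<2}) (\<lambda>k. dir (T x (fst k)) (snd k))"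
        using indep[OF x] unfolding F.indep_directions_def .
    qed (use TQ dir'1 in auto)
    \<comment> \<open>\<open>joints\<close> asks for three different planes, so the images must not
      coincide.\<close>
    have neq: "fl (T x i) \<noteq> fl (T x j)" if "i < 3" "j < 3" "i \<noteq> j" for i j
      unfolding fl_def
      by (rule L.flats_distinct[where m = 3 and p = "\<lambda>i. og' (T x i)" and v = "\<lambda>i. dir' (T x i)"])
        (use that og' dir' TQ ind in auto)
    have "\<not> (\<exists>H. hyperplane L (2 * 3) H \<and> (\<forall>t<3. L.flat_set (2 * 3) 2 (og' (T x t)) (dir' (T x t)) \<subseteq> H))"
      by (rule L.not_in_hyperplane) (use og' dir' TQ ind in auto)
    then have not: "\<not> (\<exists>H. hyperplane L 6 H \<and> (\<forall>t<3. fl (T x t) \<subseteq> H))" unfolding fl_def by simp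
    have sub: "\<forall>t<3. fl (T x t) \<subseteq> H" if "fl (T x 0) \<subseteq> H" "fl (T x 1) \<subseteq> H" "fl (T x 2) \<subseteq> H" for H
      using that by (auto simp: less_Suc_eq numeral_3_eq_3 numeral_2_eq_2)
    show ?thesis
      unfolding joints_def
    proof (intro CollectI conjI bexI)
      show "lift x \<in> affine_space L 6" by (rule lift_P(1)[OF x])
      show "\<not> (\<exists>H. hyperplane L 6 H \<and> fl (T x 0) \<subseteq> H \<and> fl (T x 1) \<subseteq> H \<and> fl (T x 2) \<subseteq> H)"
        using not sub by blast
    qed (use neq mem T x TQ in \<open>auto simp: Q'_def\<close>)
  qed
  have "inj_on lift P"
  proof (rule inj_onI)
    fix x y assume xy: "x \<in> P" "y \<in> P" "lift x = lift y"
    show "x = y"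
    proof (rule F.affine_space_eqI)
      fix i :: nat assume "i < 6"
      then show "\<iota> (x i) = \<iota> (y i)"
        using lift_P(2)[OF xy(1)] lift_P(2)[OF xy(2)] xy(3) by metis
    qed (use xy Paff in auto)
  qed
  then have "card (lift ` P) = card P" by (rule card_image)
  moreover have "lift ` P \<subseteq> joints L Q'" using joint by blast
  moreover have "card Q' \<le> card Q" "finite Q'" "Q' = {} \<longrightarrow> Q = {}"
    using Q(1) by (auto simp: Q'_def card_image_le)
  moreover have "\<forall>A\<in>Q'. plane L 6 A" using plane by (auto simp: Q'_def)
  ultimately show ?thesis using L by blast
qed

lemma joints_constant_works: "joints_constant > 0 \<and> (\<forall>F :: nat ring. field F \<longrightarrow> joints_bound F joints_constant)"
  unfolding joints_constant_def
proof (rule someI_ex)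
  show "\<exists>C>0. \<forall>F :: nat ring. field F \<longrightarrow> joints_bound F C"
    by (rule exI[of _ 432]) (simp add: joints_bound_432)
qed

text \<open>\<open>joints_constant\<close> may be smaller than 432, so
  \<open>joints_bound_432\<close> yields only the finiteness. The number of joints is compared with
  that of a configuration over the natural numbers, where the constant is known to serve.\<close>

theorem theorem1p2:
  "joints_constant > 0 \<and>
   (\<forall>F :: ('a, 'm) ring_scheme. field F \<longrightarrow>
      (\<forall>N::nat. N > 0 \<longrightarrow>
         (\<forall>Q. (\<forall>A\<in>Q. plane F 6 A) \<and> finite Q \<and> card Q = N \<longrightarrow>
            finite (joints F Q) \<and>
            real (card (joints F Q)) \<le> joints_constant * real N powr (3 / 2))))"
proof (intro conjI allI impI)
  show pos: "joints_constant > 0" using joints_constant_works by blast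
  fix F :: "('a, 'm) ring_scheme" and N :: nat and Q
  assume F: "field F" and N: "N > 0" and Q: "(\<forall>A\<in>Q. plane F 6 A) \<and> finite Q \<and> card Q = N"
  show fin: "finite (joints F Q)" using joints_bound_432[OF F] N Q unfolding joints_bound_def by blast
  obtain L :: "nat ring" and Q' P' where L: "field L" and Q': "finite Q'" "\<forall>A\<in>Q'. plane L 6 A" "card Q' \<le> card Q"
      "Q' = {} \<longrightarrow> Q = {}" and P': "P' \<subseteq> joints L Q'" "card P' = card (joints F Q)"
    using joints_transfer[OF F, of Q "joints F Q"] Q fin by blast
  have "Q' \<noteq> {}" using Q'(4) Q N by auto
  then have "card Q' > 0" using Q'(1) by (simp add: card_gt_0_iff)
  then have bound: "finite (joints L Q')" "real (card (joints L Q')) \<le> joints_constant * real (card Q') powr (3 / 2)"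
    using joints_constant_works L Q'(1,2) unfolding joints_bound_def by blast+
  have "real (card (joints F Q)) \<le> real (card (joints L Q'))"
    using card_mono[OF bound(1) P'(1)] P'(2) by simp
  also note bound(2)
  also have "joints_constant * real (card Q') powr (3 / 2) \<le> joints_constant * real N powr (3 / 2)"
    using Q'(3) Q pos by (intro mult_left_mono powr_mono2) auto
  finally show "real (card (joints F Q)) \<le> joints_constant * real N powr (3 / 2)" .
qed

end
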